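(* Let $M$ be a closed connected oriented smooth manifold with a Riemannian metric $g$ and a volume form $\Omega$ with $\int_M\Omega=1$. For $h\in\mathrm{Homeo}_0(M,\Omega)$ put $$\|h\|^{\infty,0}:=\sup_{\alpha\in\mathcal B(1)}\Big(\sup_{z\in M}\Big|\int_M I_\alpha(h,z,y)\,\Omega(y)\Big|\Big)\in\overline{\mathbb R},$$ where $\mathcal B(1)$ is the set of closed 1-forms $\alpha$ on $M$ with $\|\alpha\|_{L^2}=1$. Then: (1) $\|h\|^{\infty,0}\ge0$ for all $h\in\mathrm{Homeo}_0(M,\Omega)$; (2) $\|h\circ k\|^{\infty,0}\le\|h\|^{\infty,0}+\|k\|^{\infty,0}$ for all $h,k\in\mathrm{Homeo}_0(M,\Omega)$; (3) $\|h^{-1}\|^{\infty,0}=\|h\|^{\infty,0}$ for all $h\in\mathrm{Homeo}_0(M,\Omega)$; (4) if $\|h\|^{\infty,0}=0$, then $h=\mathrm{id}_M$.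
   Context: $\mathrm{Homeo}_0(M,\Omega)$ is the identity component ($C^0$ topology) of the group of homeomorphisms of $M$ preserving $\Omega$ (i.e. the associated measure). For a closed 1-form $\alpha$, $h$ isotopic to the identity, and $x,y\in M$, $I_\alpha(h,x,y):=\int_{h\circ\gamma}\alpha-\int_\gamma\alpha$ for any $C^1$ curve $\gamma$ from $x$ to $y$ (the value is independent of $\gamma$); the integral of a closed 1-form along a merely continuous curve is defined in the usual way through local primitives. *)

theory Defs
  imports "HOL-Analysis.Analysis"
begin

section \<open>Smooth maps between Euclidean spaces\<close>

text \<open>Meaningful for an open set \<open>S\<close> in a finite-dimensional space, where a map is \<open>C\<^sup>k\<^sup>+\<^sup>1\<close> iff it
  is differentiable and all its directional derivatives are \<open>C\<^sup>k\<close>.\<close>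

primrec Ck_on :: "nat \<Rightarrow> 'a::euclidean_space set \<Rightarrow> ('a \<Rightarrow> 'b::real_normed_vector) \<Rightarrow> bool" where
  "Ck_on 0 S f \<longleftrightarrow> continuous_on S f"
| "Ck_on (Suc k) S f \<longleftrightarrow>
     (\<forall>x\<in>S. f differentiable (at x)) \<and> (\<forall>v. Ck_on k S (\<lambda>x. frechet_derivative f (at x) v))"

definition smooth_on :: "'a::euclidean_space set \<Rightarrow> ('a \<Rightarrow> 'b::real_normed_vector) \<Rightarrow> bool" where
  "smooth_on S f \<longleftrightarrow> (\<forall>k. Ck_on k S f)"

section \<open>Closed connected oriented smooth manifolds\<close>

text \<open>The manifold is the whole type \<open>'m\<close>, and \<open>n = CARD('n) \<ge> 1\<close> is its dimension. A chart is a pair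
  of a domain and a coordinate map; the coordinate map is only relevant on the domain. The smooth
  oriented structure is given by an atlas that need not be maximal.\<close>

type_synonym ('m, 'n) chart = "'m set \<times> ('m \<Rightarrow> real^'n)"

abbreviation cdom :: "('m, 'n) chart \<Rightarrow> 'm set" where
  "cdom c \<equiv> fst c"

abbreviation cmap :: "('m, 'n) chart \<Rightarrow> 'm \<Rightarrow> real^'n" where
  "cmap c \<equiv> snd c"

definition cinv :: "('m, 'n) chart \<Rightarrow> real^'n \<Rightarrow> 'm" where
  "cinv c = inv_into (cdom c) (cmap c)"

definition is_chart :: "('m::topological_space, 'n::finite) chart \<Rightarrow> bool" where
  "is_chart c \<longleftrightarrow> open (cdom c) \<and> open (cmap c ` cdom c) \<and>
     homeomorphism (cdom c) (cmap c ` cdom c) (cmap c) (cinv c)"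

definition transition :: "('m, 'n) chart \<Rightarrow> ('m, 'n) chart \<Rightarrow> real^'n \<Rightarrow> real^'n" where
  "transition c d = cmap d \<circ> cinv c"

abbreviation dtransition :: "('m, 'n::finite) chart \<Rightarrow> ('m, 'n) chart \<Rightarrow> real^'n \<Rightarrow> real^'n \<Rightarrow> real^'n" where
  "dtransition c d x \<equiv> frechet_derivative (transition c d) (at x)"

definition oriented_atlas :: "('m::topological_space, 'n::finite) chart set \<Rightarrow> bool" where
  "oriented_atlas A \<longleftrightarrow>
     (\<forall>c\<in>A. is_chart c) \<and> (\<Union>c\<in>A. cdom c) = UNIV \<and>
     (\<forall>c\<in>A. \<forall>d\<in>A. smooth_on (cmap c ` (cdom c \<inter> cdom d)) (transition c d) \<and>
        (\<forall>x \<in> cmap c ` (cdom c \<inter> cdom d). det (matrix (dtransition c d x)) > 0))"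

definition closed_connected_oriented_manifold ::
    "('m::{t2_space, second_countable_topology}, 'n::finite) chart set \<Rightarrow> bool" where
  "closed_connected_oriented_manifold A \<longleftrightarrow>
     oriented_atlas A \<and> compact (UNIV :: 'm set) \<and> connected (UNIV :: 'm set)"

section \<open>Tensor fields\<close>

text \<open>A covariant tensor field is given by its local representations: \<open>\<alpha> c x\<close> is the multilinear map
  representing the field at the point of the chart \<open>c\<close> with coordinates \<open>x\<close>, and the
  representations in two charts are related by pull-back along the transition map. Values at
  \<open>x \<notin> cmap c ` cdom c\<close> or for \<open>c \<notin> A\<close> carry no information.\<close>

type_synonym ('m, 'n) one_form = "('m, 'n) chart \<Rightarrow> real^'n \<Rightarrow> real^'n \<Rightarrow> real"
type_synonym ('m, 'n) two_tensor = "('m, 'n) chart \<Rightarrow> real^'n \<Rightarrow> real^'n \<Rightarrow> real^'n \<Rightarrow> real"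

text \<open>The arguments \<open>v\<^sub>1, \<dots>, v\<^sub>n\<close> of an \<open>n\<close>-form are the rows of a matrix.\<close>

type_synonym ('m, 'n) top_form = "('m, 'n) chart \<Rightarrow> real^'n \<Rightarrow> real^'n^'n \<Rightarrow> real"

definition smooth_one_form ::
    "('m::topological_space, 'n::finite) chart set \<Rightarrow> ('m, 'n) one_form \<Rightarrow> bool" where
  "smooth_one_form A \<alpha> \<longleftrightarrow>
     (\<forall>c\<in>A. (\<forall>x \<in> cmap c ` cdom c. linear (\<alpha> c x)) \<and>
        (\<forall>v. smooth_on (cmap c ` cdom c) (\<lambda>x. \<alpha> c x v))) \<and>
     (\<forall>c\<in>A. \<forall>d\<in>A. \<forall>x \<in> cmap c ` (cdom c \<inter> cdom d). \<forall>v.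
        \<alpha> c x v = \<alpha> d (transition c d x) (dtransition c d x v))"

text \<open>On constant vector fields \<open>d\<alpha>(v, w) = D\<^sub>v (\<alpha>(w)) - D\<^sub>w (\<alpha>(v))\<close>.\<close>

definition closed_one_form ::
    "('m::topological_space, 'n::finite) chart set \<Rightarrow> ('m, 'n) one_form \<Rightarrow> bool" where
  "closed_one_form A \<alpha> \<longleftrightarrow> smooth_one_form A \<alpha> \<and>
     (\<forall>c\<in>A. \<forall>x \<in> cmap c ` cdom c. \<forall>v w.
        frechet_derivative (\<lambda>y. \<alpha> c y w) (at x) v - frechet_derivative (\<lambda>y. \<alpha> c y v) (at x) w = 0)"

definition riemannian_metric ::
    "('m::topological_space, 'n::finite) chart set \<Rightarrow> ('m, 'n) two_tensor \<Rightarrow> bool" where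
  "riemannian_metric A g \<longleftrightarrow>
     (\<forall>c\<in>A. (\<forall>x \<in> cmap c ` cdom c. bilinear (g c x) \<and> (\<forall>v w. g c x v w = g c x w v) \<and>
           (\<forall>v. v \<noteq> 0 \<longrightarrow> g c x v v > 0)) \<and>
        (\<forall>v w. smooth_on (cmap c ` cdom c) (\<lambda>x. g c x v w))) \<and>
     (\<forall>c\<in>A. \<forall>d\<in>A. \<forall>x \<in> cmap c ` (cdom c \<inter> cdom d). \<forall>v w.
        g c x v w = g d (transition c d x) (dtransition c d x v) (dtransition c d x w))"

definition smooth_top_form ::
    "('m::topological_space, 'n::finite) chart set \<Rightarrow> ('m, 'n) top_form \<Rightarrow> bool" where
  "smooth_top_form A \<omega> \<longleftrightarrow>
     (\<forall>c\<in>A. (\<forall>x \<in> cmap c ` cdom c.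
           (\<forall>V i. linear (\<lambda>v. \<omega> c x (\<chi> j. if j = i then v else V $ j))) \<and>
           (\<forall>V i j. i \<noteq> j \<and> V $ i = V $ j \<longrightarrow> \<omega> c x V = 0)) \<and>
        (\<forall>V. smooth_on (cmap c ` cdom c) (\<lambda>x. \<omega> c x V))) \<and>
     (\<forall>c\<in>A. \<forall>d\<in>A. \<forall>x \<in> cmap c ` (cdom c \<inter> cdom d). \<forall>V.
        \<omega> c x V = \<omega> d (transition c d x) (\<chi> j. dtransition c d x (V $ j)))"

text \<open>A volume form on an oriented manifold is positive on positively oriented frames; on a
  connected manifold a nowhere vanishing top-degree form of positive total integral is of this kind.
  The rows of \<open>mat 1\<close> are the coordinate frame.\<close>

definition volume_form ::
    "('m::topological_space, 'n::finite) chart set \<Rightarrow> ('m, 'n) top_form \<Rightarrow> bool" where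
  "volume_form A \<omega> \<longleftrightarrow> smooth_top_form A \<omega> \<and>
     (\<forall>c\<in>A. \<forall>x \<in> cmap c ` cdom c. \<omega> c x (mat 1) > 0)"

text \<open>The measure associated with a volume form \<open>\<omega>\<close>: the unique Borel measure given by
  \<open>\<omega>(\<partial>\<^sub>1, \<dots>, \<partial>\<^sub>n) dx\<^sub>1 \<dots> dx\<^sub>n\<close> in every chart. Integration of a function against \<open>\<omega>\<close> is integration
  with respect to this measure.\<close>

definition volume_measure ::
    "('m::topological_space, 'n::finite) chart set \<Rightarrow> ('m, 'n) top_form \<Rightarrow> 'm measure" where
  "volume_measure A \<omega> = (THE \<mu>. sets \<mu> = sets borel \<and>
     (\<forall>c\<in>A. \<forall>B \<in> sets borel. B \<subseteq> cdom c \<longrightarrow>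
        emeasure \<mu> B = (\<integral>\<^sup>+x \<in> cmap c ` B. ennreal (\<omega> c x (mat 1)) \<partial>lborel)))"

section \<open>The \<open>L\<^sup>2\<close> norm of a 1-form\<close>

definition gram :: "('m, 'n::finite) two_tensor \<Rightarrow> ('m, 'n) chart \<Rightarrow> real^'n \<Rightarrow> real^'n^'n" where
  "gram g c x = (\<chi> i j. g c x (axis i 1) (axis j 1))"

definition riemannian_volume :: "('m, 'n::finite) two_tensor \<Rightarrow> ('m, 'n) top_form" where
  "riemannian_volume g c x V = sqrt (det (gram g c x)) * det V"

text \<open>\<open>|\<alpha>|\<^sup>2 = \<Sum>\<^sub>i\<^sub>j g\<^sup>i\<^sup>j \<alpha>\<^sub>i \<alpha>\<^sub>j\<close> at the point \<open>p\<close>, computed in some chart around \<open>p\<close>; by tensoriality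
  the choice of the chart does not matter.\<close>

definition form_sqnorm ::
    "('m, 'n::finite) chart set \<Rightarrow> ('m, 'n) two_tensor \<Rightarrow> ('m, 'n) one_form \<Rightarrow> 'm \<Rightarrow> real" where
  "form_sqnorm A g \<alpha> p =
     (let c = (SOME c. c \<in> A \<and> p \<in> cdom c); x = cmap c p; a = (\<chi> i. \<alpha> c x (axis i 1))
      in a \<bullet> (matrix_inv (gram g c x) *v a))"

definition L2_norm_form ::
    "('m::topological_space, 'n::finite) chart set \<Rightarrow> ('m, 'n) two_tensor \<Rightarrow> ('m, 'n) one_form \<Rightarrow> real" where
  "L2_norm_form A g \<alpha> =
     sqrt (\<integral>p. form_sqnorm A g \<alpha> p \<partial>volume_measure A (riemannian_volume g))"

definition unit_closed_forms ::
    "('m::topological_space, 'n::finite) chart set \<Rightarrow> ('m, 'n) two_tensor \<Rightarrow> ('m, 'n) one_form set" where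
  "unit_closed_forms A g = {\<alpha>. closed_one_form A \<alpha> \<and> L2_norm_form A g \<alpha> = 1}"

section \<open>Integrals of closed 1-forms along continuous curves\<close>

text \<open>\<open>df = \<alpha>\<close> on the open set \<open>V\<close>.\<close>

definition local_primitive ::
    "('m::topological_space, 'n::finite) chart set \<Rightarrow> ('m, 'n) one_form \<Rightarrow> 'm set \<Rightarrow> ('m \<Rightarrow> real) \<Rightarrow> bool" where
  "local_primitive A \<alpha> V f \<longleftrightarrow> open V \<and>
     (\<forall>c\<in>A. \<forall>x \<in> cmap c ` (cdom c \<inter> V). ((f \<circ> cinv c) has_derivative \<alpha> c x) (at x))"

text \<open>A primitive of \<open>\<alpha>\<close> along \<open>\<gamma>\<close> is a function on the parameter interval that agrees near each
  parameter with \<open>f \<circ> \<gamma>\<close> for a local primitive \<open>f\<close>. It is unique up to a constant, and for \<open>C\<^sup>1\<close>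
  curves its total increment is the usual line integral.\<close>

definition primitive_along ::
    "('m::topological_space, 'n::finite) chart set \<Rightarrow> ('m, 'n) one_form \<Rightarrow> (real \<Rightarrow> 'm) \<Rightarrow> (real \<Rightarrow> real) \<Rightarrow> bool" where
  "primitive_along A \<alpha> \<gamma> F \<longleftrightarrow>
     (\<forall>s\<in>{0..1}. \<exists>V f. local_primitive A \<alpha> V f \<and> \<gamma> s \<in> V \<and>
        (\<exists>\<delta>>0. \<forall>t\<in>{0..1}. \<bar>t - s\<bar> < \<delta> \<longrightarrow> F t = f (\<gamma> t)))"

definition line_integral ::
    "('m::topological_space, 'n::finite) chart set \<Rightarrow> ('m, 'n) one_form \<Rightarrow> (real \<Rightarrow> 'm) \<Rightarrow> real" where
  "line_integral A \<alpha> \<gamma> = (THE r. \<exists>F. primitive_along A \<alpha> \<gamma> F \<and> r = F 1 - F 0)"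

definition C1_curve :: "('m::topological_space, 'n::finite) chart set \<Rightarrow> (real \<Rightarrow> 'm) \<Rightarrow> bool" where
  "C1_curve A \<gamma> \<longleftrightarrow> continuous_on {0..1} \<gamma> \<and>
     (\<forall>c\<in>A. \<exists>D. continuous_on {t\<in>{0..1}. \<gamma> t \<in> cdom c} D \<and>
        (\<forall>t\<in>{0..1}. \<gamma> t \<in> cdom c \<longrightarrow>
           ((cmap c \<circ> \<gamma>) has_vector_derivative D t) (at t within {0..1})))"

text \<open>The value \<open>I\<^sub>\<alpha>(h, x, y)\<close>; for \<open>h\<close> isotopic to the identity all \<open>C\<^sup>1\<close> curves from \<open>x\<close> to \<open>y\<close> give
  the same \<open>r\<close>.\<close>

definition displacement ::
    "('m::topological_space, 'n::finite) chart set \<Rightarrow> ('m, 'n) one_form \<Rightarrow> ('m \<Rightarrow> 'm) \<Rightarrow> 'm \<Rightarrow> 'm \<Rightarrow> real" where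
  "displacement A \<alpha> h x y =
     (THE r. \<exists>\<gamma>. C1_curve A \<gamma> \<and> \<gamma> 0 = x \<and> \<gamma> 1 = y \<and>
        r = line_integral A \<alpha> (h \<circ> \<gamma>) - line_integral A \<alpha> \<gamma>)"

section \<open>Volume-preserving homeomorphisms\<close>

definition volume_homeos ::
    "('m::topological_space, 'n::finite) chart set \<Rightarrow> ('m, 'n) top_form \<Rightarrow> ('m \<Rightarrow> 'm) set" where
  "volume_homeos A \<Omega> = {h. homeomorphism UNIV UNIV h (inv h) \<and>
     distr (volume_measure A \<Omega>) (volume_measure A \<Omega>) h = volume_measure A \<Omega>}"

text \<open>The compact-open topology; on self-maps of a compact manifold this is the \<open>C\<^sup>0\<close> topology, i.e.
  the topology of uniform convergence, and inversion of homeomorphisms is continuous for it.\<close>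

definition C0_topology :: "('m::topological_space \<Rightarrow> 'm) topology" where
  "C0_topology = topology_generated_by {{f. f ` K \<subseteq> W} | K W. compact K \<and> open W}"

definition volume_homeos_0 ::
    "('m::topological_space, 'n::finite) chart set \<Rightarrow> ('m, 'n) top_form \<Rightarrow> ('m \<Rightarrow> 'm) set" where
  "volume_homeos_0 A \<Omega> =
     connected_component_of_set (subtopology C0_topology (volume_homeos A \<Omega>)) id"

section \<open>The norm\<close>

definition norm_infty_0 ::
    "('m::topological_space, 'n::finite) chart set \<Rightarrow> ('m, 'n) two_tensor \<Rightarrow> ('m, 'n) top_form \<Rightarrow> ('m \<Rightarrow> 'm) \<Rightarrow> ereal" where
  "norm_infty_0 A g \<Omega> h =
     (SUP \<alpha> \<in> unit_closed_forms A g. SUP z.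
        ereal \<bar>\<integral>y. displacement A \<alpha> h z y \<partial>volume_measure A \<Omega>\<bar>)"

end

theory Submission
  imports Defs
begin

text \<open>Closed forms have local primitives, so the integrals along \<open>k \<circ> \<gamma>\<close> and \<open>h \<circ> \<gamma>\<close> differ by boundary terms when
  \<open>k\<close> is \<open>C\<^sup>0\<close> close to \<open>h\<close>. Hence, for two curves with the same end points, the difference of the integrals along their images
  under \<open>h\<close> is locally constant in \<open>h\<close>, and therefore constant on the identity component. So \<open>I\<^sub>\<alpha>(h, x, y)\<close> may be
  computed from any continuous curve, which gives the cocycle identity
  \<open>I\<^sub>\<alpha>(h \<circ> k, x, y) = I\<^sub>\<alpha>(h, k(x), k(y)) + I\<^sub>\<alpha>(k, x, y)\<close>. It is integrated against the invariant measure to obtain the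
  triangle inequality and the symmetry. The mean of \<open>I\<^sub>d\<^sub>f(h, z, y)\<close> over \<open>y\<close> is \<open>f(z) - f(h(z))\<close>, and exact forms
  of bump functions separate \<open>z\<close> from \<open>h(z)\<close>.\<close>

section \<open>Smooth functions\<close>

text \<open>The identity component is a connected component and not a path component, so no isotopy
  from the identity to \<open>h\<close> is at hand and homotopy invariance cannot be invoked; local
  constancy on a connected set replaces it. Path independence of the displacement is passed
  algebraically from \<open>h\<close> and \<open>k\<close> to \<open>h \<circ> k\<close> and
  \<open>inv h\<close>, which brings both under the same formulas. The measure, the line integral
  and the displacement are definite descriptions, so each needs existence and uniqueness before
  anything can be computed: the measure is glued from charts by change of variables, line integrals
  come from subdividing the interval, and the displacement needs a \<open>C^1\<close> curve between
  any two points. Nonnegativity is not automatic, since a supremum over the empty set is minus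
  infinity in \<open>ereal\<close>: a closed form of norm 1 must exist. Normalising the differential
  of a nonconstant function gives one, provided that its norm is not 0. This rests on the Riemannian
  measure being finite and positive on nonempty open sets, and on the pointwise norm being
  continuous.\<close>

lemma Ck_on_continuous: "Ck_on k S f \<Longrightarrow> continuous_on S f"
  by (cases k) (auto intro!: continuous_at_imp_continuous_on differentiable_imp_continuous_within)

lemma Ck_on_SucD: "Ck_on (Suc k) S f \<Longrightarrow> Ck_on k S f"
proof (induction k arbitrary: f)
  case 0
  then show ?case using Ck_on_continuous[OF "0"] by simp
next
  case (Suc k)
  then show ?case by (metis Ck_on.simps(2))
qed

lemma Ck_on_cong_imp:
  assumes "open S"
  shows "\<lbrakk>\<And>x. x \<in> S \<Longrightarrow> f x = g x; Ck_on k S f\<rbrakk> \<Longrightarrow> Ck_on k S g"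
proof (induction k arbitrary: f g)
  case 0
  then show ?case by (simp add: continuous_on_eq)
next
  case (Suc k)
  have der: "(g has_derivative frechet_derivative f (at x)) (at x)" if "x \<in> S" for x
  proof (rule has_derivative_transform_within_open[OF _ \<open>open S\<close> that Suc.prems(1)])
    show "(f has_derivative frechet_derivative f (at x)) (at x)"
      using Suc.prems(2) that frechet_derivative_works by auto
  qed
  have "Ck_on k S (\<lambda>x. frechet_derivative g (at x) v)" for v
  proof (rule Suc.IH)
    show "frechet_derivative f (at x) v = frechet_derivative g (at x) v" if "x \<in> S" for x
      using frechet_derivative_at[OF der[OF that]] by simp
    show "Ck_on k S (\<lambda>x. frechet_derivative f (at x) v)" using Suc.prems(2) by simp
  qed
  then show ?case using der by (auto simp: differentiable_def)
qed

text \<open>In the inductions below the derivative is given by a formula \<open>f'\<close>.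
  \<open>S\<close> is open because agreement of \<open>f'\<close> with
  \<open>frechet_derivative\<close> on \<open>S\<close> has to carry over to the derivatives of
  higher order.\<close>

lemma Ck_on_intro:
  assumes "open S" "\<And>x. x \<in> S \<Longrightarrow> (f has_derivative f' x) (at x)"
    "\<And>v. Ck_on k S (\<lambda>x. f' x v)"
  shows "Ck_on (Suc k) S f"
proof -
  have "Ck_on k S (\<lambda>x. frechet_derivative f (at x) v)" for v
  proof (rule Ck_on_cong_imp[OF assms(1) _ assms(3)[of v]])
    show "f' x v = frechet_derivative f (at x) v" if "x \<in> S" for x
      using frechet_derivative_at[OF assms(2)[OF that]] by simp
  qed
  then show ?thesis using assms(2) by (auto simp: differentiable_def)
qed

lemma Ck_on_has_derivative:
  "\<lbrakk>Ck_on (Suc k) S f; x \<in> S\<rbrakk> \<Longrightarrow> (f has_derivative frechet_derivative f (at x)) (at x)"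
  using frechet_derivative_works by auto

lemma Ck_on_subset: "\<lbrakk>Ck_on k S f; T \<subseteq> S\<rbrakk> \<Longrightarrow> Ck_on k T f"
  by (induction k arbitrary: f) (auto intro: continuous_on_subset)

text \<open>Every condition in \<open>Ck_on\<close> concerns only a neighbourhood of a point. This
  handles functions defined by cases, such as a bump function extended by 0.\<close>

lemma Ck_on_local:
  assumes "\<And>x. x \<in> S \<Longrightarrow> \<exists>T. open T \<and> x \<in> T \<and> Ck_on k T f"
  shows "Ck_on k S f"
  using assms
proof (induction k arbitrary: f)
  case 0
  have "continuous (at x) f" if "x \<in> S" for x
    using 0[OF that] continuous_on_eq_continuous_at by (metis Ck_on.simps(1))
  then show ?case by (simp add: continuous_at_imp_continuous_on)
next
  case (Suc k)
  then show ?case by (metis Ck_on.simps(2))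
qed

lemma Ck_on_const: "Ck_on k S (\<lambda>x. c)"
  by (induction k arbitrary: c) simp_all

lemma Ck_on_add:
  assumes "open S"
  shows "\<lbrakk>Ck_on k S f; Ck_on k S g\<rbrakk> \<Longrightarrow> Ck_on k S (\<lambda>x. f x + g x)"
proof (induction k arbitrary: f g)
  case 0
  then show ?case by (auto intro: continuous_on_add)
next
  case (Suc k)
  show ?case
    by (rule Ck_on_intro[OF assms has_derivative_add[OF Ck_on_has_derivative Ck_on_has_derivative]])
      (use Suc in auto)
qed

lemma Ck_on_sum:
  assumes "open S" "finite I" "\<And>i. i \<in> I \<Longrightarrow> Ck_on k S (f i)"
  shows "Ck_on k S (\<lambda>x. \<Sum>i\<in>I. f i x)"
  using assms(2,3) by (induction I) (auto intro!: Ck_on_add[OF assms(1)] Ck_on_const)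

text \<open>The derivative of \<open>b (f x) (g x)\<close> is a sum of two terms of the same shape
  with one factor differentiated, so the induction closes with \<open>f\<close> and \<open>g\<close>
  arbitrary.\<close>

lemma Ck_on_bilinear:
  assumes "open S" "bounded_bilinear b"
  shows "\<lbrakk>Ck_on k S f; Ck_on k S g\<rbrakk> \<Longrightarrow> Ck_on k S (\<lambda>x. b (f x) (g x))"
proof (induction k arbitrary: f g)
  case 0
  then show ?case by (auto intro: bounded_bilinear.continuous_on[OF assms(2)])
next
  case (Suc k)
  show ?case
    by (rule Ck_on_intro[OF assms(1) bounded_bilinear.FDERIV[OF assms(2)
            Ck_on_has_derivative Ck_on_has_derivative]])
      (use Suc Suc.prems[THEN Ck_on_SucD] in \<open>auto intro!: Ck_on_add[OF assms(1)]\<close>)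
qed

lemmas Ck_on_mult = Ck_on_bilinear[OF _ bounded_bilinear_mult]
lemmas Ck_on_scaleR = Ck_on_bilinear[OF _ bounded_bilinear_scaleR]
lemmas Ck_on_inner = Ck_on_bilinear[OF _ bounded_bilinear_inner]

lemma Ck_on_bounded_linear:
  assumes "open S" "bounded_linear f"
  shows "Ck_on k S f"
proof (cases k)
  case 0
  then show ?thesis using assms(2) by (simp add: linear_continuous_on)
next
  case (Suc j)
  show ?thesis unfolding Suc
    by (rule Ck_on_intro[OF assms(1) bounded_linear_imp_has_derivative[OF assms(2)] Ck_on_const])
qed

text \<open>\<open>Ck_on\<close> controls a derivative only along a fixed vector, but in the chain
  rule the vector \<open>f' x v\<close> varies with \<open>x\<close>. Expanding it in
  \<open>Basis\<close> gives a sum of products with the functions \<open>g' (f x) i\<close>, to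
  which the induction hypothesis applies.\<close>

lemma Ck_on_compose:
  fixes f :: "'a::euclidean_space \<Rightarrow> 'b::euclidean_space" and g :: "'b \<Rightarrow> 'c::real_normed_vector"
  assumes "open S"
  shows "\<lbrakk>Ck_on k S f; Ck_on k T g; f ` S \<subseteq> T\<rbrakk> \<Longrightarrow> Ck_on k S (g \<circ> f)"
proof (induction k arbitrary: f g)
  case 0
  then show ?case by (metis Ck_on.simps(1) continuous_on_compose continuous_on_subset)
next
  case (Suc k)
  define f' where "f' x = frechet_derivative f (at x)" for x
  define g' where "g' x = frechet_derivative g (at x)" for x
  have f': "(f has_derivative f' x) (at x)" if "x \<in> S" for x
    unfolding f'_def using Suc.prems(1) that by (rule Ck_on_has_derivative)
  have g': "(g has_derivative g' (f x)) (at (f x))" if "x \<in> S" for x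
    unfolding g'_def using Suc.prems(2,3) that by (intro Ck_on_has_derivative) auto
  have eq: "(\<Sum>i\<in>Basis. (f' x v \<bullet> i) *\<^sub>R g' (f x) i) = (g' (f x) \<circ> f' x) v" if "x \<in> S" for x v
  proof -
    have lin: "linear (g' (f x))"
      using g'[OF that] has_derivative_linear by blast
    have "g' (f x) (f' x v) = g' (f x) (\<Sum>i\<in>Basis. (f' x v \<bullet> i) *\<^sub>R i)"
      by (simp add: euclidean_representation)
    then show ?thesis
      by (simp add: linear_sum[OF lin] linear_cmul[OF lin])
  qed
  show ?case
  proof (rule Ck_on_intro[OF assms])
    show "(g \<circ> f has_derivative (\<lambda>v. \<Sum>i\<in>Basis. (f' x v \<bullet> i) *\<^sub>R g' (f x) i)) (at x)" if "x \<in> S" for x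
      unfolding eq[OF that] using diff_chain_at[OF f'[OF that] g'[OF that]] by (simp add: comp_def)
    fix v
    have "Ck_on k S (\<lambda>x. f' x v)" "Ck_on k S f" "Ck_on k T g" "\<And>i. Ck_on k T (\<lambda>y. g' y i)"
      using Suc.prems Suc.prems(1,2)[THEN Ck_on_SucD] unfolding f'_def g'_def by auto
    then have "Ck_on k S ((\<lambda>y. g' y i) \<circ> f)" for i
      using Suc.IH[of f "\<lambda>y. g' y i"] Suc.prems(3) by blast
    with \<open>Ck_on k S (\<lambda>x. f' x v)\<close> show "Ck_on k S (\<lambda>x. \<Sum>i\<in>Basis. (f' x v \<bullet> i) *\<^sub>R g' (f x) i)"
      by (intro Ck_on_sum Ck_on_scaleR Ck_on_inner assms Ck_on_const) (auto simp: comp_def)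
  qed
qed

lemma smooth_on_compose:
  fixes f :: "'a::euclidean_space \<Rightarrow> 'b::euclidean_space"
  shows "\<lbrakk>open S; smooth_on S f; smooth_on T g; f ` S \<subseteq> T\<rbrakk> \<Longrightarrow> smooth_on S (g \<circ> f)"
  by (auto simp: smooth_on_def intro!: Ck_on_compose)

lemma smooth_on_subset: "\<lbrakk>smooth_on S f; T \<subseteq> S\<rbrakk> \<Longrightarrow> smooth_on T f"
  using Ck_on_subset unfolding smooth_on_def by blast

lemma smooth_on_continuous: "smooth_on S f \<Longrightarrow> continuous_on S f"
  using Ck_on_continuous unfolding smooth_on_def by blast

lemma smooth_on_has_derivative:
  "\<lbrakk>smooth_on S f; x \<in> S\<rbrakk> \<Longrightarrow> (f has_derivative frechet_derivative f (at x)) (at x)"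
  using Ck_on_has_derivative unfolding smooth_on_def by blast

lemma smooth_on_frechet_derivative:
  "smooth_on S f \<Longrightarrow> smooth_on S (\<lambda>x. frechet_derivative f (at x) v)"
  unfolding smooth_on_def using Ck_on.simps(2) by blast

subsection \<open>Bump functions\<close>

text \<open>The family of the functions \<open>p(1/t) exp(-1/t)\<close>, extended by \<open>0\<close> to \<open>t \<le> 0\<close>, is closed under
  differentiation.\<close>

definition flat :: "real poly \<Rightarrow> real \<Rightarrow> real" where
  "flat p t = (if t \<le> 0 then 0 else poly p (inverse t) * exp (- inverse t))"

lemma poly_exp_tendsto_0: "((\<lambda>u::real. poly p u * exp (- u)) \<longlongrightarrow> 0) at_top"
proof -
  have "((\<lambda>u. \<Sum>i\<le>degree p. coeff p i * (u ^ i / exp u)) \<longlongrightarrow> (\<Sum>i\<le>degree p. coeff p i * 0)) at_top"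
    by (intro tendsto_intros tendsto_power_div_exp_0)
  then show ?thesis
    by (simp add: poly_altdef sum_distrib_right exp_minus divide_inverse mult.assoc)
qed

text \<open>With \<open>u = 1/t\<close> the derivative of \<open>p(u) exp(-u)\<close> in
  \<open>t\<close> is \<open>u^2 (p(u) - p'(u)) exp(-u)\<close>; the two \<open>pCons 0\<close> are
  the factor \<open>u^2\<close>. At \<open>0\<close> the right difference quotient is
  \<open>u p(u) exp(-u)\<close> with \<open>u\<close> tending to infinity.\<close>

lemma flat_has_field_derivative:
  "(flat p has_field_derivative flat (pCons 0 (pCons 0 (p - pderiv p))) t) (at t)"
proof -
  consider "t < 0" | "t = 0" | "t > 0" by linarith
  then show ?thesis
  proof cases
    case 1
    have "((\<lambda>_. 0) has_field_derivative 0) (at t)" by simp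
    then show ?thesis using 1
      by (auto simp: flat_def intro: has_field_derivative_transform_within_open[where S="{..<0}" and f="\<lambda>_. 0"])
  next
    case 2
    have "((\<lambda>u. flat p (inverse u) * u) \<longlongrightarrow> 0) at_top"
    proof (rule Lim_transform_eventually[OF poly_exp_tendsto_0[of "pCons 0 p"]])
      show "\<forall>\<^sub>F u in at_top. poly (pCons 0 p) u * exp (- u) = flat p (inverse u) * u"
        using eventually_gt_at_top[of 0] by eventually_elim (simp add: flat_def)
    qed
    then have "((\<lambda>h. flat p h * inverse h) \<longlongrightarrow> 0) (at_right 0)"
      unfolding filterlim_at_right_to_top by simp
    moreover have "((\<lambda>h. flat p h * inverse h) \<longlongrightarrow> 0) (at_left 0)"
      by (rule Lim_transform_eventually[OF tendsto_const])
        (auto simp: flat_def eventually_at_filter)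
    ultimately have "((\<lambda>h. flat p h * inverse h) \<longlongrightarrow> 0) (at 0)"
      by (simp add: filterlim_split_at)
    then show ?thesis using 2
      by (simp add: has_field_derivative_iff divide_inverse flat_def)
  next
    case 3
    have "((\<lambda>t. poly p (inverse t) * exp (- inverse t)) has_field_derivative
        poly (pCons 0 (pCons 0 (p - pderiv p))) (inverse t) * exp (- inverse t)) (at t)"
      using 3 by (auto intro!: derivative_eq_intros DERIV_chain2[OF poly_DERIV] simp: field_simps power2_eq_square)
    then show ?thesis using 3
      by (auto simp: flat_def intro: has_field_derivative_transform_within_open[where S="{0<..}"])
  qed
qed

lemma smooth_on_flat: "smooth_on UNIV (flat p)"
proof -
  have "Ck_on k UNIV (flat p)" for k
  proof (induction k arbitrary: p)
    case 0
    then show ?case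
      using DERIV_isCont[OF flat_has_field_derivative] by (simp add: continuous_at_imp_continuous_on)
  next
    case (Suc k)
    show ?case
      by (rule Ck_on_intro[OF open_UNIV flat_has_field_derivative[unfolded has_field_derivative_def]])
        (intro Ck_on_mult Ck_on_const open_UNIV Suc.IH)
  qed
  then show ?thesis by (simp add: smooth_on_def)
qed

text \<open>The squared distance keeps the function smooth at the centre \<open>x0\<close>, where
  the norm itself is not differentiable.\<close>

definition bump :: "'a::euclidean_space \<Rightarrow> real \<Rightarrow> 'a \<Rightarrow> real" where
  "bump x0 r x = flat 1 (r\<^sup>2 - (x - x0) \<bullet> (x - x0))"

lemma smooth_on_bump: "smooth_on UNIV (bump x0 r)"
proof -
  have id: "Ck_on k UNIV (\<lambda>x::'a. x)" for k
    by (rule Ck_on_bounded_linear) auto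
  have "Ck_on k UNIV (\<lambda>x::'a. r\<^sup>2 + (-1) * ((x + (- x0)) \<bullet> (x + (- x0))))" for k
    by (intro Ck_on_add Ck_on_mult Ck_on_inner Ck_on_const open_UNIV id)
  then have "smooth_on UNIV (\<lambda>x::'a. r\<^sup>2 + (-1) * ((x + (- x0)) \<bullet> (x + (- x0))))"
    by (simp add: smooth_on_def)
  from smooth_on_compose[OF open_UNIV this smooth_on_flat[of 1]] show ?thesis
    by (simp add: bump_def[abs_def] comp_def)
qed

lemma bump_eq_0: "r \<ge> 0 \<Longrightarrow> x \<notin> ball x0 r \<Longrightarrow> bump x0 r x = 0"
  using power_mono[of r "dist x0 x" 2]
  by (auto simp: bump_def flat_def dist_norm norm_minus_commute simp flip: power2_norm_eq_inner)

lemma bump_center: "r > 0 \<Longrightarrow> bump x0 r x0 > 0"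
  by (simp add: bump_def flat_def)

subsection \<open>Symmetry of second derivatives\<close>

lemma line_has_real_derivative:
  fixes f :: "'a::real_normed_vector \<Rightarrow> real"
  assumes "(f has_derivative f') (at (x + t *\<^sub>R v))"
  shows "((\<lambda>t. f (x + t *\<^sub>R v)) has_real_derivative f' v) (at t)"
proof -
  have "((\<lambda>t. x + t *\<^sub>R v) has_derivative (\<lambda>h. h *\<^sub>R v)) (at t)"
    by (auto intro!: derivative_eq_intros)
  from diff_chain_at[OF this assms] have "((\<lambda>t. f (x + t *\<^sub>R v)) has_derivative (\<lambda>h. f' (h *\<^sub>R v))) (at t)"
    by (simp add: comp_def)
  moreover have "f' (h *\<^sub>R v) = f' v * h" for h
    using linear_cmul[OF has_derivative_linear[OF assms]] by simp
  ultimately show ?thesis by (simp add: has_field_derivative_def)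
qed

text \<open>Two applications of the mean value theorem: along \<open>v\<close> to the difference in
  direction \<open>w\<close>, then along \<open>w\<close> to the directional derivative
  \<open>f' _ v\<close>.\<close>

lemma second_difference:
  fixes f :: "'a::real_normed_vector \<Rightarrow> real"
  assumes f: "\<And>y. y \<in> ball x e \<Longrightarrow> (f has_derivative f' y) (at y)"
    and fv: "\<And>y. y \<in> ball x e \<Longrightarrow> ((\<lambda>y. f' y v) has_derivative fv' y) (at y)"
    and h: "h > 0" "h * (norm v + norm w) < e"
  obtains y where "dist x y \<le> h * (norm v + norm w)"
    "f (x + h *\<^sub>R v + h *\<^sub>R w) - f (x + h *\<^sub>R v) - f (x + h *\<^sub>R w) + f x = h * h * fv' y w"
proof -
  have in_ball: "x + s *\<^sub>R v + t *\<^sub>R w \<in> ball x e" "dist x (x + s *\<^sub>R v + t *\<^sub>R w) \<le> h * (norm v + norm w)"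
    if "0 \<le> s" "s \<le> h" "0 \<le> t" "t \<le> h" for s t
  proof -
    have "norm (s *\<^sub>R v + t *\<^sub>R w) \<le> s * norm v + t * norm w"
      using that by (intro order_trans[OF norm_triangle_ineq]) auto
    also have "\<dots> \<le> h * (norm v + norm w)"
      using that by (simp add: distrib_left add_mono mult_right_mono)
    finally show "dist x (x + s *\<^sub>R v + t *\<^sub>R w) \<le> h * (norm v + norm w)"
      unfolding dist_norm by (subst norm_minus_commute) simp
    with h show "x + s *\<^sub>R v + t *\<^sub>R w \<in> ball x e" by simp
  qed
  define G where "G s = f (x + s *\<^sub>R v + h *\<^sub>R w) - f (x + s *\<^sub>R v)" for s
  have "(G has_real_derivative f' (x + s *\<^sub>R v + h *\<^sub>R w) v - f' (x + s *\<^sub>R v) v) (at s)"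
    if "0 \<le> s" "s \<le> h" for s
  proof -
    have "((\<lambda>s. f ((x + h *\<^sub>R w) + s *\<^sub>R v)) has_real_derivative f' (x + s *\<^sub>R v + h *\<^sub>R w) v) (at s)"
      using f[OF in_ball(1)[of s h]] that h(1)
      by (intro line_has_real_derivative) (auto simp: add_ac)
    moreover have "((\<lambda>s. f (x + s *\<^sub>R v)) has_real_derivative f' (x + s *\<^sub>R v) v) (at s)"
      using f[OF in_ball(1)[of s 0]] that h(1) by (intro line_has_real_derivative) auto
    ultimately have "((\<lambda>s. f ((x + h *\<^sub>R w) + s *\<^sub>R v) - f (x + s *\<^sub>R v)) has_real_derivative
        f' (x + s *\<^sub>R v + h *\<^sub>R w) v - f' (x + s *\<^sub>R v) v) (at s)"
      by (rule DERIV_diff)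
    then show ?thesis unfolding G_def by (simp add: add_ac)
  qed
  from MVT2[OF h(1) this] obtain s where s: "0 < s" "s < h"
    and Gs: "G h - G 0 = (h - 0) * (f' (x + s *\<^sub>R v + h *\<^sub>R w) v - f' (x + s *\<^sub>R v) v)" by blast
  have "((\<lambda>t. f' (x + s *\<^sub>R v + t *\<^sub>R w) v) has_real_derivative fv' (x + s *\<^sub>R v + t *\<^sub>R w) w) (at t)"
    if "0 \<le> t" "t \<le> h" for t
    using fv[OF in_ball(1)[of s t]] that s line_has_real_derivative[of "\<lambda>y. f' y v" _ "x + s *\<^sub>R v" t w]
    by auto
  from MVT2[OF h(1) this] obtain t where t: "0 < t" "t < h"
    and "f' (x + s *\<^sub>R v + h *\<^sub>R w) v - f' (x + s *\<^sub>R v + 0 *\<^sub>R w) v = (h - 0) * fv' (x + s *\<^sub>R v + t *\<^sub>R w) w"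
    by blast
  with Gs have "G h - G 0 = h * h * fv' (x + s *\<^sub>R v + t *\<^sub>R w) w" by simp
  with that[OF in_ball(2)[of s t]] s t show ?thesis by (simp add: G_def)
qed

text \<open>The second difference is symmetric in \<open>v\<close> and \<open>w\<close>, so by
  \<open>second_difference\<close> the two mixed derivatives agree at two points close to
  \<open>x\<close>; continuity at \<open>x\<close> excludes a gap.\<close>

lemma second_derivative_symmetric:
  fixes f :: "'a::real_normed_vector \<Rightarrow> real"
  assumes "open S" "x \<in> S"
    and f: "\<And>y. y \<in> S \<Longrightarrow> (f has_derivative f' y) (at y)"
    and fv: "\<And>y. y \<in> S \<Longrightarrow> ((\<lambda>y. f' y v) has_derivative fv' y) (at y)"
    and fw: "\<And>y. y \<in> S \<Longrightarrow> ((\<lambda>y. f' y w) has_derivative fw' y) (at y)"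
    and cont: "continuous (at x) (\<lambda>y. fv' y w)" "continuous (at x) (\<lambda>y. fw' y v)"
  shows "fv' x w = fw' x v"
proof (rule ccontr)
  assume ne: "fv' x w \<noteq> fw' x v"
  \<comment> \<open>Half of the gap: two deviations below \<open>\<epsilon>\<close> cannot bridge
    it.\<close>
  define \<epsilon> where "\<epsilon> = \<bar>fv' x w - fw' x v\<bar> / 2"
  have "\<epsilon> > 0" using ne by (simp add: \<epsilon>_def)
  obtain e where e: "e > 0" "ball x e \<subseteq> S"
    using assms(1,2) open_contains_ball by blast
  obtain d1 where d1: "d1 > 0" "\<And>y. dist y x < d1 \<Longrightarrow> dist (fv' y w) (fv' x w) < \<epsilon>"
    using cont(1) \<open>\<epsilon> > 0\<close> unfolding continuous_at_eps_delta by (metis dist_commute)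
  obtain d2 where d2: "d2 > 0" "\<And>y. dist y x < d2 \<Longrightarrow> dist (fw' y v) (fw' x v) < \<epsilon>"
    using cont(2) \<open>\<epsilon> > 0\<close> unfolding continuous_at_eps_delta by (metis dist_commute)
  define m where "m = min e (min d1 d2)"
  \<comment> \<open>The summand \<open>1\<close> keeps the denominator positive when
    \<open>v = w = 0\<close> and makes \<open>h * (norm v + norm w) < m\<close> strict.\<close>
  define h where "h = m / (norm v + norm w + 1)"
  have m: "m > 0" using e d1 d2 by (simp add: m_def)
  have pos: "norm v + norm w + 1 > 0"
    using norm_ge_zero[of v] norm_ge_zero[of w] by linarith
  have h: "h > 0" "h * (norm v + norm w) < m"
    using m pos by (auto simp: h_def field_simps)
  then have hb: "h * (norm v + norm w) < e" "h * (norm w + norm v) < e"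
    by (auto simp: m_def add.commute)
  obtain y where y: "dist x y \<le> h * (norm v + norm w)"
    "f (x + h *\<^sub>R v + h *\<^sub>R w) - f (x + h *\<^sub>R v) - f (x + h *\<^sub>R w) + f x = h * h * fv' y w"
    using second_difference[of x e f f' v fv' h w] f fv e(2) h(1) hb(1) by blast
  obtain z where z: "dist x z \<le> h * (norm w + norm v)"
    "f (x + h *\<^sub>R w + h *\<^sub>R v) - f (x + h *\<^sub>R w) - f (x + h *\<^sub>R v) + f x = h * h * fw' z v"
    using second_difference[of x e f f' w fw' h v] f fw e(2) h(1) hb(2) by blast
  have "x + h *\<^sub>R w + h *\<^sub>R v = x + h *\<^sub>R v + h *\<^sub>R w" by simp
  with z(2) have "h * h * fv' y w = h * h * fw' z v"
    unfolding y(2)[symmetric] by simp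
  then have "fv' y w = fw' z v" using h(1) by simp
  moreover have "dist (fv' y w) (fv' x w) < \<epsilon>"
    using y(1) h(2) by (intro d1(2)) (simp add: m_def dist_commute)
  moreover have "dist (fw' z v) (fw' x v) < \<epsilon>"
    using z(1) h(2) by (intro d2(2)) (simp add: m_def dist_commute add.commute)
  ultimately show False
    by (simp add: \<epsilon>_def dist_real_def abs_if split: if_splits)
qed

lemma smooth_on_second_derivative_symmetric:
  fixes f :: "'a::euclidean_space \<Rightarrow> real"
  assumes "smooth_on S f" "open S" "x \<in> S"
  shows "frechet_derivative (\<lambda>y. frechet_derivative f (at y) w) (at x) v
       = frechet_derivative (\<lambda>y. frechet_derivative f (at y) v) (at x) w"
proof -
  note d = smooth_on_frechet_derivative[OF assms(1)]
  have "continuous (at x) (\<lambda>y. frechet_derivative (\<lambda>y. frechet_derivative f (at y) w) (at y) v)" for v w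
    using smooth_on_continuous[OF smooth_on_frechet_derivative[OF d]] assms(2,3)
    by (simp add: continuous_on_eq_continuous_at)
  then show ?thesis
    by (intro second_derivative_symmetric[OF assms(2,3) smooth_on_has_derivative[OF assms(1)]
          smooth_on_has_derivative[OF d] smooth_on_has_derivative[OF d]])
qed

section \<open>Primitives of closed 1-forms\<close>

lemma segment_in_ball:
  fixes x0 :: "'a::real_normed_vector"
  assumes "x \<in> ball x0 r" "0 \<le> t" "t \<le> 1"
  shows "x0 + t *\<^sub>R (x - x0) \<in> ball x0 r"
proof -
  have "norm (t *\<^sub>R (x - x0)) \<le> norm (x - x0)"
    using assms(2,3) by (simp add: mult_left_le_one_le)
  then show ?thesis using assms(1) by (simp add: dist_norm norm_minus_commute)
qed

text \<open>The primitive is the integral of \<open>a\<close> along the segments from the centre: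
  \<open>f x\<close> is the integral over \<open>t\<close> of
  \<open>a (x0 + t (x - x0)) (x - x0)\<close>. Differentiation under the integral and closedness
  turn the integrand into the \<open>t\<close>-derivative of
  \<open>t * a (x0 + t (x - x0)) v\<close>, whose integral is \<open>a x v\<close>.\<close>

lemma poincare_ball:
  fixes a :: "'a::euclidean_space \<Rightarrow> 'a \<Rightarrow> real"
  assumes lin: "\<And>x. x \<in> ball x0 r \<Longrightarrow> linear (a x)"
    and smooth: "\<And>v. smooth_on (ball x0 r) (\<lambda>x. a x v)"
    and closed: "\<And>x v w. x \<in> ball x0 r \<Longrightarrow>
      frechet_derivative (\<lambda>y. a y w) (at x) v = frechet_derivative (\<lambda>y. a y v) (at x) w"
  obtains f where "\<And>x. x \<in> ball x0 r \<Longrightarrow> (f has_derivative a x) (at x)"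
proof
  let ?B = "ball x0 r"
  define D where "D w y = frechet_derivative (\<lambda>y. a y w) (at y)" for w y
  define Y where "Y x t = x0 + t *\<^sub>R (x - x0)" for x t
  have Y: "Y x t \<in> ?B" if "x \<in> ?B" "t \<in> {0..1}" for x t
    using that segment_in_ball[of x x0 r t] by (auto simp: Y_def)
  have contY: "continuous_on T (\<lambda>z. Y (fst z) (snd z))" for T
    unfolding Y_def by (intro continuous_intros)
  have D: "((\<lambda>y. a y w) has_derivative D w y) (at y)" if "y \<in> ?B" for w y
    unfolding D_def using smooth_on_has_derivative[OF smooth that] .
  have expand: "(\<Sum>i\<in>Basis. (u \<bullet> i) * F i) = F u" if "linear F" for F :: "'a \<Rightarrow> real" and u
  proof -
    have "F u = F (\<Sum>i\<in>Basis. (u \<bullet> i) *\<^sub>R i)" by (simp add: euclidean_representation)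
    then show ?thesis by (simp add: linear_sum[OF that] linear_cmul[OF that])
  qed
  \<comment> \<open>\<open>L x t\<close> is the derivative of \<open>F x t\<close> in
    \<open>x\<close>, with two arguments already exchanged by closedness: the product rule gives
    \<open>D (x - x0) (Y x t) (t *\<^sub>R v)\<close> in place of the second summand.\<close>
  define L where "L x t v = a (Y x t) v + t * D v (Y x t) (x - x0)" for x t v
  define F where "F x t = a (Y x t) (x - x0)" for x t
  have L_eq: "L x t v = (\<Sum>i\<in>Basis. (v \<bullet> i) * a (Y x t) i + ((x - x0) \<bullet> i) * D i (Y x t) (t *\<^sub>R v))"
    if "x \<in> ?B" "t \<in> {0..1}" for x t v
  proof -
    note lin' = lin[OF Y[OF that]] has_derivative_linear[OF D[OF Y[OF that]]]
    have "D i (Y x t) (t *\<^sub>R v) = t * D v (Y x t) i" for i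
      unfolding linear_cmul[OF lin'(2)] using closed[OF Y[OF that]] by (simp add: D_def)
    then have "(\<Sum>i\<in>Basis. ((x - x0) \<bullet> i) * D i (Y x t) (t *\<^sub>R v))
        = t * (\<Sum>i\<in>Basis. ((x - x0) \<bullet> i) * D v (Y x t) i)"
      by (simp add: sum_distrib_left mult_ac)
    then show ?thesis
      by (simp add: L_def sum.distrib expand[OF lin'(1)] expand[OF lin'(2)])
  qed
  have der: "((\<lambda>x. F x t) has_derivative L x t) (at x within ?B)" if "x \<in> ?B" "t \<in> {0..1}" for x t
  proof -
    have dY: "((\<lambda>x. Y x t) has_derivative (\<lambda>v. t *\<^sub>R v)) (at x)"
      unfolding Y_def by (auto intro!: derivative_eq_intros)
    \<comment> \<open>The vector \<open>x - x0\<close> to which \<open>a\<close> is applied moves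
      with \<open>x\<close>, so \<open>F\<close> is first expanded in \<open>Basis\<close>; the
      expansion is valid only on the ball, where \<open>a\<close> is linear.\<close>
    have "((\<lambda>x. \<Sum>i\<in>Basis. ((x - x0) \<bullet> i) * a (Y x t) i) has_derivative L x t) (at x)"
      unfolding L_eq[OF that, abs_def]
      by (auto intro!: derivative_eq_intros has_derivative_compose[OF dY D[OF Y[OF that]]] sum.cong)
    moreover have "\<forall>\<^sub>F y in at x. y \<in> ?B"
      using that(1) eventually_at_in_open'[of ?B x] by simp
    then have "\<forall>\<^sub>F y in at x. (\<Sum>i\<in>Basis. ((y - x0) \<bullet> i) * a (Y y t) i) = F y t"
      by eventually_elim (simp add: F_def expand[OF lin[OF Y[OF _ that(2)]]])
    ultimately have "((\<lambda>x. F x t) has_derivative L x t) (at x)"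
      using that by (elim has_derivative_transform_eventually)
        (simp_all add: F_def expand[OF lin[OF Y[OF that]]])
    then show ?thesis by (rule has_derivative_at_withinI)
  qed
  then have blL: "bounded_linear (L x t)" if "x \<in> ?B" "t \<in> {0..1}" for x t
    using that has_derivative_bounded_linear by blast
  \<comment> \<open>\<open>leibniz_rule\<close> takes the derivative as a continuous family of
    bounded linear maps.\<close>
  define fx where "fx x t = Blinfun (L x t)" for x t
  have fx: "blinfun_apply (fx x t) = L x t" if "x \<in> ?B" "t \<in> {0..1}" for x t
    unfolding fx_def by (rule bounded_linear_Blinfun_apply[OF blL[OF that]])
  have cont_a: "continuous_on (?B \<times> {0..1}) (\<lambda>z. a (Y (fst z) (snd z)) v)" for v
    by (rule continuous_on_compose2[OF smooth_on_continuous[OF smooth] contY]) (use Y in auto)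
  have cont_D: "continuous_on (?B \<times> {0..1}) (\<lambda>z. D v (Y (fst z) (snd z)) w)" for v w
    unfolding D_def
    by (rule continuous_on_compose2[OF smooth_on_continuous[OF smooth_on_frechet_derivative[OF smooth]] contY])
      (use Y in auto)
  have cont_L: "continuous_on (?B \<times> {0..1}) (\<lambda>z. L (fst z) (snd z) v)" for v
  proof (rule continuous_on_eq)
    show "continuous_on (?B \<times> {0..1}) (\<lambda>z. a (Y (fst z) (snd z)) v
        + snd z * (\<Sum>i\<in>Basis. ((fst z - x0) \<bullet> i) * D v (Y (fst z) (snd z)) i))"
      by (intro continuous_intros cont_a cont_D)
    show "a (Y (fst z) (snd z)) v + snd z * (\<Sum>i\<in>Basis. ((fst z - x0) \<bullet> i) * D v (Y (fst z) (snd z)) i)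
        = L (fst z) (snd z) v" if "z \<in> ?B \<times> {0..1}" for z
      using that expand[OF has_derivative_linear[OF D[OF Y]], of "fst z" "snd z"] by (auto simp: L_def)
  qed
  have cont_fx: "continuous_on (?B \<times> {0..1}) (\<lambda>(x, t). fx x t)"
    unfolding case_prod_beta
  proof (rule continuous_on_blinfun_componentwise)
    show "continuous_on (?B \<times> {0..1}) (\<lambda>z. blinfun_apply (fx (fst z) (snd z)) i)" for i
      by (rule continuous_on_eq[OF cont_L[of i]]) (auto simp: fx)
  qed
  have cont_slice: "continuous_on {0..1} (\<lambda>t. a (Y x t) v)" if "x \<in> ?B" for x v
  proof -
    have "continuous_on {0..1} (\<lambda>t. (x, t))" by (intro continuous_intros)
    moreover have "(\<lambda>t. (x, t)) ` {0..1} \<subseteq> ?B \<times> {0..1}" using that by auto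
    ultimately show ?thesis using continuous_on_compose2[OF cont_a[of v]] by fastforce
  qed
  fix x assume x: "x \<in> ?B"
  have "((\<lambda>x. integral (cbox 0 1) (F x)) has_derivative integral (cbox 0 1) (fx x)) (at x within ?B)"
  proof (rule leibniz_rule)
    show "((\<lambda>x. F x t) has_derivative blinfun_apply (fx x t)) (at x within ?B)"
      if "x \<in> ?B" "t \<in> cbox 0 1" for x t
      using der[of x t] fx[of x t] that by simp
    show "F x integrable_on cbox 0 1" if "x \<in> ?B" for x
      unfolding F_def using cont_slice[OF that] by (intro integrable_continuous) simp
  qed (use cont_fx x in auto)
  moreover have "blinfun_apply (integral (cbox 0 1) (fx x)) = a x"
  proof
    fix v
    have "continuous_on {0..1} (fx x)"
    proof -
      have "continuous_on {0..1} (\<lambda>t. (x, t))" by (intro continuous_intros)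
      moreover have "(\<lambda>t. (x, t)) ` {0..1} \<subseteq> ?B \<times> {0..1}" using x by auto
      ultimately show ?thesis using continuous_on_compose2[OF cont_fx] by fastforce
    qed
    then have "fx x integrable_on cbox 0 1" by (intro integrable_continuous) simp
    then have "blinfun_apply (integral (cbox 0 1) (fx x)) v = integral {0..1} (\<lambda>t. fx x t v)"
      using blinfun_apply_integral[of "fx x" "cbox 0 1" v] by simp
    also have "\<dots> = integral {0..1} (\<lambda>t. L x t v)"
      by (rule integral_cong) (simp only: fx[OF x])
    \<comment> \<open>Fundamental theorem of calculus for \<open>t * a (Y x t) v\<close>; the factor
      \<open>t\<close> removes the contribution of the centre.\<close>
    also have "\<dots> = 1 * a (Y x 1) v - 0 * a (Y x 0) v"
    proof (rule integral_unique, rule fundamental_theorem_of_calculus)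
      fix t :: real assume t: "t \<in> {0..1}"
      have "((\<lambda>t. a (Y x t) v) has_real_derivative D v (Y x t) (x - x0)) (at t)"
        unfolding Y_def using D[OF Y[OF x t], of v]
        by (intro line_has_real_derivative) (simp add: Y_def)
      then have "((\<lambda>t. t * a (Y x t) v) has_real_derivative L x t v) (at t)"
        unfolding L_def by (rule DERIV_cong[OF DERIV_mult[OF DERIV_ident]]) simp
      then show "((\<lambda>t. t * a (Y x t) v) has_vector_derivative L x t v) (at t within {0..1})"
        by (simp add: has_real_derivative_iff_has_vector_derivative has_vector_derivative_at_within)
    qed simp
    finally show "blinfun_apply (integral (cbox 0 1) (fx x)) v = a x v" by (simp add: Y_def)
  qed
  ultimately show "((\<lambda>x. integral (cbox 0 1) (F x)) has_derivative a x) (at x)"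
    using at_within_open[OF x open_ball] by simp
qed

section \<open>Charts and local primitives on the manifold\<close>

locale manifold =
  fixes A :: "('m::{t2_space, second_countable_topology}, 'n::{finite, wellorder}) chart set"
  assumes manifold: "closed_connected_oriented_manifold A"
begin

lemma is_chart: "c \<in> A \<Longrightarrow> is_chart c"
  using manifold by (auto simp: closed_connected_oriented_manifold_def oriented_atlas_def)

lemma compact_M: "compact (UNIV :: 'm set)" and connected_M: "connected (UNIV :: 'm set)"
  using manifold by (auto simp: closed_connected_oriented_manifold_def)

lemma chart_around: obtains c where "c \<in> A" "p \<in> cdom c"
proof -
  have "p \<in> (\<Union>c\<in>A. cdom c)"
    using manifold by (simp add: closed_connected_oriented_manifold_def oriented_atlas_def)
  then show thesis using that by blast
qed

lemma open_cdom: "c \<in> A \<Longrightarrow> open (cdom c)"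
  and open_image_cdom: "c \<in> A \<Longrightarrow> open (cmap c ` cdom c)"
  and chart_homeomorphism: "c \<in> A \<Longrightarrow> homeomorphism (cdom c) (cmap c ` cdom c) (cmap c) (cinv c)"
  using is_chart by (auto simp: is_chart_def)

lemma cinv_cmap: "\<lbrakk>c \<in> A; p \<in> cdom c\<rbrakk> \<Longrightarrow> cinv c (cmap c p) = p"
  using chart_homeomorphism by (auto simp: homeomorphism_def)

lemma cmap_cinv: "\<lbrakk>c \<in> A; x \<in> cmap c ` cdom c\<rbrakk> \<Longrightarrow> cmap c (cinv c x) = x"
  by (auto simp: cinv_cmap)

lemma cinv_in_cdom: "\<lbrakk>c \<in> A; x \<in> cmap c ` cdom c\<rbrakk> \<Longrightarrow> cinv c x \<in> cdom c"
  by (auto simp: cinv_cmap)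

lemma continuous_on_cmap: "c \<in> A \<Longrightarrow> continuous_on (cdom c) (cmap c)"
  and continuous_on_cinv: "c \<in> A \<Longrightarrow> continuous_on (cmap c ` cdom c) (cinv c)"
  using chart_homeomorphism by (auto simp: homeomorphism_def)

lemma open_cmap_image:
  assumes "c \<in> A" "open U" shows "open (cmap c ` (cdom c \<inter> U))"
proof -
  have "cmap c ` (cdom c \<inter> U) = (cmap c ` cdom c) \<inter> cinv c -` U"
    using cinv_cmap[OF assms(1)] by auto
  then show ?thesis
    using continuous_on_open_vimage[OF open_image_cdom] continuous_on_cinv assms
    by (metis Int_commute)
qed

lemma open_cinv_image:
  assumes "c \<in> A" "open X" "X \<subseteq> cmap c ` cdom c" shows "open (cinv c ` X)"
proof -
  have "cinv c ` X = cdom c \<inter> cmap c -` X"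
    using assms(3) cinv_cmap[OF assms(1)] by (force simp: image_iff)
  then show ?thesis
    using continuous_on_open_vimage[OF open_cdom] continuous_on_cmap assms
    by (metis Int_commute)
qed

lemma smooth_on_transition:
  "\<lbrakk>c \<in> A; d \<in> A\<rbrakk> \<Longrightarrow> smooth_on (cmap c ` (cdom c \<inter> cdom d)) (transition c d)"
  and det_dtransition: "\<lbrakk>c \<in> A; d \<in> A; x \<in> cmap c ` (cdom c \<inter> cdom d)\<rbrakk>
    \<Longrightarrow> det (matrix (dtransition c d x)) > 0"
  using manifold by (auto simp: closed_connected_oriented_manifold_def oriented_atlas_def)

lemma transition_has_derivative:
  "\<lbrakk>c \<in> A; d \<in> A; x \<in> cmap c ` (cdom c \<inter> cdom d)\<rbrakk>
    \<Longrightarrow> (transition c d has_derivative dtransition c d x) (at x)"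
  using smooth_on_has_derivative[OF smooth_on_transition] .

lemma transition_cmap: "\<lbrakk>c \<in> A; p \<in> cdom c\<rbrakk> \<Longrightarrow> transition c d (cmap c p) = cmap d p"
  by (simp add: transition_def cinv_cmap)

lemma cinv_transition:
  "\<lbrakk>c \<in> A; d \<in> A; x \<in> cmap c ` (cdom c \<inter> cdom d)\<rbrakk> \<Longrightarrow> cinv d (transition c d x) = cinv c x"
  by (auto simp: transition_def cinv_cmap)

lemma chart_ball:
  assumes "c \<in> A" "p \<in> cdom c" "open U" "p \<in> U"
  obtains r where "r > 0" "ball (cmap c p) r \<subseteq> cmap c ` (cdom c \<inter> U)"
  using open_cmap_image[OF assms(1,3)] assms(2,4) open_contains_ball by (metis Int_iff image_eqI)

text \<open>The transformation law of \<open>\<alpha>\<close> and the chain rule carry the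
  derivative from the single chart \<open>c\<close> to every chart of the atlas.\<close>

lemma local_primitiveI:
  assumes c: "c \<in> A" and V: "open V" "V \<subseteq> cdom c"
    and f: "\<And>x. x \<in> cmap c ` V \<Longrightarrow> ((f \<circ> cinv c) has_derivative \<alpha> c x) (at x)"
    and \<alpha>: "smooth_one_form A \<alpha>"
  shows "local_primitive A \<alpha> V f"
  unfolding local_primitive_def
proof (intro conjI ballI V)
  fix d x assume d: "d \<in> A" and x: "x \<in> cmap d ` (cdom d \<inter> V)"
  have x': "x \<in> cmap d ` (cdom d \<inter> cdom c)" using x V by auto
  have tx: "transition d c x \<in> cmap c ` V"
    using x V by (auto simp: transition_cmap[OF d])
  have "((f \<circ> cinv c) \<circ> transition d c has_derivative \<alpha> c (transition d c x) \<circ> dtransition d c x) (at x)"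
    by (intro diff_chain_at transition_has_derivative f d c x' tx)
  moreover have "\<alpha> c (transition d c x) \<circ> dtransition d c x = \<alpha> d x"
    using \<alpha> c d x' by (auto simp: smooth_one_form_def)
  ultimately have "((f \<circ> cinv c) \<circ> transition d c has_derivative \<alpha> d x) (at x)" by simp
  then show "((f \<circ> cinv d) has_derivative \<alpha> d x) (at x)"
  proof (rule has_derivative_transform_within_open)
    show "open (cmap d ` (cdom d \<inter> cdom c))" by (intro open_cmap_image open_cdom c d)
  qed (use x' cinv_transition[OF d c] in auto)
qed

lemma local_primitive_exists:
  assumes "closed_one_form A \<alpha>"
  obtains V f where "p \<in> V" "local_primitive A \<alpha> V f"
proof -
  obtain c where c: "c \<in> A" "p \<in> cdom c" using chart_around .
  obtain r where r: "r > 0" "ball (cmap c p) r \<subseteq> cmap c ` cdom c"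
    using chart_ball[OF c open_UNIV] by auto
  let ?B = "ball (cmap c p) r"
  have \<alpha>: "smooth_one_form A \<alpha>" using assms by (simp add: closed_one_form_def)
  obtain f where f: "\<And>x. x \<in> ?B \<Longrightarrow> (f has_derivative \<alpha> c x) (at x)"
  proof (rule poincare_ball[of "cmap c p" r "\<alpha> c"])
    show "linear (\<alpha> c x)" if "x \<in> ?B" for x
      using \<alpha> c(1) r(2) that by (auto simp: smooth_one_form_def)
    show "smooth_on ?B (\<lambda>x. \<alpha> c x v)" for v
      using \<alpha> c(1) smooth_on_subset[OF _ r(2)] by (auto simp: smooth_one_form_def)
    show "frechet_derivative (\<lambda>y. \<alpha> c y w) (at x) v = frechet_derivative (\<lambda>y. \<alpha> c y v) (at x) w"
      if "x \<in> ?B" for x v w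
      using assms c(1) r(2) that unfolding closed_one_form_def by (metis (no_types, lifting) eq_iff_diff_eq_0 subsetD)
  qed blast
  have cinv_B: "cinv c ` ?B \<subseteq> cdom c" "cmap c ` cinv c ` ?B = ?B"
    using r(2) cinv_in_cdom[OF c(1)] cmap_cinv[OF c(1)] by (auto simp: image_iff subset_iff)
  have "local_primitive A \<alpha> (cinv c ` ?B) (f \<circ> cmap c)"
  proof (rule local_primitiveI[OF c(1) open_cinv_image[OF c(1) open_ball r(2)] cinv_B(1) _ \<alpha>])
    fix x assume "x \<in> cmap c ` cinv c ` ?B"
    then have x: "x \<in> ?B" using cinv_B(2) by simp
    show "((f \<circ> cmap c) \<circ> cinv c has_derivative \<alpha> c x) (at x)"
      by (rule has_derivative_transform_within_open[OF f[OF x] open_ball x])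
        (use r(2) cmap_cinv[OF c(1)] in auto)
  qed
  moreover have "p \<in> cinv c ` ?B"
    using r(1) cinv_cmap[OF c] by (metis centre_in_ball image_eqI)
  ultimately show thesis using that by blast
qed

lemma local_primitive_has_derivative:
  "\<lbrakk>local_primitive A \<alpha> V f; c \<in> A; x \<in> cmap c ` (cdom c \<inter> V)\<rbrakk>
    \<Longrightarrow> ((f \<circ> cinv c) has_derivative \<alpha> c x) (at x)"
  unfolding local_primitive_def by blast

lemma local_primitive_add_const:
  "local_primitive A \<alpha> V f \<Longrightarrow> local_primitive A \<alpha> V (\<lambda>p. f p + C)"
  unfolding local_primitive_def comp_def
  using has_derivative_add[OF _ has_derivative_const[of C]] by fastforce

text \<open>Shrinking to a coordinate ball makes the domain convex, hence the difference constant;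
  on all of \<open>V \<inter> W\<close>, which may be disconnected, the constant could vary.\<close>

lemma local_primitive_diff:
  assumes f: "local_primitive A \<alpha> V f" and g: "local_primitive A \<alpha> W g" and p: "p \<in> V" "p \<in> W"
  obtains U C where "open U" "p \<in> U" "U \<subseteq> V \<inter> W" "\<And>q. q \<in> U \<Longrightarrow> f q = g q + C"
proof -
  obtain c where c: "c \<in> A" "p \<in> cdom c" using chart_around .
  have op: "open (V \<inter> W)" using f g by (auto simp: local_primitive_def)
  obtain r where r: "r > 0" "ball (cmap c p) r \<subseteq> cmap c ` (cdom c \<inter> (V \<inter> W))"
    using chart_ball[OF c op] p by auto
  let ?B = "ball (cmap c p) r"
  have "((\<lambda>x. f (cinv c x) - g (cinv c x)) has_derivative (\<lambda>_. 0)) (at x within ?B)" if "x \<in> ?B" for x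
  proof -
    have "((f \<circ> cinv c) has_derivative \<alpha> c x) (at x)" "((g \<circ> cinv c) has_derivative \<alpha> c x) (at x)"
      by (rule local_primitive_has_derivative[OF f c(1)] local_primitive_has_derivative[OF g c(1)],
          use that r(2) in blast)+
    from has_derivative_diff[OF this] show ?thesis
      by (simp add: has_derivative_at_withinI)
  qed
  from has_derivative_zero_constant[OF convex_ball this]
  obtain C where C: "\<And>x. x \<in> ?B \<Longrightarrow> f (cinv c x) - g (cinv c x) = C" by blast
  show thesis
  proof
    show "open (cinv c ` ?B)" using r(2) by (intro open_cinv_image c) auto
    show "p \<in> cinv c ` ?B" using r(1) cinv_cmap[OF c] by (metis centre_in_ball image_eqI)
    show "cinv c ` ?B \<subseteq> V \<inter> W" using r(2) cinv_cmap[OF c(1)] by force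
    show "f q = g q + C" if "q \<in> cinv c ` ?B" for q using C that by force
  qed
qed

lemma local_primitive_continuous:
  assumes f: "local_primitive A \<alpha> V f" shows "continuous_on V f"
proof -
  have "continuous (at p) f" if p: "p \<in> V" for p
  proof -
    obtain c where c: "c \<in> A" "p \<in> cdom c" using chart_around .
    have V: "open V" using f by (simp add: local_primitive_def)
    have "continuous_on (cmap c ` (cdom c \<inter> V)) (f \<circ> cinv c)"
      by (intro continuous_at_imp_continuous_on ballI
          has_derivative_continuous[OF local_primitive_has_derivative[OF f c(1)]])
    then have "continuous_on (cdom c \<inter> V) (\<lambda>q. (f \<circ> cinv c) (cmap c q))"
      by (rule continuous_on_compose2[OF _ continuous_on_subset[OF continuous_on_cmap[OF c(1)]]]) auto
    then have "continuous_on (cdom c \<inter> V) f"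
      by (rule continuous_on_eq) (simp add: cinv_cmap[OF c(1)])
    then show ?thesis
      using p c(2) continuous_on_eq_continuous_at open_Int[OF open_cdom[OF c(1)] V] by blast
  qed
  then show ?thesis by (simp add: continuous_at_imp_continuous_on)
qed

end

section \<open>Integration along continuous curves\<close>

text \<open>\<open>primitive_along\<close> on an arbitrary interval: existence and uniqueness are
  proved by subdividing the parameter interval, which needs primitives on its pieces.\<close>

definition primitive_on ::
    "('m::topological_space, 'n::finite) chart set \<Rightarrow> ('m, 'n) one_form \<Rightarrow> (real \<Rightarrow> 'm) \<Rightarrow> real \<Rightarrow> real \<Rightarrow> (real \<Rightarrow> real) \<Rightarrow> bool" where
  "primitive_on A \<alpha> \<gamma> a b F \<longleftrightarrow>
     (\<forall>s\<in>{a..b}. \<exists>V f. local_primitive A \<alpha> V f \<and> \<gamma> s \<in> V \<and>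
        (\<exists>\<delta>>0. \<forall>t\<in>{a..b}. \<bar>t - s\<bar> < \<delta> \<longrightarrow> F t = f (\<gamma> t)))"

lemma primitive_along_iff: "primitive_along A \<alpha> \<gamma> F \<longleftrightarrow> primitive_on A \<alpha> \<gamma> 0 1 F"
  by (simp add: primitive_along_def primitive_on_def)

lemma primitive_onE:
  assumes "primitive_on A \<alpha> \<gamma> a b F" "a \<le> s" "s \<le> b"
  obtains V f \<delta> where "local_primitive A \<alpha> V f" "\<gamma> s \<in> V" "\<delta> > 0"
    "\<And>t. \<lbrakk>a \<le> t; t \<le> b; \<bar>t - s\<bar> < \<delta>\<rbrakk> \<Longrightarrow> F t = f (\<gamma> t)"
proof -
  have "s \<in> {a..b}" using assms(2,3) by simp
  with assms(1) obtain V f \<delta> where "local_primitive A \<alpha> V f" "\<gamma> s \<in> V" "\<delta> > 0"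
    "\<forall>t\<in>{a..b}. \<bar>t - s\<bar> < \<delta> \<longrightarrow> F t = f (\<gamma> t)"
    unfolding primitive_on_def by blast
  then show thesis by (intro that[of V f \<delta>]) auto
qed

lemma primitive_onI:
  assumes "\<And>s. \<lbrakk>a \<le> s; s \<le> b\<rbrakk> \<Longrightarrow> \<exists>V f \<delta>. local_primitive A \<alpha> V f \<and> \<gamma> s \<in> V \<and> \<delta> > 0 \<and>
        (\<forall>t. a \<le> t \<and> t \<le> b \<and> \<bar>t - s\<bar> < \<delta> \<longrightarrow> F t = f (\<gamma> t))"
  shows "primitive_on A \<alpha> \<gamma> a b F"
  unfolding primitive_on_def
proof
  fix s assume "s \<in> {a..b}"
  then obtain V f \<delta> where "local_primitive A \<alpha> V f" "\<gamma> s \<in> V" "\<delta> > 0"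
    "\<forall>t. a \<le> t \<and> t \<le> b \<and> \<bar>t - s\<bar> < \<delta> \<longrightarrow> F t = f (\<gamma> t)"
    using assms[of s] by auto
  then show "\<exists>V f. local_primitive A \<alpha> V f \<and> \<gamma> s \<in> V \<and>
      (\<exists>\<delta>>0. \<forall>t\<in>{a..b}. \<bar>t - s\<bar> < \<delta> \<longrightarrow> F t = f (\<gamma> t))"
    by (intro exI[of _ V] exI[of _ f] conjI exI[of _ \<delta>]) auto
qed

lemma primitive_on_subinterval:
  assumes "primitive_on A \<alpha> \<gamma> a b F" "a \<le> a'" "b' \<le> b"
  shows "primitive_on A \<alpha> \<gamma> a' b' F"
proof (rule primitive_onI)
  fix s assume "a' \<le> s" "s \<le> b'"
  with assms obtain V f \<delta> where "local_primitive A \<alpha> V f" "\<gamma> s \<in> V" "\<delta> > 0"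
    "\<And>t. \<lbrakk>a \<le> t; t \<le> b; \<bar>t - s\<bar> < \<delta>\<rbrakk> \<Longrightarrow> F t = f (\<gamma> t)"
    by (elim primitive_onE[of A \<alpha> \<gamma> a b F s]) auto
  with assms(2,3) show "\<exists>V f \<delta>. local_primitive A \<alpha> V f \<and> \<gamma> s \<in> V \<and> \<delta> > 0 \<and>
        (\<forall>t. a' \<le> t \<and> t \<le> b' \<and> \<bar>t - s\<bar> < \<delta> \<longrightarrow> F t = f (\<gamma> t))"
    by (intro exI[of _ V] exI[of _ f] exI[of _ \<delta>]) auto
qed

lemma primitive_on_cong:
  assumes "primitive_on A \<alpha> \<gamma> a b F" "\<And>t. \<lbrakk>a \<le> t; t \<le> b\<rbrakk> \<Longrightarrow> \<gamma>' t = \<gamma> t"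
  shows "primitive_on A \<alpha> \<gamma>' a b F"
  using assms unfolding primitive_on_def by simp

lemma primitive_on_local:
  assumes "local_primitive A \<alpha> V f" "\<gamma> ` {a..b} \<subseteq> V"
  shows "primitive_on A \<alpha> \<gamma> a b (f \<circ> \<gamma>)"
proof (rule primitive_onI)
  fix s assume "a \<le> s" "s \<le> b"
  with assms show "\<exists>V fa \<delta>. local_primitive A \<alpha> V fa \<and> \<gamma> s \<in> V \<and> \<delta> > 0 \<and>
        (\<forall>t. a \<le> t \<and> t \<le> b \<and> \<bar>t - s\<bar> < \<delta> \<longrightarrow> (f \<circ> \<gamma>) t = fa (\<gamma> t))"
    by (intro exI[of _ V] exI[of _ f] exI[of _ 1]) auto
qed

lemma continuous_on_window:
  fixes \<gamma> :: "real \<Rightarrow> 'm::topological_space"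
  assumes "continuous_on {a..b} \<gamma>" "a \<le> s" "s \<le> b" "open U" "\<gamma> s \<in> U"
  obtains \<delta> where "\<delta> > 0" "\<And>t. \<lbrakk>a \<le> t; t \<le> b; \<bar>t - s\<bar> < \<delta>\<rbrakk> \<Longrightarrow> \<gamma> t \<in> U"
proof -
  obtain W where W: "open W" "s \<in> W" "\<And>t. \<lbrakk>t \<in> {a..b}; t \<in> W\<rbrakk> \<Longrightarrow> \<gamma> t \<in> U"
    using assms unfolding continuous_on_topological by (metis atLeastAtMost_iff)
  obtain \<delta> where "\<delta> > 0" "\<And>t. \<bar>t - s\<bar> < \<delta> \<Longrightarrow> t \<in> W"
    using W(1,2) unfolding open_dist dist_real_def by blast
  with W(3) that show thesis by (metis atLeastAtMost_iff)
qed

text \<open>Continuity of \<open>\<phi>\<close> pulls the window around \<open>\<phi> s\<close> back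
  to a window around \<open>s\<close>. The two halves of a joined path are the intended use.\<close>

lemma primitive_on_reparam:
  assumes F: "primitive_on A \<alpha> \<gamma> a b F" and \<phi>: "continuous_on {c..d} \<phi>" "\<phi> ` {c..d} \<subseteq> {a..b}"
  shows "primitive_on A \<alpha> (\<gamma> \<circ> \<phi>) c d (F \<circ> \<phi>)"
proof (rule primitive_onI)
  fix s assume s: "c \<le> s" "s \<le> d"
  then have "\<phi> s \<in> \<phi> ` {c..d}" by simp
  then have "\<phi> s \<in> {a..b}" using \<phi>(2) by blast
  then have "a \<le> \<phi> s" "\<phi> s \<le> b" by simp_all
  then obtain V f \<delta> where V: "local_primitive A \<alpha> V f" "\<gamma> (\<phi> s) \<in> V" "\<delta> > 0"
    "\<And>t. \<lbrakk>a \<le> t; t \<le> b; \<bar>t - \<phi> s\<bar> < \<delta>\<rbrakk> \<Longrightarrow> F t = f (\<gamma> t)"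
    using primitive_onE[OF F] by metis
  obtain \<epsilon> where e: "\<epsilon> > 0" "\<And>t. \<lbrakk>c \<le> t; t \<le> d; \<bar>t - s\<bar> < \<epsilon>\<rbrakk> \<Longrightarrow> \<phi> t \<in> ball (\<phi> s) \<delta>"
    using continuous_on_window[OF \<phi>(1) s open_ball] V(3) by (metis centre_in_ball)
  have "F (\<phi> t) = f (\<gamma> (\<phi> t))" if "c \<le> t" "t \<le> d" "\<bar>t - s\<bar> < \<epsilon>" for t
    using e(2)[OF that] \<phi>(2)[unfolded image_subset_iff] that
    by (intro V(4)) (auto simp: dist_real_def abs_minus_commute)
  with V(1,2) e(1) show "\<exists>V f \<delta>. local_primitive A \<alpha> V f \<and> (\<gamma> \<circ> \<phi>) s \<in> V \<and> \<delta> > 0 \<and>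
        (\<forall>t. c \<le> t \<and> t \<le> d \<and> \<bar>t - s\<bar> < \<delta> \<longrightarrow> (F \<circ> \<phi>) t = f ((\<gamma> \<circ> \<phi>) t))"
    by (intro exI[of _ V] exI[of _ f] exI[of _ \<epsilon>]) auto
qed

context manifold begin

text \<open>Near each parameter both functions come from local primitives, which differ by a
  constant; bisection (\<open>Bolzano\<close>) spreads the equality of increments over the
  interval.\<close>

lemma primitive_on_unique:
  assumes F: "primitive_on A \<alpha> \<gamma> a b F" and G: "primitive_on A \<alpha> \<gamma> a b G"
    and \<gamma>: "continuous_on {a..b} \<gamma>" and "a \<le> b"
  shows "F b - F a = G b - G a"
proof -
  define P where "P u v \<longleftrightarrow> (a \<le> u \<and> u \<le> v \<and> v \<le> b \<longrightarrow> F v - G v = F u - G u)" for u v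
  have "P a b" using \<open>a \<le> b\<close>
  proof (rule Bolzano)
    show "P u w" if "P u v" "P v w" "u \<le> v" "v \<le> w" for u v w
      using that by (auto simp: P_def)
    fix x assume x: "a \<le> x" "x \<le> b"
    obtain V f d1 where f: "local_primitive A \<alpha> V f" "\<gamma> x \<in> V" "d1 > 0"
      "\<And>t. \<lbrakk>a \<le> t; t \<le> b; \<bar>t - x\<bar> < d1\<rbrakk> \<Longrightarrow> F t = f (\<gamma> t)"
      using primitive_onE[OF F x] by metis
    obtain W g d2 where g: "local_primitive A \<alpha> W g" "\<gamma> x \<in> W" "d2 > 0"
      "\<And>t. \<lbrakk>a \<le> t; t \<le> b; \<bar>t - x\<bar> < d2\<rbrakk> \<Longrightarrow> G t = g (\<gamma> t)"
      using primitive_onE[OF G x] by metis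
    obtain U C where U: "open U" "\<gamma> x \<in> U" "U \<subseteq> V \<inter> W" "\<And>q. q \<in> U \<Longrightarrow> f q = g q + C"
      using local_primitive_diff[OF f(1) g(1) f(2) g(2)] by metis
    obtain d3 where d3: "d3 > 0" "\<And>t. \<lbrakk>a \<le> t; t \<le> b; \<bar>t - x\<bar> < d3\<rbrakk> \<Longrightarrow> \<gamma> t \<in> U"
      using continuous_on_window[OF \<gamma> x U(1,2)] by metis
    have const: "F t - G t = C" if "a \<le> t" "t \<le> b" "\<bar>t - x\<bar> < Min {d1, d2, d3}" for t
      using that f(4) g(4) U(4)[OF d3(2)] by simp
    show "\<exists>d>0. \<forall>u v. u \<le> x \<and> x \<le> v \<and> v - u < d \<longrightarrow> P u v"
      using f(3) g(3) d3(1) by (intro exI[of _ "Min {d1, d2, d3}"]) (auto simp: P_def const)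
  qed
  then show ?thesis using \<open>a \<le> b\<close> by (simp add: P_def)
qed

text \<open>Shifting \<open>G\<close> by a constant makes the values meet at \<open>b\<close>. Away
  from \<open>b\<close> one of the given primitives serves; at \<open>b\<close> a single local
  primitive has to serve both sides.\<close>

lemma primitive_on_join:
  assumes F: "primitive_on A \<alpha> \<gamma> a b F" and G: "primitive_on A \<alpha> \<gamma> b c G"
    and le: "a \<le> b" "b \<le> c" and \<gamma>: "continuous_on {a..c} \<gamma>"
  shows "primitive_on A \<alpha> \<gamma> a c (\<lambda>t. if t \<le> b then F t else G t - G b + F b)"
    (is "primitive_on A \<alpha> \<gamma> a c ?H")
proof (rule primitive_onI)
  fix s assume s: "a \<le> s" "s \<le> c"
  show "\<exists>V f \<delta>. local_primitive A \<alpha> V f \<and> \<gamma> s \<in> V \<and> \<delta> > 0 \<and>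
        (\<forall>t. a \<le> t \<and> t \<le> c \<and> \<bar>t - s\<bar> < \<delta> \<longrightarrow> ?H t = f (\<gamma> t))"
  proof (cases s b rule: linorder_cases)
    case less
    obtain V f d where f: "local_primitive A \<alpha> V f" "\<gamma> s \<in> V" "d > 0"
      "\<And>t. \<lbrakk>a \<le> t; t \<le> b; \<bar>t - s\<bar> < d\<rbrakk> \<Longrightarrow> F t = f (\<gamma> t)"
      using primitive_onE[OF F s(1)] less by (metis less_imp_le)
    then show ?thesis using less
      by (intro exI[of _ V] exI[of _ f] exI[of _ "min d (b - s)"]) (auto simp: abs_if split: if_splits)
  next
    case greater
    obtain V f d where f: "local_primitive A \<alpha> V f" "\<gamma> s \<in> V" "d > 0"
      "\<And>t. \<lbrakk>b \<le> t; t \<le> c; \<bar>t - s\<bar> < d\<rbrakk> \<Longrightarrow> G t = f (\<gamma> t)"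
      using primitive_onE[OF G _ s(2)] greater by (metis less_imp_le)
    then show ?thesis using greater local_primitive_add_const[OF f(1), of "F b - G b"]
      by (intro exI[of _ V] exI[of _ "\<lambda>p. f p + (F b - G b)"] exI[of _ "min d (s - b)"]) auto
  next
    \<comment> \<open>\<open>f\<close> serves both sides: on the left by its choice, on the right
      because \<open>f = g + C\<close> near \<open>\<gamma> b\<close> and the shift
      \<open>F b - G b\<close> is exactly \<open>C\<close>.\<close>
    case equal
    obtain V f d1 where f: "local_primitive A \<alpha> V f" "\<gamma> b \<in> V" "d1 > 0"
      "\<And>t. \<lbrakk>a \<le> t; t \<le> b; \<bar>t - b\<bar> < d1\<rbrakk> \<Longrightarrow> F t = f (\<gamma> t)"
      using primitive_onE[OF F le(1)] by (metis order_refl)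
    obtain W g d2 where g: "local_primitive A \<alpha> W g" "\<gamma> b \<in> W" "d2 > 0"
      "\<And>t. \<lbrakk>b \<le> t; t \<le> c; \<bar>t - b\<bar> < d2\<rbrakk> \<Longrightarrow> G t = g (\<gamma> t)"
      using primitive_onE[OF G _ le(2)] by (metis order_refl)
    obtain U C where U: "open U" "\<gamma> b \<in> U" "U \<subseteq> V \<inter> W" "\<And>q. q \<in> U \<Longrightarrow> f q = g q + C"
      using local_primitive_diff[OF f(1) g(1) f(2) g(2)] by metis
    obtain d3 where d3: "d3 > 0" "\<And>t. \<lbrakk>a \<le> t; t \<le> c; \<bar>t - b\<bar> < d3\<rbrakk> \<Longrightarrow> \<gamma> t \<in> U"
      using continuous_on_window[OF \<gamma> le U(1,2)] by metis
    have b: "F b = f (\<gamma> b)" "G b = g (\<gamma> b)" "f (\<gamma> b) = g (\<gamma> b) + C"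
      using f(3,4) g(3,4) U(2,4) le by auto
    have "?H t = f (\<gamma> t)" if "a \<le> t" "t \<le> c" "\<bar>t - b\<bar> < Min {d1, d2, d3}" for t
      using that f(4)[of t] g(4)[of t] U(4)[OF d3(2), of t] b by auto
    then show ?thesis using f(1-3) g(3) d3(1) equal
      by (intro exI[of _ V] exI[of _ f] exI[of _ "Min {d1, d2, d3}"]) auto
  qed
qed

text \<open>A local primitive settles short intervals and \<open>primitive_on_join\<close> unites
  adjacent ones, so bisection applies.\<close>

lemma primitive_on_exists:
  assumes \<alpha>: "closed_one_form A \<alpha>" and \<gamma>: "continuous_on {a..b} \<gamma>" and "a \<le> b"
  obtains F where "primitive_on A \<alpha> \<gamma> a b F"
proof -
  define P where "P u v \<longleftrightarrow> (a \<le> u \<and> u \<le> v \<and> v \<le> b \<longrightarrow> (\<exists>F. primitive_on A \<alpha> \<gamma> u v F))" for u v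
  have "P a b" using \<open>a \<le> b\<close>
  proof (rule Bolzano)
    show "P u w" if "P u v" "P v w" "u \<le> v" "v \<le> w" for u v w
      unfolding P_def
    proof
      assume a: "a \<le> u \<and> u \<le> w \<and> w \<le> b"
      then have "\<exists>F. primitive_on A \<alpha> \<gamma> u v F" "\<exists>G. primitive_on A \<alpha> \<gamma> v w G"
        using that by (simp_all add: P_def)
      then obtain F G where "primitive_on A \<alpha> \<gamma> u v F" "primitive_on A \<alpha> \<gamma> v w G"
        by blast
      from primitive_on_join[OF this that(3,4) continuous_on_subset[OF \<gamma>]] a
      show "\<exists>F. primitive_on A \<alpha> \<gamma> u w F" by (metis atLeastatMost_subset_iff)
    qed
    fix x assume x: "a \<le> x" "x \<le> b"
    obtain V f where f: "\<gamma> x \<in> V" "local_primitive A \<alpha> V f"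
      using local_primitive_exists[OF \<alpha>] .
    then have "open V" by (simp add: local_primitive_def)
    obtain d where d: "d > 0" "\<And>t. \<lbrakk>a \<le> t; t \<le> b; \<bar>t - x\<bar> < d\<rbrakk> \<Longrightarrow> \<gamma> t \<in> V"
      using continuous_on_window[OF \<gamma> x \<open>open V\<close> f(1)] by metis
    have "P u v" if "u \<le> x \<and> x \<le> v \<and> v - u < d" for u v
      using that primitive_on_local[OF f(2), of \<gamma> u v] d(2) by (force simp: P_def)
    then show "\<exists>d>0. \<forall>u v. u \<le> x \<and> x \<le> v \<and> v - u < d \<longrightarrow> P u v"
      using d(1) by blast
  qed
  then show ?thesis using \<open>a \<le> b\<close> that by (auto simp: P_def)
qed

lemma primitive_on_increment:
  assumes "primitive_on A \<alpha> \<gamma> a b F" "continuous_on {a..b} \<gamma>" "a \<le> b"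
    "local_primitive A \<alpha> V f" "\<gamma> ` {a..b} \<subseteq> V"
  shows "F b - F a = f (\<gamma> b) - f (\<gamma> a)"
  using primitive_on_unique[OF assms(1) primitive_on_local[OF assms(4,5)] assms(2,3)] by simp

lemma line_integral_eq:
  assumes "primitive_on A \<alpha> \<gamma> 0 1 F" "path \<gamma>"
  shows "line_integral A \<alpha> \<gamma> = F 1 - F 0"
  unfolding line_integral_def primitive_along_iff
proof (rule the_equality)
  fix r assume "\<exists>G. primitive_on A \<alpha> \<gamma> 0 1 G \<and> r = G 1 - G 0"
  then obtain G where "primitive_on A \<alpha> \<gamma> 0 1 G" "r = G 1 - G 0" by blast
  then show "r = F 1 - F 0"
    using primitive_on_unique[OF _ assms(1) assms(2)[unfolded path_def]] by simp
qed (use assms(1) in blast)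

lemma line_integral_global_primitive:
  assumes "local_primitive A \<alpha> UNIV f" "path \<gamma>"
  shows "line_integral A \<alpha> \<gamma> = f (\<gamma> 1) - f (\<gamma> 0)"
  using line_integral_eq[OF primitive_on_local[OF assms(1)] assms(2)] by simp

lemma line_integral_local:
  assumes "local_primitive A \<alpha> V f" "path \<gamma>" "path_image \<gamma> \<subseteq> V"
  shows "line_integral A \<alpha> \<gamma> = f (pathfinish \<gamma>) - f (pathstart \<gamma>)"
  using line_integral_eq[OF primitive_on_local[OF assms(1)] assms(2)] assms(3)
  by (simp add: path_image_def pathstart_def pathfinish_def)

lemma line_integral_join:
  assumes \<alpha>: "closed_one_form A \<alpha>" and \<gamma>: "path \<gamma>" "path \<eta>" "pathfinish \<gamma> = pathstart \<eta>"
  shows "line_integral A \<alpha> (\<gamma> +++ \<eta>) = line_integral A \<alpha> \<gamma> + line_integral A \<alpha> \<eta>"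
proof -
  have path: "path (\<gamma> +++ \<eta>)" using \<gamma> by simp
  obtain F where F: "primitive_on A \<alpha> \<gamma> 0 1 F"
    using primitive_on_exists[OF \<alpha>, of 0 1 \<gamma>] \<gamma>(1) by (auto simp: path_def)
  obtain G where G: "primitive_on A \<alpha> \<eta> 0 1 G"
    using primitive_on_exists[OF \<alpha>, of 0 1 \<eta>] \<gamma>(2) by (auto simp: path_def)
  have "primitive_on A \<alpha> (\<gamma> \<circ> (\<lambda>t. 2 * t)) 0 (1/2) (F \<circ> (\<lambda>t. 2 * t))"
    by (rule primitive_on_reparam[OF F]) (auto intro!: continuous_intros)
  then have 1: "primitive_on A \<alpha> (\<gamma> +++ \<eta>) 0 (1/2) (F \<circ> (\<lambda>t. 2 * t))"
    by (rule primitive_on_cong) (simp add: joinpaths_def)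
  have "primitive_on A \<alpha> (\<eta> \<circ> (\<lambda>t. 2 * t - 1)) (1/2) 1 (G \<circ> (\<lambda>t. 2 * t - 1))"
    by (rule primitive_on_reparam[OF G]) (auto intro!: continuous_intros)
  then have 2: "primitive_on A \<alpha> (\<gamma> +++ \<eta>) (1/2) 1 (G \<circ> (\<lambda>t. 2 * t - 1))"
  proof (rule primitive_on_cong)
    fix t :: real assume "1 / 2 \<le> t"
    then show "(\<gamma> +++ \<eta>) t = (\<eta> \<circ> (\<lambda>t. 2 * t - 1)) t"
    proof (cases "t = 1 / 2")
      \<comment> \<open>\<open>joinpaths\<close> uses the first curve at \<open>1/2\<close>; the
        formulas agree there because the curves meet.\<close>
      case True
      show ?thesis unfolding True using \<gamma>(3) by (simp add: joinpaths_def pathfinish_def pathstart_def)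
    qed (auto simp: joinpaths_def)
  qed
  from line_integral_eq[OF primitive_on_join[OF 1 2] path] path
  show ?thesis
    unfolding line_integral_eq[OF F \<gamma>(1)] line_integral_eq[OF G \<gamma>(2)] by (simp add: path_def)
qed

end

section \<open>Invariance of periods under the identity component\<close>

lemma openin_C0_topology: "\<lbrakk>compact K; open W\<rbrakk> \<Longrightarrow> openin C0_topology {f. f ` K \<subseteq> W}"
  unfolding C0_topology_def by (rule topology_generated_by_Basis) auto

text \<open>The open sets around the points with value \<open>\<Phi> h\<close> and those around the
  others would separate \<open>T\<close>. Constancy is asked on \<open>N \<inter> T\<close> only,
  since \<open>C0_topology\<close> lives on all self-maps, continuous or not.\<close>

lemma locally_constant_on_connectedin:
  assumes T: "connectedin X T"
    and loc: "\<And>h. h \<in> T \<Longrightarrow> \<exists>N. openin X N \<and> h \<in> N \<and> (\<forall>k\<in>N \<inter> T. \<Phi> k = \<Phi> h)"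
    and "h \<in> T" "k \<in> T"
  shows "\<Phi> k = \<Phi> h"
proof (rule ccontr)
  assume ne: "\<Phi> k \<noteq> \<Phi> h"
  obtain N where N: "\<And>h. h \<in> T \<Longrightarrow> openin X (N h) \<and> h \<in> N h \<and> (\<forall>k\<in>N h \<inter> T. \<Phi> k = \<Phi> h)"
    using loc by metis
  define E1 where "E1 = \<Union> (N ` {f\<in>T. \<Phi> f = \<Phi> h})"
  define E2 where "E2 = \<Union> (N ` {f\<in>T. \<Phi> f \<noteq> \<Phi> h})"
  have "openin X E1" "openin X E2" using N by (auto simp: E1_def E2_def)
  moreover have "T \<subseteq> E1 \<union> E2" using N unfolding E1_def E2_def by blast
  moreover have "E1 \<inter> E2 \<inter> T = {}"
  proof (rule ccontr)
    assume "E1 \<inter> E2 \<inter> T \<noteq> {}"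
    then obtain f f1 f2 where f: "f \<in> T" "f1 \<in> T" "\<Phi> f1 = \<Phi> h" "f \<in> N f1" "f2 \<in> T" "\<Phi> f2 \<noteq> \<Phi> h" "f \<in> N f2"
      unfolding E1_def E2_def by blast
    then have "\<Phi> f = \<Phi> f1" "\<Phi> f = \<Phi> f2" using N[OF f(2)] N[OF f(5)] by blast+
    with f show False by simp
  qed
  moreover have "h \<in> E1 \<inter> T" "k \<in> E2 \<inter> T" using N assms(3,4) ne unfolding E1_def E2_def by blast+
  then have "E1 \<inter> T \<noteq> {}" "E2 \<inter> T \<noteq> {}" by blast+
  ultimately show False using T unfolding connectedin by blast
qed

context manifold begin

text \<open>For \<open>k\<close> close to \<open>h\<close> the integrals along \<open>h \<circ> \<gamma>\<close> and \<open>k \<circ> \<gamma>\<close> differ by boundary terms that only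
  depend on the local primitives chosen at the two end points.\<close>

lemma integral_variation:
  assumes \<alpha>: "closed_one_form A \<alpha>" and h: "continuous_on UNIV h" and \<gamma>: "path \<gamma>"
    and f0: "local_primitive A \<alpha> V0 f0" "h (\<gamma> 0) \<in> V0"
    and f1: "local_primitive A \<alpha> V1 f1" "h (\<gamma> 1) \<in> V1"
  shows "\<exists>N. openin C0_topology N \<and> h \<in> N \<and> (\<forall>k\<in>N. continuous_on UNIV k \<longrightarrow>
    line_integral A \<alpha> (k \<circ> \<gamma>) - line_integral A \<alpha> (h \<circ> \<gamma>)
      = (f1 (k (\<gamma> 1)) - f1 (h (\<gamma> 1))) - (f0 (k (\<gamma> 0)) - f0 (h (\<gamma> 0))))"
proof -
  have c\<gamma>: "continuous_on {0..1} \<gamma>" using \<gamma> by (simp add: path_def)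
  have ck: "continuous_on {u..v} (k \<circ> \<gamma>)" if "continuous_on UNIV k" "0 \<le> u" "v \<le> 1" for k :: "'m \<Rightarrow> 'm" and u v
    using that continuous_on_subset[OF c\<gamma>, of "{u..v}"] continuous_on_subset[OF that(1)]
    by (intro continuous_on_compose) auto
  \<comment> \<open>Stated with increments of arbitrary primitives \<open>F\<close> and
    \<open>G\<close>, since \<open>line_integral\<close> is tied to the unit interval.\<close>
  define R where "R k u v fu fv \<longleftrightarrow> (\<forall>F G. primitive_on A \<alpha> (h \<circ> \<gamma>) u v F \<and> primitive_on A \<alpha> (k \<circ> \<gamma>) u v G \<longrightarrow>
      (G v - G u) - (F v - F u) = (fv (k (\<gamma> v)) - fv (h (\<gamma> v))) - (fu (k (\<gamma> u)) - fu (h (\<gamma> u))))"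
    for k u v and fu fv :: "'m \<Rightarrow> real"
  \<comment> \<open>Quantifying over all local primitives at both ends lets the one chosen at a
    middle parameter serve for both halves, where its terms cancel.\<close>
  define P where "P u v \<longleftrightarrow> (0 \<le> u \<and> u \<le> v \<and> v \<le> 1 \<longrightarrow> (\<forall>Vu fu Vv fv.
      local_primitive A \<alpha> Vu fu \<and> h (\<gamma> u) \<in> Vu \<and> local_primitive A \<alpha> Vv fv \<and> h (\<gamma> v) \<in> Vv \<longrightarrow>
      (\<exists>N. openin C0_topology N \<and> h \<in> N \<and> (\<forall>k\<in>N. continuous_on UNIV k \<longrightarrow> R k u v fu fv))))" for u v
  have "P 0 1"
  proof (rule Bolzano)
    fix u v w assume uv: "P u v" and vw: "P v w" and le: "u \<le> v" "v \<le> w"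
    show "P u w"
      unfolding P_def
    proof safe
      fix Vu fu Vw fw
      assume b: "0 \<le> u" "w \<le> 1" "local_primitive A \<alpha> Vu fu" "h (\<gamma> u) \<in> Vu"
        "local_primitive A \<alpha> Vw fw" "h (\<gamma> w) \<in> Vw"
      obtain Vv fv where fv: "h (\<gamma> v) \<in> Vv" "local_primitive A \<alpha> Vv fv"
        using local_primitive_exists[OF \<alpha>] .
      obtain N where N: "openin C0_topology N" "h \<in> N"
        "\<And>k. k \<in> N \<Longrightarrow> continuous_on UNIV k \<Longrightarrow> R k u v fu fv"
        using uv[unfolded P_def, rule_format, of Vu fu Vv fv] b fv order_trans[OF le(2) b(2)] le(1) by blast
      obtain N' where N': "openin C0_topology N'" "h \<in> N'"
        "\<And>k. k \<in> N' \<Longrightarrow> continuous_on UNIV k \<Longrightarrow> R k v w fv fw"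
        using vw[unfolded P_def, rule_format, of Vv fv Vw fw] b fv order_trans[OF b(1) le(1)] le(2) by blast
      have "R k u w fu fw" if "k \<in> N \<inter> N'" "continuous_on UNIV k" for k
        unfolding R_def
      proof safe
        fix F G assume FG: "primitive_on A \<alpha> (h \<circ> \<gamma>) u w F" "primitive_on A \<alpha> (k \<circ> \<gamma>) u w G"
        have "R k u v fu fv" "R k v w fv fw" using that N(3) N'(3) by auto
        then have "(G v - G u) - (F v - F u) = (fv (k (\<gamma> v)) - fv (h (\<gamma> v))) - (fu (k (\<gamma> u)) - fu (h (\<gamma> u)))"
          "(G w - G v) - (F w - F v) = (fw (k (\<gamma> w)) - fw (h (\<gamma> w))) - (fv (k (\<gamma> v)) - fv (h (\<gamma> v)))"
          unfolding R_def using primitive_on_subinterval[OF FG(1)] primitive_on_subinterval[OF FG(2)] le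
          by simp_all
        then show "(G w - G u) - (F w - F u) = (fw (k (\<gamma> w)) - fw (h (\<gamma> w))) - (fu (k (\<gamma> u)) - fu (h (\<gamma> u)))"
          by linarith
      qed
      then show "\<exists>N. openin C0_topology N \<and> h \<in> N \<and> (\<forall>k\<in>N. continuous_on UNIV k \<longrightarrow> R k u w fu fw)"
        using N N' by (intro exI[of _ "N \<inter> N'"]) auto
    qed
  next
    fix x :: real assume x: "0 \<le> x" "x \<le> 1"
    obtain V f where f: "(h \<circ> \<gamma>) x \<in> V" "local_primitive A \<alpha> V f"
      using local_primitive_exists[OF \<alpha>] .
    have V: "open V" using f by (simp add: local_primitive_def)
    obtain d where d: "d > 0" "\<And>t. \<lbrakk>0 \<le> t; t \<le> 1; \<bar>t - x\<bar> < d\<rbrakk> \<Longrightarrow> (h \<circ> \<gamma>) t \<in> V"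
      using continuous_on_window[OF ck[OF h order_refl order_refl] x V f(1)] by metis
    have "P u v" if uv: "u \<le> x" "x \<le> v" "v - u < d" for u v
      unfolding P_def
    proof safe
      fix Vu fu Vv fv
      assume b: "0 \<le> u" "v \<le> 1" "u \<le> v" "local_primitive A \<alpha> Vu fu" "h (\<gamma> u) \<in> Vu"
        "local_primitive A \<alpha> Vv fv" "h (\<gamma> v) \<in> Vv"
      have hV: "(h \<circ> \<gamma>) ` {u..v} \<subseteq> V" using d(2) uv b by auto
      then have in_V: "h (\<gamma> u) \<in> V" "h (\<gamma> v) \<in> V" using b by auto
      obtain U C where U: "open U" "h (\<gamma> u) \<in> U" "\<And>q. q \<in> U \<Longrightarrow> fu q = f q + C"
        using local_primitive_diff[OF b(4) f(2) b(5) in_V(1)] by metis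
      obtain W D where W: "open W" "h (\<gamma> v) \<in> W" "\<And>q. q \<in> W \<Longrightarrow> fv q = f q + D"
        using local_primitive_diff[OF b(6) f(2) b(7) in_V(2)] by metis
      \<comment> \<open>\<open>k\<close> has to keep the whole piece of curve in \<open>V\<close>,
        where \<open>f\<close> computes both increments, and the images of its end points in
        \<open>U\<close> and \<open>W\<close>, where \<open>fu\<close> and \<open>fv\<close> differ
        from \<open>f\<close> by constants.\<close>
      let ?N = "{k. k ` \<gamma> ` {u..v} \<subseteq> V} \<inter> {k. k ` {\<gamma> u} \<subseteq> U} \<inter> {k. k ` {\<gamma> v} \<subseteq> W}"
      have "compact (\<gamma> ` {u..v})"
        using c\<gamma> b by (intro compact_continuous_image continuous_on_subset[OF c\<gamma>]) auto
      then have "openin C0_topology ?N"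
        using V U(1) W(1) by (intro openin_Int openin_C0_topology) auto
      moreover have "h \<in> ?N" using hV U(2) W(2) by (auto simp: image_comp)
      moreover have "R k u v fu fv" if k: "k \<in> ?N" "continuous_on UNIV k" for k
        unfolding R_def
      proof safe
        fix F G assume FG: "primitive_on A \<alpha> (h \<circ> \<gamma>) u v F" "primitive_on A \<alpha> (k \<circ> \<gamma>) u v G"
        have "F v - F u = f ((h \<circ> \<gamma>) v) - f ((h \<circ> \<gamma>) u)"
          by (rule primitive_on_increment[OF FG(1) ck[OF h b(1,2)] b(3) f(2) hV])
        moreover have "G v - G u = f ((k \<circ> \<gamma>) v) - f ((k \<circ> \<gamma>) u)"
          by (rule primitive_on_increment[OF FG(2) ck[OF k(2) b(1,2)] b(3) f(2)])
            (use k(1) in \<open>auto simp: image_comp\<close>)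
        moreover have "k (\<gamma> u) \<in> U" "k (\<gamma> v) \<in> W" using k(1) by auto
        ultimately show "(G v - G u) - (F v - F u) = (fv (k (\<gamma> v)) - fv (h (\<gamma> v))) - (fu (k (\<gamma> u)) - fu (h (\<gamma> u)))"
          using U(2,3) W(2,3) by simp
      qed
      ultimately show "\<exists>N. openin C0_topology N \<and> h \<in> N \<and> (\<forall>k\<in>N. continuous_on UNIV k \<longrightarrow> R k u v fu fv)"
        by (intro exI[of _ ?N] conjI ballI impI)
    qed
    then show "\<exists>d>0. \<forall>u v. u \<le> x \<and> x \<le> v \<and> v - u < d \<longrightarrow> P u v" using d(1) by blast
  qed simp
  from this[unfolded P_def, rule_format, of V0 f0 V1 f1] f0 f1
  obtain N where N: "openin C0_topology N" "h \<in> N"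
    "\<And>k. k \<in> N \<Longrightarrow> continuous_on UNIV k \<Longrightarrow> R k 0 1 f0 f1"
    by auto
  have "line_integral A \<alpha> (k \<circ> \<gamma>) - line_integral A \<alpha> (h \<circ> \<gamma>)
      = (f1 (k (\<gamma> 1)) - f1 (h (\<gamma> 1))) - (f0 (k (\<gamma> 0)) - f0 (h (\<gamma> 0)))"
    if k: "k \<in> N" "continuous_on UNIV k" for k
  proof -
    have p: "path (h \<circ> \<gamma>)" "path (k \<circ> \<gamma>)" using ck[OF h] ck[OF k(2)] by (auto simp: path_def)
    obtain F where F: "primitive_on A \<alpha> (h \<circ> \<gamma>) 0 1 F"
      using primitive_on_exists[OF \<alpha> p(1)[unfolded path_def]] by auto
    obtain G where G: "primitive_on A \<alpha> (k \<circ> \<gamma>) 0 1 G"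
      using primitive_on_exists[OF \<alpha> p(2)[unfolded path_def]] by auto
    show ?thesis
      using N(3)[OF k, unfolded R_def, rule_format, of F G] F G
      unfolding line_integral_eq[OF F p(1)] line_integral_eq[OF G p(2)] by simp
  qed
  with N(1,2) show ?thesis by blast
qed

definition displacement_welldefined :: "('m, 'n) one_form \<Rightarrow> ('m \<Rightarrow> 'm) \<Rightarrow> bool" where
  "displacement_welldefined \<alpha> h \<longleftrightarrow> continuous_on UNIV h \<and>
     (\<forall>\<gamma> \<eta>. path \<gamma> \<and> path \<eta> \<and> pathstart \<gamma> = pathstart \<eta> \<and> pathfinish \<gamma> = pathfinish \<eta> \<longrightarrow>
        line_integral A \<alpha> (h \<circ> \<gamma>) - line_integral A \<alpha> \<gamma> = line_integral A \<alpha> (h \<circ> \<eta>) - line_integral A \<alpha> \<eta>)"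

lemma volume_homeos_0_subset: "volume_homeos_0 A \<Omega> \<subseteq> volume_homeos A \<Omega>"
  unfolding volume_homeos_0_def
  using connected_component_of_subset_topspace[of "subtopology C0_topology (volume_homeos A \<Omega>)" id] by auto

lemma displacement_welldefined_volume_homeos_0:
  assumes \<alpha>: "closed_one_form A \<alpha>" and h: "h \<in> volume_homeos_0 A \<Omega>"
  shows "displacement_welldefined \<alpha> h"
  unfolding displacement_welldefined_def
proof (intro conjI allI impI)
  have cont: "continuous_on UNIV k" if "k \<in> volume_homeos A \<Omega>" for k
    using that by (auto simp: volume_homeos_def homeomorphism_def)
  show "continuous_on UNIV h" using cont h volume_homeos_0_subset by blast
  fix \<gamma> \<eta> :: "real \<Rightarrow> 'm"
  assume *: "path \<gamma> \<and> path \<eta> \<and> pathstart \<gamma> = pathstart \<eta> \<and> pathfinish \<gamma> = pathfinish \<eta>"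
  then have ends: "\<gamma> 0 = \<eta> 0" "\<gamma> 1 = \<eta> 1" by (auto simp: pathstart_def pathfinish_def)
  obtain T where T: "connectedin (subtopology C0_topology (volume_homeos A \<Omega>)) T" "id \<in> T" "h \<in> T"
    using h by (auto simp: volume_homeos_0_def connected_component_of_def)
  have T': "connectedin C0_topology T" "T \<subseteq> volume_homeos A \<Omega>"
    using T(1) by (auto simp: connectedin_subtopology)
  define \<Phi> where "\<Phi> k = line_integral A \<alpha> (k \<circ> \<gamma>) - line_integral A \<alpha> (k \<circ> \<eta>)" for k
  have "\<Phi> h = \<Phi> id"
  proof (rule locally_constant_on_connectedin[OF T'(1) _ T(2,3)])
    fix k assume k: "k \<in> T"
    then have ck: "continuous_on UNIV k" using cont T'(2) by blast
    obtain V0 f0 where f0: "k (\<gamma> 0) \<in> V0" "local_primitive A \<alpha> V0 f0"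
      using local_primitive_exists[OF \<alpha>] .
    obtain V1 f1 where f1: "k (\<gamma> 1) \<in> V1" "local_primitive A \<alpha> V1 f1"
      using local_primitive_exists[OF \<alpha>] .
    \<comment> \<open>The same \<open>f0\<close> and \<open>f1\<close> serve for both curves because
      their end points coincide, so the boundary terms cancel in \<open>\<Phi>\<close>.\<close>
    note v = integral_variation[OF \<alpha> ck _ f0(2) _ f1(2)]
    obtain N where N: "openin C0_topology N" "k \<in> N"
      "\<And>k'. k' \<in> N \<Longrightarrow> continuous_on UNIV k' \<Longrightarrow>
        line_integral A \<alpha> (k' \<circ> \<gamma>) - line_integral A \<alpha> (k \<circ> \<gamma>)
      = (f1 (k' (\<gamma> 1)) - f1 (k (\<gamma> 1))) - (f0 (k' (\<gamma> 0)) - f0 (k (\<gamma> 0)))"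
      using v[of \<gamma>] f0(1) f1(1) * by auto
    obtain N' where N': "openin C0_topology N'" "k \<in> N'"
      "\<And>k'. k' \<in> N' \<Longrightarrow> continuous_on UNIV k' \<Longrightarrow>
        line_integral A \<alpha> (k' \<circ> \<eta>) - line_integral A \<alpha> (k \<circ> \<eta>)
      = (f1 (k' (\<eta> 1)) - f1 (k (\<eta> 1))) - (f0 (k' (\<eta> 0)) - f0 (k (\<eta> 0)))"
      using v[of \<eta>] f0(1) f1(1) * ends by auto
    have "\<Phi> k' = \<Phi> k" if "k' \<in> N \<inter> N' \<inter> T" for k'
      using N(3)[of k'] N'(3)[of k'] that cont T'(2) ends by (auto simp: \<Phi>_def)
    then show "\<exists>N. openin C0_topology N \<and> k \<in> N \<and> (\<forall>k'\<in>N \<inter> T. \<Phi> k' = \<Phi> k)"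
      using N(1,2) N'(1,2) by (intro exI[of _ "N \<inter> N'"]) auto
  qed
  then show "line_integral A \<alpha> (h \<circ> \<gamma>) - line_integral A \<alpha> \<gamma> = line_integral A \<alpha> (h \<circ> \<eta>) - line_integral A \<alpha> \<eta>"
    by (simp add: \<Phi>_def)
qed

end

section \<open>Connecting points by \<open>C\<^sup>1\<close> curves\<close>

text \<open>A smooth transition from 0 to 1, constant for \<open>t \<le> 1/3\<close> and for
  \<open>t \<ge> 2/3\<close>; a segment traversed at this pace rests near both ends.\<close>

definition step :: "real \<Rightarrow> real" where
  "step t = flat 1 (t - 1/3) / (flat 1 (t - 1/3) + flat 1 (2/3 - t))"

lemma flat_nonneg: "flat 1 t \<ge> 0" and flat_pos_iff: "flat 1 t > 0 \<longleftrightarrow> t > 0"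
  by (simp_all add: flat_def)

text \<open>The summands are positive for \<open>t > 1/3\<close> and for \<open>t < 2/3\<close>
  respectively, and one of these always holds.\<close>

lemma step_denominator: "flat 1 (t - 1/3) + flat 1 (2/3 - t) > 0"
  using flat_nonneg[of "t - 1/3"] flat_nonneg[of "2/3 - t"] flat_pos_iff[of "t - 1/3"] flat_pos_iff[of "2/3 - t"]
  by (cases "t > 1/3") (auto intro: add_pos_nonneg add_nonneg_pos)

lemma step_range: "0 \<le> step t" "step t \<le> 1"
  using step_denominator[of t] flat_nonneg[of "t - 1/3"] flat_nonneg[of "2/3 - t"]
  by (simp_all add: step_def divide_le_eq)

lemma step_eq_0: "t \<le> 1/3 \<Longrightarrow> step t = 0"
  by (simp add: step_def flat_def)

lemma step_eq_1: assumes "t \<ge> 2/3" shows "step t = 1"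
proof -
  have "flat 1 (2/3 - t) = 0" using assms by (simp add: flat_def)
  then show ?thesis using step_denominator[of t] by (simp add: step_def)
qed

lemma step_C1:
  obtains step' where "\<And>t. (step has_vector_derivative step' t) (at t)" "continuous_on UNIV step'"
proof -
  define q where "q = pCons (0::real) (pCons 0 (1 - pderiv 1))"
  define u v u' v' where "u t = flat 1 (t - 1/3)" and "v t = flat 1 (2/3 - t)"
    and "u' t = flat q (t - 1/3)" and "v' t = - flat q (2/3 - t)" for t
  have flat: "(flat 1 has_real_derivative flat q t) (at t)" for t
    unfolding q_def by (rule flat_has_field_derivative)
  have d: "(u has_real_derivative u' t) (at t)" "(v has_real_derivative v' t) (at t)" for t
  proof -
    have "((\<lambda>t. t - 1/3) has_real_derivative 1) (at t)" "((\<lambda>t. 2/3 - t) has_real_derivative -1) (at t)"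
      by (auto intro!: derivative_eq_intros)
    then show "(u has_real_derivative u' t) (at t)" "(v has_real_derivative v' t) (at t)"
      using DERIV_chain2[OF flat] unfolding u_def v_def u'_def v'_def by fastforce+
  qed
  have nz: "u t + v t \<noteq> 0" for t
    using step_denominator[of t] by (simp add: u_def v_def)
  define step' where "step' t = (u' t * (u t + v t) - u t * (u' t + v' t)) / ((u t + v t) * (u t + v t))" for t
  have "(step has_real_derivative step' t) (at t)" for t
    unfolding step_def[abs_def] step'_def u_def[symmetric] v_def[symmetric]
    by (intro DERIV_divide DERIV_add d nz)
  moreover have cont_flat: "continuous_on UNIV (flat p)" for p
    using smooth_on_continuous[OF smooth_on_flat] .
  have "continuous_on UNIV step'"
    unfolding step'_def u_def v_def u'_def v'_def
    by (intro continuous_intros continuous_on_compose2[OF cont_flat])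
      (use nz in \<open>auto simp: u_def v_def\<close>)
  ultimately show thesis
    using that unfolding has_real_derivative_iff_has_vector_derivative by blast
qed

context manifold begin

text \<open>The curves live on all of \<open>real\<close>, which avoids one-sided derivatives at
  \<open>0\<close> and \<open>1\<close>, and the condition is local, which makes pieces easy to
  glue.\<close>

definition C1_near :: "(real \<Rightarrow> 'm) \<Rightarrow> real \<Rightarrow> bool" where
  "C1_near \<gamma> t \<longleftrightarrow> (\<forall>c\<in>A. \<gamma> t \<in> cdom c \<longrightarrow> (\<exists>S D. open S \<and> t \<in> S \<and> continuous_on S D \<and>
     (\<forall>s\<in>S. ((cmap c \<circ> \<gamma>) has_vector_derivative D s) (at s))))"

lemma C1_curveI:
  assumes \<gamma>: "continuous_on {0..1} \<gamma>" and C1: "\<And>t. C1_near \<gamma> t"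
  shows "C1_curve A \<gamma>"
  unfolding C1_curve_def
proof (intro conjI \<gamma> ballI)
  fix c assume c: "c \<in> A"
  \<comment> \<open>A globally defined derivative, with which the local ones from
    \<open>C1_near\<close> agree wherever they exist.\<close>
  define D where "D t = vector_derivative (cmap c \<circ> \<gamma>) (at t)" for t
  let ?T = "{t \<in> {0..1}. \<gamma> t \<in> cdom c}"
  have *: "((cmap c \<circ> \<gamma>) has_vector_derivative D t) (at t) \<and> continuous (at t) D" if t: "\<gamma> t \<in> cdom c" for t
  proof -
    obtain S D' where S: "open S" "t \<in> S" "continuous_on S D'"
      "\<And>s. s \<in> S \<Longrightarrow> ((cmap c \<circ> \<gamma>) has_vector_derivative D' s) (at s)"
      using C1[of t, unfolded C1_near_def, rule_format, OF c t] by blast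
    have eq: "D' s = D s" if "s \<in> S" for s
      using vector_derivative_at[OF S(4)[OF that]] by (simp add: D_def)
    have "continuous_on S D" using continuous_on_eq[OF S(3) eq] .
    then have "continuous (at t) D" using S(1,2) continuous_on_eq_continuous_at by blast
    then show ?thesis using S(4)[OF S(2)] eq[OF S(2)] by simp
  qed
  then have "continuous_on ?T D" by (simp add: continuous_at_imp_continuous_on)
  moreover have "\<forall>t\<in>{0..1}. \<gamma> t \<in> cdom c \<longrightarrow> ((cmap c \<circ> \<gamma>) has_vector_derivative D t) (at t within {0..1})"
    using * has_vector_derivative_at_within by blast
  ultimately show "\<exists>D. continuous_on ?T D \<and> (\<forall>t\<in>{0..1}. \<gamma> t \<in> cdom c \<longrightarrow>
      ((cmap c \<circ> \<gamma>) has_vector_derivative D t) (at t within {0..1}))" by blast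
qed

lemma C1_near_cong:
  assumes "C1_near \<gamma> t" "open S" "t \<in> S" "\<And>s. s \<in> S \<Longrightarrow> \<gamma> s = \<eta> s"
  shows "C1_near \<eta> t"
  unfolding C1_near_def
proof (intro ballI impI)
  fix c assume c: "c \<in> A" "\<eta> t \<in> cdom c"
  then obtain S' D where S': "open S'" "t \<in> S'" "continuous_on S' D"
    "\<And>s. s \<in> S' \<Longrightarrow> ((cmap c \<circ> \<gamma>) has_vector_derivative D s) (at s)"
    using assms unfolding C1_near_def by metis
  have "((cmap c \<circ> \<eta>) has_vector_derivative D s) (at s)" if "s \<in> S \<inter> S'" for s
    by (rule has_vector_derivative_transform_within_open[OF S'(4) assms(2)]) (use that assms(4) in auto)
  then show "\<exists>S D. open S \<and> t \<in> S \<and> continuous_on S D \<and>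
      (\<forall>s\<in>S. ((cmap c \<circ> \<eta>) has_vector_derivative D s) (at s))"
    using S' assms(2,3) by (intro exI[of _ "S \<inter> S'"] exI[of _ D]) (auto intro: continuous_on_subset)
qed

lemma C1_near_const: "C1_near (\<lambda>_. p) t"
  unfolding C1_near_def
proof (intro ballI impI)
  fix c
  show "\<exists>S D. open S \<and> t \<in> S \<and> continuous_on S D \<and>
      (\<forall>s\<in>S. ((cmap c \<circ> (\<lambda>_. p)) has_vector_derivative D s) (at s))"
    by (intro exI[of _ UNIV] exI[of _ "\<lambda>_. 0"]) (auto simp: comp_def)
qed

lemma C1_near_affine:
  assumes "C1_near \<gamma> (4 * t - a)"
  shows "C1_near (\<lambda>t. \<gamma> (4 * t - a)) t"
  unfolding C1_near_def
proof (intro ballI impI)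
  fix c assume "c \<in> A" "\<gamma> (4 * t - a) \<in> cdom c"
  then obtain S D where S: "open S" "4 * t - a \<in> S" "continuous_on S D"
    "\<And>s. s \<in> S \<Longrightarrow> ((cmap c \<circ> \<gamma>) has_vector_derivative D s) (at s)"
    using assms unfolding C1_near_def by metis
  let ?T = "(\<lambda>t. 4 * t - a) -` S"
  have "open ?T" by (intro open_vimage S(1) continuous_intros)
  moreover have "t \<in> ?T" using S(2) by simp
  moreover have "continuous_on ?T (\<lambda>t. 4 *\<^sub>R D (4 * t - a))"
    by (intro continuous_intros continuous_on_compose2[OF S(3)]) auto
  moreover have "((cmap c \<circ> (\<lambda>t. \<gamma> (4 * t - a))) has_vector_derivative 4 *\<^sub>R D (4 * s - a)) (at s)"
    if "s \<in> ?T" for s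
  proof -
    have "((\<lambda>t. 4 * t - a) has_vector_derivative 4) (at s)"
      by (auto intro!: derivative_eq_intros simp flip: has_real_derivative_iff_has_vector_derivative)
    from vector_diff_chain_at[OF this S(4)] that show ?thesis by (simp add: comp_def)
  qed
  ultimately show "\<exists>S D. open S \<and> t \<in> S \<and> continuous_on S D \<and>
      (\<forall>s\<in>S. ((cmap c \<circ> (\<lambda>t. \<gamma> (4 * t - a))) has_vector_derivative D s) (at s))"
    by (intro exI[of _ ?T] exI[of _ "\<lambda>t. 4 *\<^sub>R D (4 * t - a)"]) auto
qed

text \<open>Curves that rest near their end points can be concatenated without losing regularity.\<close>

definition C1_linked :: "'m \<Rightarrow> 'm \<Rightarrow> bool" where
  "C1_linked p q \<longleftrightarrow> (\<exists>\<gamma>. continuous_on UNIV \<gamma> \<and> (\<forall>t. C1_near \<gamma> t) \<and>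
     (\<forall>t\<le>1/3. \<gamma> t = p) \<and> (\<forall>t\<ge>2/3. \<gamma> t = q))"

lemma C1_linked_trans:
  assumes "C1_linked p q" "C1_linked q r"
  shows "C1_linked p r"
proof -
  obtain \<gamma> where \<gamma>: "continuous_on UNIV \<gamma>" "\<And>t. C1_near \<gamma> t" "\<And>t. t \<le> 1/3 \<Longrightarrow> \<gamma> t = p" "\<And>t. t \<ge> 2/3 \<Longrightarrow> \<gamma> t = q"
    using assms(1) unfolding C1_linked_def by blast
  obtain \<eta> where \<eta>: "continuous_on UNIV \<eta>" "\<And>t. C1_near \<eta> t" "\<And>t. t \<le> 1/3 \<Longrightarrow> \<eta> t = q" "\<And>t. t \<ge> 2/3 \<Longrightarrow> \<eta> t = r"
    using assms(2) unfolding C1_linked_def by blast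
  \<comment> \<open>The slope \<open>4\<close> and the offsets \<open>1\<close> and \<open>2\<close>
    preserve the rests: \<open>\<sigma>\<close> stays at \<open>p\<close> up to \<open>1/3\<close>
    and at \<open>r\<close> from \<open>2/3\<close> on, and both pieces equal \<open>q\<close>
    between \<open>5/12\<close> and \<open>7/12\<close>, so there is no corner at
    \<open>1/2\<close>.\<close>
  define \<sigma> where "\<sigma> t = (if t \<le> 1/2 then \<gamma> (4 * t - 1) else \<eta> (4 * t - 2))" for t
  have "C1_near \<sigma> t" for t
  proof -
    consider "t < 1/2" | "t > 1/2" | "t \<in> {5/12<..<7/12}" by (auto simp: not_less) linarith
    then show ?thesis
    proof cases
      case 1
      show ?thesis
        by (rule C1_near_cong[OF C1_near_affine[OF \<gamma>(2)], of "{..<1/2}"]) (use 1 in \<open>auto simp: \<sigma>_def\<close>)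
    next
      case 2
      show ?thesis
        by (rule C1_near_cong[OF C1_near_affine[OF \<eta>(2)], of "{1/2<..}"]) (use 2 in \<open>auto simp: \<sigma>_def\<close>)
    next
      case 3
      show ?thesis
        by (rule C1_near_cong[OF C1_near_const[of q], of "{5/12<..<7/12}"])
          (use 3 \<gamma>(4) \<eta>(3) in \<open>auto simp: \<sigma>_def\<close>)
    qed
  qed
  moreover have "continuous_on UNIV \<sigma>"
  proof -
    have "continuous_on ({..1/2} \<union> {1/2..}) (\<lambda>t. if t \<le> 1/2 then \<gamma> (4 * t - 1) else \<eta> (4 * t - 2))"
      by (intro continuous_on_If continuous_on_compose2[OF \<gamma>(1)] continuous_on_compose2[OF \<eta>(1)] continuous_intros)
        (use \<gamma>(4) \<eta>(3) in auto)
    moreover have "{..1/2} \<union> {1/2..} = (UNIV :: real set)" by auto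
    ultimately show ?thesis by (simp add: \<sigma>_def[abs_def])
  qed
  moreover have "\<sigma> t = p" if "t \<le> 1/3" for t
    using that \<gamma>(3) by (auto simp: \<sigma>_def)
  moreover have "\<sigma> t = r" if "t \<ge> 2/3" for t
    using that \<eta>(4) by (auto simp: \<sigma>_def)
  ultimately show ?thesis unfolding C1_linked_def by blast
qed

text \<open>The coordinate segment from \<open>x\<close> to \<open>y\<close> is traversed with
  \<open>step\<close>. In another chart \<open>d\<close> it becomes
  \<open>transition c d \<circ> \<sigma>\<close>, whose derivative is continuous because transitions
  are smooth.\<close>

lemma C1_linked_in_chart:
  assumes c: "c \<in> A" and B: "convex B" "B \<subseteq> cmap c ` cdom c" and xy: "x \<in> B" "y \<in> B"
  shows "C1_linked (cinv c x) (cinv c y)"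
proof -
  obtain step' where st: "\<And>t. (step has_vector_derivative step' t) (at t)" "continuous_on UNIV step'"
    using step_C1 by blast
  define \<sigma> where "\<sigma> t = x + step t *\<^sub>R (y - x)" for t
  have \<sigma>_in: "\<sigma> t \<in> B" for t
    using convexD_alt[OF B(1) xy step_range[of t]] by (simp add: \<sigma>_def algebra_simps)
  have \<sigma>': "(\<sigma> has_vector_derivative step' t *\<^sub>R (y - x)) (at t)" for t
    unfolding \<sigma>_def
    using has_vector_derivative_add[OF has_vector_derivative_const[of x]
        bounded_linear.has_vector_derivative[OF bounded_linear_scaleR_left st(1)]] by simp
  have cont_\<sigma>: "continuous_on S \<sigma>" for S
    using \<sigma>' by (auto intro!: continuous_at_imp_continuous_on has_vector_derivative_continuous)
  have cont: "continuous_on UNIV (cinv c \<circ> \<sigma>)"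
    by (rule continuous_on_compose[OF cont_\<sigma> continuous_on_subset[OF continuous_on_cinv[OF c]]])
      (use \<sigma>_in B(2) in auto)
  have "C1_near (cinv c \<circ> \<sigma>) t" for t
    unfolding C1_near_def
  proof (intro ballI impI)
    fix d assume d: "d \<in> A" "(cinv c \<circ> \<sigma>) t \<in> cdom d"
    let ?X = "cmap c ` (cdom c \<inter> cdom d)"
    let ?S = "(cinv c \<circ> \<sigma>) -` cdom d"
    have S: "open ?S" "t \<in> ?S" using open_vimage[OF open_cdom[OF d(1)] cont] d(2) by auto
    have in_X: "\<sigma> s \<in> ?X" if "s \<in> ?S" for s
    proof -
      have "\<sigma> s \<in> cmap c ` cdom c" using \<sigma>_in B(2) by blast
      then show ?thesis
        using that cmap_cinv[OF c] cinv_in_cdom[OF c] by (metis IntI comp_apply image_eqI vimageD)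
    qed
    let ?D = "\<lambda>s. step' s *\<^sub>R dtransition c d (\<sigma> s) (y - x)"
    have "continuous_on ?X (\<lambda>z. dtransition c d z (y - x))"
      by (intro smooth_on_continuous smooth_on_frechet_derivative smooth_on_transition c d)
    then have "continuous_on ?S (\<lambda>s. dtransition c d (\<sigma> s) (y - x))"
      by (rule continuous_on_compose2[OF _ cont_\<sigma>]) (use in_X in auto)
    then have "continuous_on ?S ?D"
      by (intro continuous_on_scaleR continuous_on_subset[OF st(2)]) auto
    moreover have "((cmap d \<circ> (cinv c \<circ> \<sigma>)) has_vector_derivative ?D s) (at s)" if "s \<in> ?S" for s
    proof -
      note der = transition_has_derivative[OF c d(1) in_X[OF that]]
      have "(dtransition c d (\<sigma> s) \<circ> (\<lambda>h. h *\<^sub>R step' s *\<^sub>R (y - x))) = (\<lambda>h. h *\<^sub>R ?D s)"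
        by (simp only: fun_eq_iff comp_apply linear_cmul[OF has_derivative_linear[OF der]] simp_thms)
      moreover have "cmap d \<circ> (cinv c \<circ> \<sigma>) = transition c d \<circ> \<sigma>"
        by (simp add: transition_def comp_assoc)
      ultimately show ?thesis
        using diff_chain_at[OF \<sigma>'[unfolded has_vector_derivative_def] der]
        by (simp only: has_vector_derivative_def)
    qed
    ultimately show "\<exists>S D. open S \<and> t \<in> S \<and> continuous_on S D \<and>
      (\<forall>s\<in>S. ((cmap d \<circ> (cinv c \<circ> \<sigma>)) has_vector_derivative D s) (at s))"
      using S by (intro exI[of _ ?S] exI[of _ ?D]) auto
  qed
  moreover have "\<sigma> t = x" if "t \<le> 1/3" for t using step_eq_0[OF that] by (simp add: \<sigma>_def)
  moreover have "\<sigma> t = y" if "t \<ge> 2/3" for t using step_eq_1[OF that] by (simp add: \<sigma>_def)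
  ultimately show ?thesis
    unfolding C1_linked_def using cont by (intro exI[of _ "cinv c \<circ> \<sigma>"]) auto
qed

text \<open>Linking is transitive and holds within coordinate balls, so connectedness of the
  manifold extends it to all pairs.\<close>

lemma C1_linked: "C1_linked p q"
proof -
  have "\<exists>U. open U \<and> p \<in> U \<and> (\<forall>q\<in>U. \<forall>r\<in>U. C1_linked q r)" for p
  proof -
    obtain c where c: "c \<in> A" "p \<in> cdom c" using chart_around .
    obtain r where r: "r > 0" "ball (cmap c p) r \<subseteq> cmap c ` cdom c"
      using chart_ball[OF c open_UNIV] by auto
    let ?U = "cinv c ` ball (cmap c p) r"
    have "open ?U" using r(2) by (intro open_cinv_image c) auto
    moreover have "p \<in> ?U" using r(1) cinv_cmap[OF c] by (metis centre_in_ball image_eqI)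
    ultimately show ?thesis using C1_linked_in_chart[OF c(1) convex_ball r(2)] by blast
  qed
  then obtain U where U: "\<And>p. open (U p)" "\<And>p. p \<in> U p" "\<And>p q r. q \<in> U p \<Longrightarrow> r \<in> U p \<Longrightarrow> C1_linked q r"
    by metis
  \<comment> \<open>The symmetrised relation is an equivalence without any reversal of
    curves.\<close>
  have "C1_linked p q \<and> C1_linked q p"
  proof (rule connected_equivalence_relation[OF connected_M UNIV_I UNIV_I,
        where R = "\<lambda>p q. C1_linked p q \<and> C1_linked q p"])
    show "\<exists>T. openin (top_of_set UNIV) T \<and> a \<in> T \<and> (\<forall>x\<in>T. C1_linked a x \<and> C1_linked x a)" for a
      using U(1,2) U(3)[of a a] U(3)[of _ a a] by (intro exI[of _ "U a"]) auto
  qed (use C1_linked_trans in blast)+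
  then show ?thesis by blast
qed

text \<open>Without at least one such curve the definite description in \<open>displacement\<close>
  would be unspecified.\<close>

lemma C1_curve_exists:
  obtains \<gamma> where "C1_curve A \<gamma>" "\<gamma> 0 = p" "\<gamma> 1 = q"
proof -
  obtain \<gamma> where "continuous_on UNIV \<gamma>" "\<And>t. C1_near \<gamma> t" "\<And>t. t \<le> 1/3 \<Longrightarrow> \<gamma> t = p" "\<And>t. t \<ge> 2/3 \<Longrightarrow> \<gamma> t = q"
    using C1_linked[of p q] unfolding C1_linked_def by blast
  then show thesis using that[of \<gamma>] by (auto intro!: C1_curveI intro: continuous_on_subset)
qed

lemma C1_curve_path: "C1_curve A \<gamma> \<Longrightarrow> path \<gamma>"
  by (simp add: C1_curve_def path_def)

section \<open>The displacement function\<close>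

text \<open>Path independence over all continuous paths identifies the value on
  \<open>\<gamma>\<close> with that on any \<open>C^1\<close> curve, and one such curve exists. From
  here on the displacement is computed on the most convenient path.\<close>

lemma displacement_eq:
  assumes h: "displacement_welldefined \<alpha> h" and \<gamma>: "path \<gamma>" "pathstart \<gamma> = x" "pathfinish \<gamma> = y"
  shows "displacement A \<alpha> h x y = line_integral A \<alpha> (h \<circ> \<gamma>) - line_integral A \<alpha> \<gamma>"
  unfolding displacement_def
proof (rule the_equality)
  obtain \<eta> where \<eta>: "C1_curve A \<eta>" "\<eta> 0 = x" "\<eta> 1 = y" using C1_curve_exists .
  have *: "line_integral A \<alpha> (h \<circ> \<gamma>) - line_integral A \<alpha> \<gamma> = line_integral A \<alpha> (h \<circ> \<eta>) - line_integral A \<alpha> \<eta>"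
    if "C1_curve A \<eta>" "\<eta> 0 = x" "\<eta> 1 = y" for \<eta>
    using h \<gamma> C1_curve_path[OF that(1)] that(2,3)
    unfolding displacement_welldefined_def by (simp add: pathstart_def pathfinish_def)
  then show "\<exists>\<eta>. C1_curve A \<eta> \<and> \<eta> 0 = x \<and> \<eta> 1 = y \<and>
      line_integral A \<alpha> (h \<circ> \<gamma>) - line_integral A \<alpha> \<gamma> = line_integral A \<alpha> (h \<circ> \<eta>) - line_integral A \<alpha> \<eta>"
    using \<eta> by blast
  show "r = line_integral A \<alpha> (h \<circ> \<gamma>) - line_integral A \<alpha> \<gamma>"
    if "\<exists>\<eta>. C1_curve A \<eta> \<and> \<eta> 0 = x \<and> \<eta> 1 = y \<and> r = line_integral A \<alpha> (h \<circ> \<eta>) - line_integral A \<alpha> \<eta>" for r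
    using that * by metis
qed

lemma path_exists:
  obtains \<gamma> :: "real \<Rightarrow> 'm" where "path \<gamma>" "pathstart \<gamma> = p" "pathfinish \<gamma> = q"
  using C1_curve_exists C1_curve_path by (metis pathfinish_def pathstart_def)

lemma path_map:
  assumes "displacement_welldefined \<alpha> h" "path \<gamma>"
  shows "path (h \<circ> \<gamma>)"
  using assms by (auto simp: displacement_welldefined_def intro: path_continuous_image continuous_on_subset)

text \<open>The integrals along \<open>\<gamma>\<close>, \<open>k \<circ> \<gamma>\<close> and
  \<open>h \<circ> (k \<circ> \<gamma>)\<close> telescope.\<close>

lemma displacement_welldefined_comp:
  assumes h: "displacement_welldefined \<alpha> h" and k: "displacement_welldefined \<alpha> k"
  shows "displacement_welldefined \<alpha> (h \<circ> k)"
  unfolding displacement_welldefined_def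
proof (intro conjI allI impI)
  show "continuous_on UNIV (h \<circ> k)"
    using h k unfolding displacement_welldefined_def
    by (intro continuous_on_compose) (auto intro: continuous_on_subset)
  fix \<gamma> \<eta> :: "real \<Rightarrow> 'm"
  assume *: "path \<gamma> \<and> path \<eta> \<and> pathstart \<gamma> = pathstart \<eta> \<and> pathfinish \<gamma> = pathfinish \<eta>"
  then have 1: "line_integral A \<alpha> (k \<circ> \<gamma>) - line_integral A \<alpha> \<gamma> = line_integral A \<alpha> (k \<circ> \<eta>) - line_integral A \<alpha> \<eta>"
    using k unfolding displacement_welldefined_def by blast
  have "path (k \<circ> \<gamma>) \<and> path (k \<circ> \<eta>) \<and> pathstart (k \<circ> \<gamma>) = pathstart (k \<circ> \<eta>) \<and> pathfinish (k \<circ> \<gamma>) = pathfinish (k \<circ> \<eta>)"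
    using * path_map[OF k] by (simp add: pathstart_compose pathfinish_compose)
  then have "line_integral A \<alpha> (h \<circ> (k \<circ> \<gamma>)) - line_integral A \<alpha> (k \<circ> \<gamma>)
      = line_integral A \<alpha> (h \<circ> (k \<circ> \<eta>)) - line_integral A \<alpha> (k \<circ> \<eta>)"
    using h unfolding displacement_welldefined_def by blast
  with 1 show "line_integral A \<alpha> (h \<circ> k \<circ> \<gamma>) - line_integral A \<alpha> \<gamma>
      = line_integral A \<alpha> (h \<circ> k \<circ> \<eta>) - line_integral A \<alpha> \<eta>"
    by (simp add: comp_assoc)
qed

lemma displacement_comp:
  assumes h: "displacement_welldefined \<alpha> h" and k: "displacement_welldefined \<alpha> k"
  shows "displacement A \<alpha> (h \<circ> k) x y = displacement A \<alpha> h (k x) (k y) + displacement A \<alpha> k x y"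
proof -
  obtain \<gamma> where \<gamma>: "path \<gamma>" "pathstart \<gamma> = x" "pathfinish \<gamma> = y" using path_exists .
  have k\<gamma>: "path (k \<circ> \<gamma>)" "pathstart (k \<circ> \<gamma>) = k x" "pathfinish (k \<circ> \<gamma>) = k y"
    using path_map[OF k \<gamma>(1)] \<gamma>(2,3) by (auto simp: pathstart_compose pathfinish_compose)
  show ?thesis
    unfolding displacement_eq[OF displacement_welldefined_comp[OF h k] \<gamma>]
      displacement_eq[OF k \<gamma>] displacement_eq[OF h k\<gamma>] by (simp add: comp_assoc)
qed

text \<open>Path independence of \<open>h\<close> on the curves
  \<open>inv h \<circ> \<gamma>\<close> is, up to sign, path independence of \<open>inv h\<close> on
  the curves \<open>\<gamma>\<close>.\<close>

lemma displacement_welldefined_inv: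
  assumes h: "displacement_welldefined \<alpha> h" and inv: "homeomorphism UNIV UNIV h (inv h)"
  shows "displacement_welldefined \<alpha> (inv h)"
  unfolding displacement_welldefined_def
proof (intro conjI allI impI)
  show cont: "continuous_on UNIV (inv h)" using inv by (simp add: homeomorphism_def)
  fix \<gamma> \<eta> :: "real \<Rightarrow> 'm"
  assume *: "path \<gamma> \<and> path \<eta> \<and> pathstart \<gamma> = pathstart \<eta> \<and> pathfinish \<gamma> = pathfinish \<eta>"
  then have "path (inv h \<circ> \<gamma>) \<and> path (inv h \<circ> \<eta>) \<and> pathstart (inv h \<circ> \<gamma>) = pathstart (inv h \<circ> \<eta>) \<and>
      pathfinish (inv h \<circ> \<gamma>) = pathfinish (inv h \<circ> \<eta>)"
    using cont by (auto simp: pathstart_compose pathfinish_compose intro: path_continuous_image continuous_on_subset)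
  then have "line_integral A \<alpha> (h \<circ> (inv h \<circ> \<gamma>)) - line_integral A \<alpha> (inv h \<circ> \<gamma>)
      = line_integral A \<alpha> (h \<circ> (inv h \<circ> \<eta>)) - line_integral A \<alpha> (inv h \<circ> \<eta>)"
    using h unfolding displacement_welldefined_def by blast
  moreover have "h \<circ> (inv h \<circ> \<sigma>) = \<sigma>" for \<sigma> :: "real \<Rightarrow> 'm"
    using inv by (auto simp: homeomorphism_def)
  ultimately show "line_integral A \<alpha> (inv h \<circ> \<gamma>) - line_integral A \<alpha> \<gamma>
      = line_integral A \<alpha> (inv h \<circ> \<eta>) - line_integral A \<alpha> \<eta>" by simp
qed

lemma displacement_inv:
  assumes h: "displacement_welldefined \<alpha> h" and inv: "homeomorphism UNIV UNIV h (inv h)"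
  shows "displacement A \<alpha> (inv h) x y = - displacement A \<alpha> h (inv h x) (inv h y)"
proof -
  obtain \<gamma> where \<gamma>: "path \<gamma>" "pathstart \<gamma> = x" "pathfinish \<gamma> = y" using path_exists .
  note h' = displacement_welldefined_inv[OF assms]
  have h\<gamma>: "path (inv h \<circ> \<gamma>)" "pathstart (inv h \<circ> \<gamma>) = inv h x" "pathfinish (inv h \<circ> \<gamma>) = inv h y"
    using path_map[OF h' \<gamma>(1)] \<gamma>(2,3) by (auto simp: pathstart_compose pathfinish_compose)
  have "h \<circ> (inv h \<circ> \<gamma>) = \<gamma>"
    using inv by (auto simp: homeomorphism_def)
  then show ?thesis
    unfolding displacement_eq[OF h' \<gamma>] displacement_eq[OF h h\<gamma>] by simp
qed

lemma displacement_add: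
  assumes \<alpha>: "closed_one_form A \<alpha>" and h: "displacement_welldefined \<alpha> h"
  shows "displacement A \<alpha> h x z = displacement A \<alpha> h x y + displacement A \<alpha> h y z"
proof -
  obtain \<gamma> where \<gamma>: "path \<gamma>" "pathstart \<gamma> = x" "pathfinish \<gamma> = y" using path_exists .
  obtain \<eta> where \<eta>: "path \<eta>" "pathstart \<eta> = y" "pathfinish \<eta> = z" using path_exists .
  have \<gamma>\<eta>: "path (\<gamma> +++ \<eta>)" "pathstart (\<gamma> +++ \<eta>) = x" "pathfinish (\<gamma> +++ \<eta>) = z" using \<gamma> \<eta> by auto
  show ?thesis
    unfolding displacement_eq[OF h \<gamma>] displacement_eq[OF h \<eta>] displacement_eq[OF h \<gamma>\<eta>] path_compose_join
    using \<gamma> \<eta> path_map[OF h]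
    by (simp add: line_integral_join[OF \<alpha>] pathstart_compose pathfinish_compose)
qed

lemma displacement_exact:
  assumes f: "local_primitive A \<alpha> UNIV f" and h: "displacement_welldefined \<alpha> h"
  shows "displacement A \<alpha> h x y = (f (h y) - f y) - (f (h x) - f x)"
proof -
  obtain \<gamma> where \<gamma>: "path \<gamma>" "pathstart \<gamma> = x" "pathfinish \<gamma> = y" using path_exists .
  show ?thesis
    unfolding displacement_eq[OF h \<gamma>] line_integral_global_primitive[OF f \<gamma>(1)]
      line_integral_global_primitive[OF f path_map[OF h \<gamma>(1)]]
    using \<gamma>(2,3) by (simp add: pathstart_def pathfinish_def)
qed

text \<open>Near \<open>y\<close> the increment from \<open>y\<close> to \<open>z\<close> is taken
  along a short coordinate segment, where local primitives around \<open>y\<close> and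
  \<open>h y\<close> give it explicitly. Continuity supplies the measurability and integrability
  behind the means.\<close>

lemma displacement_continuous:
  assumes \<alpha>: "closed_one_form A \<alpha>" and h: "displacement_welldefined \<alpha> h"
  shows "continuous_on UNIV (displacement A \<alpha> h x)"
proof -
  have "continuous (at y) (displacement A \<alpha> h x)" for y
  proof -
    obtain V f where f: "y \<in> V" "local_primitive A \<alpha> V f" using local_primitive_exists[OF \<alpha>] .
    obtain W g where g: "h y \<in> W" "local_primitive A \<alpha> W g" using local_primitive_exists[OF \<alpha>] .
    have ch: "continuous_on UNIV h" using h by (simp add: displacement_welldefined_def)
    have open_VW: "open V" "open W" using f g by (auto simp: local_primitive_def)
    have op: "open (V \<inter> h -` W)" using open_VW open_vimage[OF _ ch] by blast
    obtain c where c: "c \<in> A" "y \<in> cdom c" using chart_around .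
    obtain r where r: "r > 0" "ball (cmap c y) r \<subseteq> cmap c ` (cdom c \<inter> (V \<inter> h -` W))"
      using chart_ball[OF c op] f(1) g(1) by auto
    let ?B = "ball (cmap c y) r" and ?U = "cinv c ` ball (cmap c y) r"
    have U: "open ?U" "?U \<subseteq> V \<inter> h -` W" "y \<in> ?U"
    proof -
      show "open ?U" using r(2) by (intro open_cinv_image c) auto
      show "?U \<subseteq> V \<inter> h -` W" using r(2) cinv_cmap[OF c(1)] by force
      show "y \<in> ?U" using r(1) cinv_cmap[OF c] by (metis centre_in_ball image_eqI)
    qed
    have eq: "displacement A \<alpha> h x y + ((g (h z) - g (h y)) - (f z - f y)) = displacement A \<alpha> h x z"
      if z: "z \<in> ?U" for z
    proof -
      obtain w where w: "w \<in> ?B" "z = cinv c w" using z by blast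
      let ?\<gamma> = "cinv c \<circ> linepath (cmap c y) w"
      have seg: "closed_segment (cmap c y) w \<subseteq> ?B"
        using w(1) r(1) by (intro closed_segment_subset convex_ball) auto
      have "path ?\<gamma>"
        using seg r(2) by (intro path_continuous_image continuous_on_subset[OF continuous_on_cinv[OF c(1)]]) auto
      moreover have "pathstart ?\<gamma> = y" "pathfinish ?\<gamma> = z"
        using cinv_cmap[OF c] w(2) by (auto simp: pathstart_compose pathfinish_compose)
      moreover have "path_image ?\<gamma> \<subseteq> ?U" using seg by (auto simp: path_image_compose)
      ultimately have \<gamma>: "path ?\<gamma>" "pathstart ?\<gamma> = y" "pathfinish ?\<gamma> = z" "path_image ?\<gamma> \<subseteq> V"
        "path_image (h \<circ> ?\<gamma>) \<subseteq> W"
        using U(2) by (auto simp: path_image_compose)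
      have "displacement A \<alpha> h y z = (g (h z) - g (h y)) - (f z - f y)"
        unfolding displacement_eq[OF h \<gamma>(1-3)] line_integral_local[OF f(2) \<gamma>(1,4)]
          line_integral_local[OF g(2) path_map[OF h \<gamma>(1)] \<gamma>(5)]
        using \<gamma>(2,3) by (simp add: pathstart_compose pathfinish_compose)
      then show ?thesis using displacement_add[OF \<alpha> h, of x z y] by simp
    qed
    have "continuous_on ?U (\<lambda>z. displacement A \<alpha> h x y + ((g (h z) - g (h y)) - (f z - f y)))"
      using U(2) by (intro continuous_intros continuous_on_compose2[OF local_primitive_continuous[OF g(2)]]
          continuous_on_subset[OF local_primitive_continuous[OF f(2)]] continuous_on_subset[OF ch]) auto
    then have "continuous_on ?U (displacement A \<alpha> h x)"
      by (rule continuous_on_eq) (rule eq)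
    then show ?thesis using U(1,3) continuous_on_eq_continuous_at by blast
  qed
  then show ?thesis by (simp add: continuous_at_imp_continuous_on)
qed

end

section \<open>The measure associated with a density\<close>

type_synonym ('m, 'n) density = "('m, 'n) chart \<Rightarrow> real^'n \<Rightarrow> real"

text \<open>The change of variables theorem for absolutely integrable vector-valued functions, read
  off on \<open>real^1\<close>. For nonnegative integrands absolute integrability is plain
  integrability, so existence of the integral is transferred as well.\<close>

lemma has_integral_change_of_variables_nonneg:
  fixes f :: "real^'n::{finite,wellorder} \<Rightarrow> real" and g :: "real^'n::_ \<Rightarrow> real^'n::_"
  assumes S: "S \<in> sets lebesgue"
    and der: "\<And>x. x \<in> S \<Longrightarrow> (g has_derivative g' x) (at x within S)"
    and inj: "inj_on g S" and nonneg: "\<And>y. y \<in> g ` S \<Longrightarrow> 0 \<le> f y"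
  shows "((\<lambda>x. \<bar>det (matrix (g' x))\<bar> * f (g x)) has_integral m) S \<longleftrightarrow> (f has_integral m) (g ` S)"
proof -
  have vec: "\<bar>det (matrix (g' x))\<bar> *\<^sub>R (vec (f (g x)) :: real^1) = vec (\<bar>det (matrix (g' x))\<bar> * f (g x))" for x
    by (simp add: vec_eq_iff)
  have 1: "(\<lambda>x. \<bar>det (matrix (g' x))\<bar> * f (g x)) absolutely_integrable_on S \<longleftrightarrow>
      (\<lambda>x. \<bar>det (matrix (g' x))\<bar> * f (g x)) integrable_on S"
    using nonneg by (intro absolutely_integrable_on_iff_nonneg) auto
  have 2: "f absolutely_integrable_on (g ` S) \<longleftrightarrow> f integrable_on (g ` S)"
    using nonneg by (intro absolutely_integrable_on_iff_nonneg) auto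
  have "(\<lambda>x. \<bar>det (matrix (g' x))\<bar> *\<^sub>R (vec (f (g x)) :: real^1)) absolutely_integrable_on S \<and>
      integral S (\<lambda>x. \<bar>det (matrix (g' x))\<bar> *\<^sub>R (vec (f (g x)) :: real^1)) = vec m
    \<longleftrightarrow> (\<lambda>y. vec (f y) :: real^1) absolutely_integrable_on (g ` S) \<and>
      integral (g ` S) (\<lambda>y. vec (f y) :: real^1) = vec m"
    by (rule has_absolute_integral_change_of_variables[OF S der inj])
  then show ?thesis
    unfolding vec absolutely_integrable_on_1_iff integral_on_1_eq
    by (simp add: 1 2 has_integral_iff)
qed

text \<open>Bridge between the extended nonnegative integral, in which the volume measure is
  defined, and the gauge integral, in which the variables are changed.\<close>

lemma nn_set_integral_eq_iff_has_integral:
  fixes f :: "'a::euclidean_space \<Rightarrow> real"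
  assumes meas: "(\<lambda>x. indicator S x * f x) \<in> borel_measurable borel"
    and nonneg: "\<And>x. x \<in> S \<Longrightarrow> 0 \<le> f x" and "0 \<le> r"
  shows "(\<integral>\<^sup>+x\<in>S. ennreal (f x) \<partial>lborel) = ennreal r \<longleftrightarrow> (f has_integral r) S"
proof
  assume eq: "(\<integral>\<^sup>+x\<in>S. ennreal (f x) \<partial>lborel) = ennreal r"
  have "(\<integral>\<^sup>+x. ennreal (indicator S x * f x) \<partial>lborel) = ennreal r"
    unfolding eq[symmetric] by (intro nn_integral_cong) (auto simp: indicator_def)
  from nn_integral_has_integral[OF meas _ this] nonneg \<open>0 \<le> r\<close>
  have "((\<lambda>x. indicator S x * f x) has_integral r) UNIV" by (auto simp: indicator_def)
  moreover have "(\<lambda>x. indicator S x * f x) = (\<lambda>x. if x \<in> S then f x else 0)" by auto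
  ultimately show "(f has_integral r) S" by (simp add: has_integral_restrict_UNIV)
next
  assume "(f has_integral r) S"
  from nn_integral_has_integral_lebesgue'[OF nonneg this]
  show "(\<integral>\<^sup>+x\<in>S. ennreal (f x) \<partial>lborel) = ennreal r" by simp
qed

text \<open>Equality is tested on finite values: each side equals \<open>ennreal r\<close> iff the
  other does, so if one side is infinite, both are.\<close>

lemma nn_set_integral_change_of_variables:
  fixes a b :: "real^'n::{finite,wellorder} \<Rightarrow> real" and g :: "real^'n::_ \<Rightarrow> real^'n::_"
  assumes S: "S \<in> sets lebesgue"
    and der: "\<And>x. x \<in> S \<Longrightarrow> (g has_derivative g' x) (at x within S)"
    and inj: "inj_on g S" and nonneg: "\<And>y. y \<in> g ` S \<Longrightarrow> 0 \<le> b y"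
    and ab: "\<And>x. x \<in> S \<Longrightarrow> a x = \<bar>det (matrix (g' x))\<bar> * b (g x)"
    and meas: "(\<lambda>x. indicator S x * a x) \<in> borel_measurable borel"
      "(\<lambda>y. indicator (g ` S) y * b y) \<in> borel_measurable borel"
  shows "(\<integral>\<^sup>+x\<in>S. ennreal (a x) \<partial>lborel) = (\<integral>\<^sup>+y\<in>g ` S. ennreal (b y) \<partial>lborel)" (is "?a = ?b")
proof -
  have a: "0 \<le> a x" if "x \<in> S" for x using that nonneg by (simp add: ab)
  have "((\<lambda>x. \<bar>det (matrix (g' x))\<bar> * b (g x)) has_integral r) S \<longleftrightarrow> (a has_integral r) S" for r
    using ab by (intro has_integral_cong) simp
  then have iff: "?a = ennreal r \<longleftrightarrow> ?b = ennreal r" if "0 \<le> r" for r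
    using has_integral_change_of_variables_nonneg[where f = b and m = r, OF S der inj nonneg]
      nn_set_integral_eq_iff_has_integral[OF meas(1) a that]
      nn_set_integral_eq_iff_has_integral[OF meas(2) nonneg that] by simp
  consider r where "0 \<le> r" "?a = ennreal r" | r where "0 \<le> r" "?b = ennreal r" | "?a = top" "?b = top"
    by (cases ?a; cases ?b) auto
  then show ?thesis by cases (use iff in simp_all)
qed

section \<open>Gluing chart densities to a Borel measure\<close>

context manifold begin

lemma cinv_measurable:
  assumes "c \<in> A"
  shows "cinv c \<in> borel_measurable (restrict_space borel (cmap c ` cdom c))"
  by (rule borel_measurable_continuous_on_restrict[OF continuous_on_cinv[OF assms]])

lemma cmap_image_borel:
  assumes c: "c \<in> A" and B: "B \<in> sets borel" "B \<subseteq> cdom c"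
  shows "cmap c ` B \<in> sets borel"
proof -
  have "cinv c -` B \<inter> space (restrict_space borel (cmap c ` cdom c)) \<in> sets (restrict_space borel (cmap c ` cdom c))"
    by (rule measurable_sets[OF cinv_measurable[OF c] B(1)])
  moreover have "cinv c -` B \<inter> space (restrict_space borel (cmap c ` cdom c)) = cmap c ` B"
    using B(2) cinv_cmap[OF c] by (auto simp: space_restrict_space)
  ultimately show ?thesis
    using open_image_cdom[OF c] by (simp add: sets_restrict_space_iff)
qed

text \<open>Common abstraction of \<open>\<Omega>\<close> and of the Riemannian volume, each taken
  on the coordinate frame. The determinant stands without absolute value since transitions preserve
  orientation.\<close>

definition chart_density :: "('m, 'n) density \<Rightarrow> bool" where
  "chart_density \<rho> \<longleftrightarrow>
     (\<forall>c\<in>A. continuous_on (cmap c ` cdom c) (\<rho> c) \<and> (\<forall>x \<in> cmap c ` cdom c. \<rho> c x > 0)) \<and>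
     (\<forall>c\<in>A. \<forall>d\<in>A. \<forall>x \<in> cmap c ` (cdom c \<inter> cdom d).
        \<rho> c x = det (matrix (dtransition c d x)) * \<rho> d (transition c d x))"

lemma chart_density_continuous:
    "\<lbrakk>chart_density \<rho>; c \<in> A\<rbrakk> \<Longrightarrow> continuous_on (cmap c ` cdom c) (\<rho> c)"
  and chart_density_pos: "\<lbrakk>chart_density \<rho>; c \<in> A; x \<in> cmap c ` cdom c\<rbrakk> \<Longrightarrow> \<rho> c x > 0"
  and chart_density_transition:
    "\<lbrakk>chart_density \<rho>; c \<in> A; d \<in> A; x \<in> cmap c ` (cdom c \<inter> cdom d)\<rbrakk>
      \<Longrightarrow> \<rho> c x = det (matrix (dtransition c d x)) * \<rho> d (transition c d x)"
  unfolding chart_density_def by blast+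

lemma chart_density_measurable:
  assumes \<rho>: "chart_density \<rho>" and c: "c \<in> A" and S: "S \<in> sets borel" "S \<subseteq> cmap c ` cdom c"
  shows "(\<lambda>x. indicator S x * \<rho> c x) \<in> borel_measurable borel"
proof -
  have "(\<lambda>x. indicator (cmap c ` cdom c) x *\<^sub>R \<rho> c x) \<in> borel_measurable borel"
    using chart_density_continuous[OF \<rho> c] open_image_cdom[OF c]
    by (intro borel_measurable_continuous_on_indicator) auto
  then have "(\<lambda>x. indicator S x * (indicator (cmap c ` cdom c) x *\<^sub>R \<rho> c x)) \<in> borel_measurable borel"
    using S(1) by measurable
  moreover have "(\<lambda>x. indicator S x * (indicator (cmap c ` cdom c) x *\<^sub>R \<rho> c x)) = (\<lambda>x. indicator S x * \<rho> c x)"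
    using S(2) by (intro ext) (auto simp: indicator_def)
  ultimately show ?thesis by simp
qed

text \<open>Change of variables under \<open>transition c d\<close>; this makes the measures built
  in two charts agree on the overlap.\<close>

lemma chart_density_integral:
  assumes \<rho>: "chart_density \<rho>" and cd: "c \<in> A" "d \<in> A"
    and B: "B \<in> sets borel" "B \<subseteq> cdom c" "B \<subseteq> cdom d"
  shows "(\<integral>\<^sup>+x\<in>cmap c ` B. ennreal (\<rho> c x) \<partial>lborel) = (\<integral>\<^sup>+x\<in>cmap d ` B. ennreal (\<rho> d x) \<partial>lborel)"
proof -
  let ?S = "cmap c ` B"
  have S: "?S \<subseteq> cmap c ` (cdom c \<inter> cdom d)" using B by auto
  have im: "transition c d ` ?S = cmap d ` B"
    unfolding image_image by (rule image_cong[OF refl transition_cmap[OF cd(1) subsetD[OF B(2)]]])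
  have pos: "0 \<le> \<rho> d y" if "y \<in> cmap d ` B" for y
    by (rule less_imp_le[OF chart_density_pos[OF \<rho> cd(2) subsetD[OF image_mono[OF B(3)] that]]])
  have "(\<integral>\<^sup>+x\<in>?S. ennreal (\<rho> c x) \<partial>lborel) = (\<integral>\<^sup>+x\<in>transition c d ` ?S. ennreal (\<rho> d x) \<partial>lborel)"
  proof (rule nn_set_integral_change_of_variables[where g' = "dtransition c d"])
    show "?S \<in> sets lebesgue" using cmap_image_borel[OF cd(1) B(1,2)] by simp
    show "(transition c d has_derivative dtransition c d x) (at x within ?S)" if "x \<in> ?S" for x
      using transition_has_derivative[OF cd] S that by (blast intro: has_derivative_at_withinI)
    show "inj_on (transition c d) ?S"
    proof (rule inj_on_inverseI[where g = "transition d c"])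
      fix x assume "x \<in> ?S"
      then show "transition d c (transition c d x) = x"
        using B(2,3) by (auto simp: transition_cmap[OF cd(1)] transition_cmap[OF cd(2)] subset_iff)
    qed
    show "\<rho> c x = \<bar>det (matrix (dtransition c d x))\<bar> * \<rho> d (transition c d x)" if "x \<in> ?S" for x
    proof -
      have x: "x \<in> cmap c ` (cdom c \<inter> cdom d)" using S that by blast
      have "\<rho> c x = det (matrix (dtransition c d x)) * \<rho> d (transition c d x)"
        by (rule chart_density_transition[OF \<rho> cd x])
      then show ?thesis using det_dtransition[OF cd x] by simp
    qed
    show "(\<lambda>x. indicator ?S x * \<rho> c x) \<in> borel_measurable borel"
      by (intro chart_density_measurable[OF \<rho>] cmap_image_borel cd B image_mono)
    show "(\<lambda>y. indicator (transition c d ` ?S) y * \<rho> d y) \<in> borel_measurable borel"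
      unfolding im by (intro chart_density_measurable[OF \<rho>] cmap_image_borel cd B image_mono)
  qed (use pos im in auto)
  then show ?thesis by (simp only: im)
qed

text \<open>Lebesgue measure on the coordinate image, weighted by \<open>\<rho> c\<close> and pushed
  to the manifold by \<open>cinv c\<close>.\<close>

lemma chart_measure_exists:
  assumes \<rho>: "chart_density \<rho>" and c: "c \<in> A"
  obtains N :: "'m measure" where "sets N = sets borel"
    "\<And>B. \<lbrakk>B \<in> sets borel; B \<subseteq> cdom c\<rbrakk> \<Longrightarrow> emeasure N B = (\<integral>\<^sup>+x\<in>cmap c ` B. ennreal (\<rho> c x) \<partial>lborel)"
proof
  let ?I = "cmap c ` cdom c"
  have I: "?I \<in> sets borel" using open_image_cdom[OF c] by simp
  let ?D = "density (restrict_space lborel ?I) (\<lambda>x. ennreal (\<rho> c x))"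
  have cont: "continuous_on ?I (\<rho> c)" using \<rho> c by (simp add: chart_density_def)
  have sets_restrict: "sets (restrict_space lborel ?I) = sets (restrict_space borel ?I)"
    by (intro sets_restrict_space_cong) simp
  have \<rho>_meas: "(\<lambda>x. ennreal (\<rho> c x)) \<in> borel_measurable (restrict_space lborel ?I)"
    using borel_measurable_continuous_on_restrict[OF cont]
    by (subst measurable_cong_sets[OF sets_restrict refl]) simp
  have cinv_meas: "cinv c \<in> measurable ?D borel"
    using cinv_measurable[OF c] by (subst measurable_cong_sets[OF _ refl, of _ "restrict_space borel ?I"])
      (simp_all add: sets_restrict)
  show "sets (distr ?D borel (cinv c)) = sets borel" by simp
  fix B :: "'m set" assume B: "B \<in> sets borel" "B \<subseteq> cdom c"
  have pre: "cinv c -` B \<inter> ?I = cmap c ` B"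
    using B(2) cinv_cmap[OF c] by auto
  have B': "cmap c ` B \<in> sets (restrict_space lborel ?I)"
    using cmap_image_borel[OF c B] B(2) I by (auto simp: sets_restrict sets_restrict_space_iff image_mono)
  have "emeasure (distr ?D borel (cinv c)) B = emeasure ?D (cmap c ` B)"
    using emeasure_distr[OF cinv_meas B(1)] pre by (simp add: space_restrict_space)
  also have "\<dots> = (\<integral>\<^sup>+x. ennreal (\<rho> c x) * indicator (cmap c ` B) x \<partial>restrict_space lborel ?I)"
    by (rule emeasure_density[OF \<rho>_meas B'])
  also have "\<dots> = (\<integral>\<^sup>+x. (ennreal (\<rho> c x) * indicator (cmap c ` B) x) * indicator ?I x \<partial>lborel)"
    using I by (intro nn_integral_restrict_space) simp
  also have "\<dots> = (\<integral>\<^sup>+x\<in>cmap c ` B. ennreal (\<rho> c x) \<partial>lborel)"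
    using B(2) by (intro nn_integral_cong) (auto simp: indicator_def)
  finally show "emeasure (distr ?D borel (cinv c)) B = (\<integral>\<^sup>+x\<in>cmap c ` B. ennreal (\<rho> c x) \<partial>lborel)" .
qed

text \<open>Compactness leaves finitely many charts, and removing the earlier domains makes the
  pieces disjoint, at the price of being Borel instead of open.\<close>

lemma borel_chart_partition:
  obtains n :: nat and c E where "\<And>i. i < n \<Longrightarrow> c i \<in> A" "\<And>i. i < n \<Longrightarrow> E i \<subseteq> cdom (c i)"
    "\<And>i. E i \<in> sets borel" "disjoint_family E" "(\<Union>i<n. E i) = (UNIV :: 'm set)"
proof -
  have "UNIV \<subseteq> (\<Union>c\<in>A. cdom c)" using chart_around by blast
  then obtain C where C: "C \<subseteq> A" "finite C" "UNIV \<subseteq> (\<Union>c\<in>C. cdom c)"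
    using compactE_image[OF compact_M, of A cdom] open_cdom by metis
  obtain c and n :: nat where c: "C = c ` {i. i < n}"
    using C(2) by (auto simp: finite_conv_nat_seg_image)
  \<comment> \<open>Padded with empty sets, as \<open>disjointed\<close> works on sequences indexed
    by all of \<open>nat\<close>.\<close>
  define U where "U i = (if i < n then cdom (c i) else {})" for i
  have cA: "c i \<in> A" if "i < n" for i using C(1) c that by blast
  have "(\<Union>i. U i) = UNIV" using C(3) c by (auto simp: U_def)
  moreover have "open (U i)" for i using open_cdom[OF cA, of i] by (simp add: U_def)
  ultimately have U: "\<And>i. i < n \<Longrightarrow> c i \<in> A" "(\<Union>i. U i) = UNIV" "\<And>i. open (U i)"
    using cA by blast+
  have empty: "disjointed U i = {}" if "\<not> i < n" for i
    using that disjointed_subset[of U i] by (simp add: U_def)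
  show thesis
  proof
    show "\<And>i. i < n \<Longrightarrow> c i \<in> A" by (rule U)
    show "disjointed U i \<subseteq> cdom (c i)" if "i < n" for i
      using disjointed_subset[of U i] that by (simp add: U_def)
    show "disjointed U i \<in> sets borel" for i
    proof -
      have "range U \<subseteq> sets borel" using U(3) by auto
      from sets.range_disjointed_sets[OF this] show ?thesis by blast
    qed
    show "disjoint_family (disjointed U)" by (rule disjoint_family_disjointed)
    have "(\<Union>i. disjointed U i) = UNIV" using U(2) by (simp add: UN_disjointed_eq)
    then show "(\<Union>i<n. disjointed U i) = UNIV" using empty by blast
  qed
qed

text \<open>The characterisation under the definite description in \<open>volume_measure\<close>,
  for an arbitrary density.\<close>

definition is_volume_measure :: "('m, 'n) density \<Rightarrow> 'm measure \<Rightarrow> bool" where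
  "is_volume_measure \<rho> \<mu> \<longleftrightarrow> sets \<mu> = sets borel \<and>
     (\<forall>c\<in>A. \<forall>B \<in> sets borel. B \<subseteq> cdom c \<longrightarrow>
        emeasure \<mu> B = (\<integral>\<^sup>+x \<in> cmap c ` B. ennreal (\<rho> c x) \<partial>lborel))"

text \<open>Only subsets of chart domains have a prescribed measure; the finite Borel partition cuts
  any Borel set into such pieces.\<close>

lemma is_volume_measure_unique:
  assumes \<mu>: "is_volume_measure \<rho> \<mu>" and \<nu>: "is_volume_measure \<rho> \<nu>"
  shows "\<mu> = \<nu>"
proof (rule measure_eqI)
  show "sets \<mu> = sets \<nu>" using \<mu> \<nu> by (simp add: is_volume_measure_def)
  fix X assume "X \<in> sets \<mu>"
  then have X: "X \<in> sets borel" using \<mu> by (simp add: is_volume_measure_def)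
  obtain n :: nat and c E where E: "\<And>i. i < n \<Longrightarrow> c i \<in> A" "\<And>i. i < n \<Longrightarrow> E i \<subseteq> cdom (c i)"
    "\<And>i. E i \<in> sets borel" "disjoint_family E" "(\<Union>i<n. E i) = (UNIV :: 'm set)"
    using borel_chart_partition by metis
  have split: "emeasure M X = (\<Sum>i<n. emeasure M (X \<inter> E i))" if "sets M = sets borel" for M :: "'m measure"
  proof -
    have "(\<Sum>i<n. emeasure M (X \<inter> E i)) = emeasure M (\<Union>i<n. X \<inter> E i)"
      using E(3,4) X that by (intro sum_emeasure) (auto simp: disjoint_family_on_def)
    moreover have "(\<Union>i<n. X \<inter> E i) = X" using E(5) by blast
    ultimately show ?thesis by simp
  qed
  have "emeasure \<mu> (X \<inter> E i) = emeasure \<nu> (X \<inter> E i)" if "i < n" for i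
  proof -
    have "X \<inter> E i \<in> sets borel" "X \<inter> E i \<subseteq> cdom (c i)" using X E(2)[OF that] E(3) by auto
    then show ?thesis using \<mu> \<nu> E(1)[OF that] unfolding is_volume_measure_def by metis
  qed
  then show "emeasure \<mu> X = emeasure \<nu> X"
    using split[of \<mu>] split[of \<nu>] \<mu> \<nu> by (simp add: is_volume_measure_def)
qed

lemma is_volume_measure_exists:
  assumes \<rho>: "chart_density \<rho>"
  obtains \<mu> where "is_volume_measure \<rho> \<mu>"
proof -
  let ?P = "\<lambda>c (N :: 'm measure). sets N = sets borel \<and> (\<forall>B\<in>sets borel. B \<subseteq> cdom c \<longrightarrow>
      emeasure N B = (\<integral>\<^sup>+x\<in>cmap c ` B. ennreal (\<rho> c x) \<partial>lborel))"
  have "\<forall>c\<in>A. \<exists>N. ?P c N"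
  proof
    fix c assume c: "c \<in> A"
    show "\<exists>N. ?P c N" by (rule chart_measure_exists[OF \<rho> c]) blast
  qed
  from bchoice[OF this] obtain N where N': "\<forall>c\<in>A. ?P c (N c)" by blast
  then have N: "\<And>c. c \<in> A \<Longrightarrow> sets (N c) = sets (borel :: 'm measure)"
    "\<And>c B. \<lbrakk>c \<in> A; B \<in> sets borel; B \<subseteq> cdom c\<rbrakk>
      \<Longrightarrow> emeasure (N c) B = (\<integral>\<^sup>+x\<in>cmap c ` B. ennreal (\<rho> c x) \<partial>lborel)"
    by blast+
  obtain n :: nat and c E where E: "\<And>i. i < n \<Longrightarrow> c i \<in> A" "\<And>i. i < n \<Longrightarrow> E i \<subseteq> cdom (c i)"
    "\<And>i. E i \<in> sets borel" "disjoint_family E" "(\<Union>i<n. E i) = (UNIV :: 'm set)"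
    using borel_chart_partition by metis
  define m where "m X = (\<Sum>i<n. emeasure (N (c i)) (X \<inter> E i))" for X
  define \<mu> where "\<mu> = measure_of (UNIV :: 'm set) (sets borel) m"
  have sets: "sets \<mu> = sets borel"
    unfolding \<mu>_def using sets.sigma_sets_eq[of "borel :: 'm measure"] by simp
  have "countably_additive (sets \<mu>) m"
  proof (rule countably_additiveI)
    fix F :: "nat \<Rightarrow> 'm set" assume F: "range F \<subseteq> sets \<mu>" "disjoint_family F"
    have "(\<Sum>j. emeasure (N (c i)) (F j \<inter> E i)) = emeasure (N (c i)) ((\<Union>j. F j) \<inter> E i)" if "i < n" for i
    proof -
      have "(\<Sum>j. emeasure (N (c i)) (F j \<inter> E i)) = emeasure (N (c i)) (\<Union>j. F j \<inter> E i)"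
        using F E(1)[OF that] E(3) N(1) sets by (intro suminf_emeasure) (auto simp: disjoint_family_on_def)
      then show ?thesis by simp
    qed
    then show "(\<Sum>j. m (F j)) = m (\<Union>j. F j)"
      unfolding m_def by (subst suminf_sum) auto
  qed
  then have emeasure: "emeasure \<mu> X = m X" if "X \<in> sets borel" for X
    using that sets
    by (intro emeasure_measure_of[OF \<mu>_def]) (auto simp: positive_def m_def)
  have "emeasure \<mu> B = (\<integral>\<^sup>+x\<in>cmap d ` B. ennreal (\<rho> d x) \<partial>lborel)"
    if d: "d \<in> A" and B: "B \<in> sets borel" "B \<subseteq> cdom d" for d B
  proof -
    \<comment> \<open>\<open>B \<inter> E i\<close> lies in both chart domains, so the measure used
      on \<open>E i\<close> may be exchanged for that of \<open>d\<close>.\<close>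
    have "emeasure (N (c i)) (B \<inter> E i) = emeasure (N d) (B \<inter> E i)" if "i < n" for i
    proof -
      have *: "B \<inter> E i \<in> sets borel" "B \<inter> E i \<subseteq> cdom (c i)" "B \<inter> E i \<subseteq> cdom d"
        using B E(2)[OF that] E(3) by auto
      then show ?thesis
        using N(2)[OF E(1)[OF that] *(1,2)] N(2)[OF d *(1,3)]
          chart_density_integral[OF \<rho> E(1)[OF that] d *] by simp
    qed
    then have "emeasure \<mu> B = (\<Sum>i<n. emeasure (N d) (B \<inter> E i))"
      unfolding emeasure[OF B(1)] m_def by simp
    also have "\<dots> = emeasure (N d) (\<Union>i<n. B \<inter> E i)"
      using E(3,4) B N(1)[OF d] by (intro sum_emeasure) (auto simp: disjoint_family_on_def)
    also have "(\<Union>i<n. B \<inter> E i) = B" using E(5) by blast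
    finally show ?thesis using N(2)[OF d B] by simp
  qed
  with sets have "is_volume_measure \<rho> \<mu>" unfolding is_volume_measure_def by blast
  then show thesis by (rule that)
qed

lemma volume_measure:
  assumes "chart_density (\<lambda>c x. \<omega> c x (mat 1))"
  shows "is_volume_measure (\<lambda>c x. \<omega> c x (mat 1)) (volume_measure A \<omega>)"
proof -
  define \<rho> where "\<rho> = (\<lambda>c x. \<omega> c x (mat 1))"
  have \<rho>: "chart_density \<rho>" using assms by (simp add: \<rho>_def)
  obtain \<mu> where \<mu>: "is_volume_measure \<rho> \<mu>" by (rule is_volume_measure_exists[OF \<rho>])
  have "is_volume_measure \<rho> (THE \<mu>. is_volume_measure \<rho> \<mu>)"
  proof (rule theI)
    show "\<nu> = \<mu>" if "is_volume_measure \<rho> \<nu>" for \<nu>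
      by (rule is_volume_measure_unique[OF that \<mu>])
  qed (rule \<mu>)
  moreover have "volume_measure A \<omega> = (THE \<mu>. is_volume_measure \<rho> \<mu>)"
    unfolding volume_measure_def is_volume_measure_def \<rho>_def by (rule refl)
  ultimately show ?thesis by (simp only: \<rho>_def)
qed

text \<open>On a coordinate ball inside a null open set the positive density would integrate to 0,
  making the ball Lebesgue-null. This is needed for definiteness of the \<open>L^2\<close>
  norm.\<close>

lemma volume_measure_open_pos:
  assumes \<rho>: "chart_density \<rho>" and \<mu>: "is_volume_measure \<rho> \<mu>" and U: "open U" "U \<noteq> {}"
  shows "emeasure \<mu> U \<noteq> 0"
proof
  assume 0: "emeasure \<mu> U = 0"
  obtain p where p: "p \<in> U" using U by blast
  obtain c where c: "c \<in> A" "p \<in> cdom c" using chart_around .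
  obtain r where r: "r > 0" "ball (cmap c p) r \<subseteq> cmap c ` (cdom c \<inter> U)"
    using chart_ball[OF c U(1) p] .
  let ?B = "ball (cmap c p) r"
  have B: "?B \<subseteq> cmap c ` cdom c" using r(2) by blast
  have \<rho>_pos: "\<rho> c x > 0" if "x \<in> ?B" for x
    using chart_density_pos[OF \<rho> c(1)] B that by blast
  have sets: "sets \<mu> = sets borel" and V: "cdom c \<inter> U \<in> sets borel"
    using \<mu> open_cdom[OF c(1)] U(1) by (auto simp: is_volume_measure_def)
  have "emeasure \<mu> (cdom c \<inter> U) \<le> emeasure \<mu> U"
    using U(1) sets by (intro emeasure_mono) auto
  then have "(\<integral>\<^sup>+x\<in>cmap c ` (cdom c \<inter> U). ennreal (\<rho> c x) \<partial>lborel) = 0"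
    using 0 \<mu> c(1) V unfolding is_volume_measure_def by auto
  moreover have "(\<integral>\<^sup>+x. ennreal (indicator ?B x * \<rho> c x) \<partial>lborel)
      \<le> (\<integral>\<^sup>+x\<in>cmap c ` (cdom c \<inter> U). ennreal (\<rho> c x) \<partial>lborel)"
    using r(2) by (intro nn_integral_mono) (auto simp: indicator_def)
  ultimately have "(\<integral>\<^sup>+x. ennreal (indicator ?B x * \<rho> c x) \<partial>lborel) = 0" by simp
  then have "AE x in lborel. ennreal (indicator ?B x * \<rho> c x) = 0"
    using chart_density_measurable[OF \<rho> c(1) _ B] by (subst (asm) nn_integral_0_iff_AE) auto
  then have "AE x in lborel. x \<notin> ?B"
    by eventually_elim (use \<rho>_pos in \<open>force simp: indicator_def ennreal_eq_0_iff split: if_splits\<close>)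
  then have "?B \<in> null_sets lborel"
    by (subst AE_iff_null_sets) auto
  then have "negligible ?B"
    by (simp add: negligible_iff_null_sets null_sets_completionI)
  then show False using open_not_negligible[OF open_ball, of "cmap c p" r] r(1) by simp
qed

text \<open>A density may be unbounded on the open coordinate image, but it is bounded on a closed
  ball of half the radius; compactness leaves finitely many such balls.\<close>

lemma volume_measure_finite:
  assumes \<rho>: "chart_density \<rho>" and \<mu>: "is_volume_measure \<rho> \<mu>"
  shows "finite_measure \<mu>"
proof (rule finite_measureI)
  have sets: "sets \<mu> = sets borel" using \<mu> by (simp add: is_volume_measure_def)
  have "\<exists>U. open U \<and> p \<in> U \<and> emeasure \<mu> U < \<infinity>" for p
  proof -
    obtain c where c: "c \<in> A" "p \<in> cdom c" using chart_around .
    obtain r where r: "r > 0" "ball (cmap c p) r \<subseteq> cmap c ` cdom c"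
      using chart_ball[OF c open_UNIV] by auto
    let ?B = "ball (cmap c p) (r / 2)" and ?K = "cball (cmap c p) (r / 2)"
    have K: "?K \<subseteq> cmap c ` cdom c" using r by (auto simp: subset_iff)
    then have B: "?B \<subseteq> cmap c ` cdom c" using ball_subset_cball by blast
    have "continuous_on ?K (\<rho> c)" by (rule continuous_on_subset[OF chart_density_continuous[OF \<rho> c(1)] K])
    then have "bounded (\<rho> c ` ?K)" by (intro compact_imp_bounded compact_continuous_image compact_cball)
    then obtain M where "\<forall>y\<in>\<rho> c ` ?K. norm y \<le> M" unfolding bounded_iff by blast
    then have M: "\<rho> c x \<le> M" if "x \<in> ?K" for x
      using that by (metis abs_le_D1 image_eqI real_norm_def)
    let ?U = "cinv c ` ?B"
    have U: "open ?U" by (rule open_cinv_image[OF c(1) open_ball B])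
    have "?U \<subseteq> cdom c" "cmap c ` ?U = ?B"
      using B cinv_in_cdom[OF c(1)] cmap_cinv[OF c(1)] by (auto simp: image_iff subset_iff)
    then have "emeasure \<mu> ?U = (\<integral>\<^sup>+x\<in>?B. ennreal (\<rho> c x) \<partial>lborel)"
      using \<mu> c(1) U unfolding is_volume_measure_def by simp
    also have "\<dots> \<le> (\<integral>\<^sup>+x. ennreal M * indicator ?B x \<partial>lborel)"
      using M by (intro nn_integral_mono) (auto simp: indicator_def intro: ennreal_leI)
    also have "\<dots> = ennreal M * emeasure lborel ?B" by (intro nn_integral_cmult_indicator) simp
    also have "\<dots> < \<infinity>"
      using emeasure_lborel_ball_finite[of "cmap c p" "r / 2"] by (simp add: ennreal_mult_less_top)
    finally have "emeasure \<mu> ?U < \<infinity>" .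
    moreover have "p \<in> ?U" using r(1) cinv_cmap[OF c] by (metis centre_in_ball half_gt_zero image_eqI)
    ultimately show ?thesis using U by blast
  qed
  then obtain U where U: "\<And>p. open (U p)" "\<And>p. p \<in> U p" "\<And>p. emeasure \<mu> (U p) < \<infinity>" by metis
  have "UNIV \<subseteq> (\<Union>p. U p)" using U(2) by blast
  then obtain P where P: "finite P" "UNIV \<subseteq> (\<Union>p\<in>P. U p)"
    using compactE_image[OF compact_M, of UNIV U] U(1) by metis
  have space: "space \<mu> = UNIV" using sets_eq_imp_space_eq[OF sets] by simp
  have "emeasure \<mu> (space \<mu>) \<le> emeasure \<mu> (\<Union>p\<in>P. U p)"
    using P U(1) sets by (intro emeasure_mono) auto
  also have "\<dots> \<le> (\<Sum>p\<in>P. emeasure \<mu> (U p))"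
    using P(1) U(1) sets by (intro emeasure_subadditive_finite) auto
  also have "\<dots> < \<infinity>" using P(1) U(3) by (simp add: ennreal_sum_less_top)
  finally show "emeasure \<mu> (space \<mu>) \<noteq> \<infinity>" by simp
qed

end

section \<open>Linear algebra of volume forms and Gram matrices\<close>

definition alternating_form :: "(real^'n^'n \<Rightarrow> real) \<Rightarrow> bool" where
  "alternating_form F \<longleftrightarrow> (\<forall>V i. linear (\<lambda>v. F (\<chi> j. if j = i then v else V $ j))) \<and>
     (\<forall>V i j. i \<noteq> j \<and> V $ i = V $ j \<longrightarrow> F V = 0)"

lemma alternating_form_linear: "alternating_form F \<Longrightarrow> linear (\<lambda>v. F (\<chi> j. if j = i then v else V $ j))"
  and alternating_form_eq_0: "\<lbrakk>alternating_form F; i \<noteq> j; V $ i = V $ j\<rbrakk> \<Longrightarrow> F V = 0"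
  unfolding alternating_form_def by blast+

lemma update_row_self: "(\<chi> j. if j = i then V $ i else V $ j) = V"
  by (simp add: vec_eq_iff)

lemma row_mat_1: "(mat 1 :: real^'n^'n) $ i = axis i 1"
  by (auto simp: vec_eq_iff mat_def axis_def)

lemma continuous_on_det:
  fixes M :: "'a::topological_space \<Rightarrow> real^'n^'n"
  assumes "\<And>i j. continuous_on S (\<lambda>x. M x $ i $ j)"
  shows "continuous_on S (\<lambda>x. det (M x))"
  unfolding det_def by (intro continuous_intros assms)

lemma alternating_form_det: "alternating_form det"
  unfolding alternating_form_def
proof (intro conjI allI impI)
  fix V :: "real^'n^'n" and i
  show "linear (\<lambda>v. det (\<chi> j. if j = i then v else V $ j))"
  proof (rule linearI)
    show "det (\<chi> j. if j = i then x + y else V $ j)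
        = det (\<chi> j. if j = i then x else V $ j) + det (\<chi> j. if j = i then y else V $ j)" for x y
      by (rule det_row_add)
    show "det (\<chi> j. if j = i then r *\<^sub>R x else V $ j) = r *\<^sub>R det (\<chi> j. if j = i then x else V $ j)" for r x
      using det_row_mul[of i r "\<lambda>_. x" "\<lambda>j. V $ j"] by (simp only: scalar_mult_eq_scaleR real_scaleR_def)
  qed
next
  fix V :: "real^'n^'n" and i j assume "i \<noteq> j \<and> V $ i = V $ j"
  then show "det V = 0" using det_identical_rows[of i j V] by (simp add: row_def)
qed

lemma alternating_form_compose:
  fixes B :: "real^'n^'n"
  assumes F: "alternating_form F"
  shows "alternating_form (\<lambda>V. F (V ** B))"
  unfolding alternating_form_def
proof (intro conjI allI impI)
  fix V :: "real^'n^'n" and i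
  have "(\<chi> j. if j = i then v else V $ j) ** B = (\<chi> j. if j = i then v v* B else (V ** B) $ j)" for v
    by (auto simp: vec_eq_iff matrix_matrix_mult_def vector_matrix_mult_def mult.commute)
  moreover have "linear (\<lambda>v. v v* B)"
    unfolding transpose_matrix_vector[symmetric] by (rule matrix_vector_mul_linear)
  ultimately show "linear (\<lambda>v. F ((\<chi> j. if j = i then v else V $ j) ** B))"
    using linear_compose[OF _ alternating_form_linear[OF F]] by (simp add: comp_def)
next
  fix V :: "real^'n^'n" and i j assume *: "i \<noteq> j \<and> V $ i = V $ j"
  then have "(V ** B) $ i = (V ** B) $ j" by (simp add: vec_eq_iff matrix_matrix_mult_def)
  then show "F (V ** B) = 0" using F * by (blast intro: alternating_form_eq_0)
qed

text \<open>Polarisation: the value with \<open>V $ i + V $ j\<close> in both rows is 0 and expands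
  into four terms, two of which vanish.\<close>

lemma alternating_form_swap:
  assumes F: "alternating_form F" and "i \<noteq> j"
  shows "F (\<chi> k. if k = i then V $ j else if k = j then V $ i else V $ k) = - F V"
proof -
  let ?W = "\<lambda>x y. \<chi> k. if k = i then x else if k = j then y else V $ k"
  have 1: "linear (\<lambda>x. F (?W x y))" for y
  proof -
    have "?W x y = (\<chi> k. if k = i then x else (?W 0 y) $ k)" for x by (auto simp: vec_eq_iff)
    then show ?thesis using alternating_form_linear[OF F, of i "?W 0 y"] by simp
  qed
  have 2: "linear (\<lambda>y. F (?W x y))" for x
  proof -
    have "?W x y = (\<chi> k. if k = j then y else (?W x 0) $ k)" for y using \<open>i \<noteq> j\<close> by (auto simp: vec_eq_iff)
    then show ?thesis using alternating_form_linear[OF F, of j "?W x 0"] by simp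
  qed
  have 0: "F (?W x x) = 0" for x
    using alternating_form_eq_0[OF F \<open>i \<noteq> j\<close>, of "?W x x"] by simp
  have "0 = F (?W (V $ i + V $ j) (V $ i + V $ j))" by (rule 0[symmetric])
  also have "\<dots> = F (?W (V $ i) (V $ i)) + F (?W (V $ i) (V $ j)) + (F (?W (V $ j) (V $ i)) + F (?W (V $ j) (V $ j)))"
    unfolding linear_add[OF 1] linear_add[OF 2] by simp
  also have "\<dots> = F (?W (V $ i) (V $ j)) + F (?W (V $ j) (V $ i))" by (simp only: 0)
  finally have "F (?W (V $ j) (V $ i)) = - F (?W (V $ i) (V $ j))" by simp
  moreover have "?W (V $ i) (V $ j) = V" by (simp add: vec_eq_iff)
  ultimately show ?thesis by simp
qed

text \<open>Induction over products of elementary matrices, where each factor is a row operation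
  whose effect on an alternating form is known.\<close>

lemma alternating_form_vanishes:
  fixes F :: "real^'n^'n \<Rightarrow> real"
  assumes "alternating_form F" "F (mat 1) = 0"
  shows "F V = 0"
proof -
  \<comment> \<open>\<open>F\<close> is quantified inside: for a product \<open>A ** B\<close> the
    hypothesis on \<open>A\<close> is applied to \<open>\<lambda>V. F (V ** B)\<close>, which
    vanishes at \<open>mat 1\<close> by the hypothesis on \<open>B\<close>.\<close>
  have "\<forall>F. alternating_form F \<and> F (mat 1) = 0 \<longrightarrow> F V = 0"
  proof (rule induct_matrix_elementary[where P = "\<lambda>V. \<forall>F. alternating_form F \<and> F (mat 1) = 0 \<longrightarrow> F V = 0"])
    fix A B :: "real^'n^'n"
    assume A: "\<forall>F. alternating_form F \<and> F (mat 1) = 0 \<longrightarrow> F A = 0"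
      and B: "\<forall>F. alternating_form F \<and> F (mat 1) = 0 \<longrightarrow> F B = 0"
    show "\<forall>F. alternating_form F \<and> F (mat 1) = 0 \<longrightarrow> F (A ** B) = 0"
    proof (intro allI impI)
      fix F :: "real^'n^'n \<Rightarrow> real" assume F: "alternating_form F \<and> F (mat 1) = 0"
      then have "alternating_form (\<lambda>V. F (V ** B))" "F (mat 1 ** B) = 0"
        using B alternating_form_compose by auto
      then show "F (A ** B) = 0" using A[rule_format, of "\<lambda>V. F (V ** B)"] by blast
    qed
  next
    fix A :: "real^'n^'n" and i assume "row i A = 0"
    then have 0: "A $ i = 0" by (simp add: row_def)
    show "\<forall>F. alternating_form F \<and> F (mat 1) = 0 \<longrightarrow> F A = 0"
    proof (intro allI impI)
      fix F :: "real^'n^'n \<Rightarrow> real" assume F: "alternating_form F \<and> F (mat 1) = 0"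
      have "F (\<chi> j. if j = i then 0 else A $ j) = 0"
        using linear_0[OF alternating_form_linear[of F i A]] F by blast
      then have "F (\<chi> j. if j = i then A $ i else A $ j) = 0" using 0 by (simp cong: if_cong)
      then show "F A = 0" by (simp only: update_row_self)
    qed
  next
    fix A :: "real^'n^'n" assume A: "\<And>i j. i \<noteq> j \<Longrightarrow> A $ i $ j = 0"
    show "\<forall>F. alternating_form F \<and> F (mat 1) = 0 \<longrightarrow> F A = 0"
    proof (intro allI impI)
      fix F :: "real^'n^'n \<Rightarrow> real" assume F: "alternating_form F \<and> F (mat 1) = 0"
      have row: "A $ i = A $ i $ i *\<^sub>R axis i 1" for i
        using A by (auto simp: vec_eq_iff axis_def)
      \<comment> \<open>Starting from \<open>mat 1\<close>, the rows are replaced one at a time by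
        multiples of unit vectors; each replacement multiplies the value by a scalar.\<close>
      have "F (\<chi> j. if j \<in> K then A $ j else axis j 1) = 0" if "finite K" for K
        using that
      proof (induction K)
        case empty
        have "(\<chi> j. axis j 1) = (mat 1 :: real^'n^'n)" by (auto simp: vec_eq_iff mat_def axis_def)
        then show ?case using F by simp
      next
        case (insert i K)
        let ?V = "\<chi> j. if j \<in> K then A $ j else axis j 1"
        have lin: "linear (\<lambda>v. F (\<chi> j. if j = i then v else ?V $ j))"
          using F by (blast intro: alternating_form_linear)
        have "(\<chi> j. if j \<in> insert i K then A $ j else axis j 1) = (\<chi> j. if j = i then A $ i else ?V $ j)"
          by (auto simp: vec_eq_iff)
        also have "F \<dots> = F (\<chi> j. if j = i then A $ i $ i *\<^sub>R axis i 1 else ?V $ j)"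
          by (rule arg_cong[where f = "\<lambda>v. F (\<chi> j. if j = i then v else ?V $ j)", OF row])
        also have "\<dots> = A $ i $ i * F (\<chi> j. if j = i then axis i 1 else ?V $ j)"
          using linear_cmul[OF lin] by simp
        also have "(\<chi> j. if j = i then axis i 1 else ?V $ j) = ?V"
          using insert.hyps(2) by (auto simp: vec_eq_iff)
        finally show ?case using insert.IH by simp
      qed
      from this[of UNIV] show "F A = 0" by simp
    qed
  next
    fix m n :: 'n assume mn: "m \<noteq> n"
    show "\<forall>F. alternating_form F \<and> F (mat 1) = 0 \<longrightarrow>
        F (\<chi> i j. mat 1 $ i $ Transposition.transpose m n j) = 0"
    proof (intro allI impI)
      fix F :: "real^'n^'n \<Rightarrow> real" assume F: "alternating_form F \<and> F (mat 1) = 0"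
      have "(\<chi> i j. mat 1 $ i $ Transposition.transpose m n j) =
          ((\<chi> k. if k = m then mat 1 $ n else if k = n then mat 1 $ m else mat 1 $ k) :: real^'n^'n)"
        using mn by (auto simp: vec_eq_iff mat_def Transposition.transpose_def)
      then show "F (\<chi> i j. mat 1 $ i $ Transposition.transpose m n j) = 0"
        using alternating_form_swap[OF _ mn, of F "mat 1"] F by simp
    qed
  next
    fix m n :: 'n and c :: real assume mn: "m \<noteq> n"
    show "\<forall>F. alternating_form F \<and> F (mat 1) = 0 \<longrightarrow>
        F (\<chi> i j. if i = m \<and> j = n then c else of_bool (i = j)) = 0"
    proof (intro allI impI)
      fix F :: "real^'n^'n \<Rightarrow> real" assume F: "alternating_form F \<and> F (mat 1) = 0"
      have lin: "linear (\<lambda>v. F (\<chi> k. if k = m then v else mat 1 $ k))"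
        using F by (blast intro: alternating_form_linear)
      have "(\<chi> i j. if i = m \<and> j = n then c else of_bool (i = j)) =
          ((\<chi> k. if k = m then mat 1 $ m + c *\<^sub>R (mat 1 $ n) else mat 1 $ k) :: real^'n^'n)"
        using mn by (auto simp: vec_eq_iff mat_def)
      also have "F \<dots> = F (\<chi> k. if k = m then mat 1 $ m else mat 1 $ k) + c * F (\<chi> k. if k = m then mat 1 $ n else mat 1 $ k)"
        by (simp add: linear_add[OF lin] linear_cmul[OF lin])
      also have "F (\<chi> k. if k = m then mat 1 $ n else mat 1 $ k) = 0"
        by (rule alternating_form_eq_0[of F m n]) (use F mn in auto)
      also have "(\<chi> k. if k = m then mat 1 $ m else mat 1 $ k) = (mat 1 :: real^'n^'n)"
        by (rule update_row_self)
      finally show "F (\<chi> i j. if i = m \<and> j = n then c else of_bool (i = j)) = 0" using F by simp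
    qed
  qed
  then show ?thesis using assms by blast
qed

text \<open>The difference of the two sides is alternating in \<open>V\<close> and vanishes at
  \<open>mat 1\<close>.\<close>

lemma alternating_form_eq_det:
  fixes F :: "real^'n^'n \<Rightarrow> real"
  assumes F: "alternating_form F"
  shows "F V = det V * F (mat 1)"
proof -
  have "alternating_form (\<lambda>V. F V - det V * F (mat 1))"
    unfolding alternating_form_def
  proof (intro conjI allI impI)
    show "linear (\<lambda>v. F (\<chi> j. if j = i then v else V $ j) - det (\<chi> j. if j = i then v else V $ j) * F (mat 1))" for V i
      using alternating_form_linear[OF F, of i V] alternating_form_linear[OF alternating_form_det, of i V]
      by (intro linear_compose_sub) (auto simp: linear_iff algebra_simps)
    show "F V - det V * F (mat 1) = 0" if "i \<noteq> j \<and> V $ i = V $ j" for V i j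
      using that alternating_form_eq_0[OF F, of i j V] alternating_form_eq_0[OF alternating_form_det, of i j V] by simp
  qed
  from alternating_form_vanishes[OF this, of V] show ?thesis by simp
qed

text \<open>All matrices on the segment from the identity to \<open>G\<close> are positive definite,
  hence invertible, so the determinant cannot change sign along it.\<close>

lemma det_positive_definite:
  fixes G :: "real^'n^'n"
  assumes pos: "\<And>v. v \<noteq> 0 \<Longrightarrow> v \<bullet> (G *v v) > 0"
  shows "det G > 0"
proof (rule ccontr)
  assume "\<not> det G > 0"
  define M where "M t = (1 - t) *\<^sub>R (mat 1 :: real^'n^'n) + t *\<^sub>R G" for t :: real
  have M_mult: "M t *v v = (1 - t) *\<^sub>R v + t *\<^sub>R (G *v v)" for t v
    by (simp add: M_def matrix_vector_mult_add_rdistrib flip: scaleR_matrix_vector_assoc)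
  have nz: "det (M t) \<noteq> 0" if t: "0 \<le> t" "t \<le> 1" for t
  proof -
    have "v = 0" if "M t *v v = 0" for v
    proof (rule ccontr)
      assume v: "v \<noteq> 0"
      have "(1 - t) * (v \<bullet> v) + t * (v \<bullet> (G *v v)) = v \<bullet> (M t *v v)"
        by (simp add: M_mult inner_add_right)
      moreover have "(1 - t) * (v \<bullet> v) + t * (v \<bullet> (G *v v)) > 0"
        using pos[OF v] v t by (cases "t = 0") (auto intro: add_nonneg_pos)
      ultimately show False using that by simp
    qed
    then have "\<exists>B. B ** M t = mat 1" by (simp add: matrix_left_invertible_ker)
    then show ?thesis by (simp add: invertible_left_inverse flip: invertible_det_nz)
  qed
  have "continuous_on {0..1} (\<lambda>t. det (M t))"
    by (rule continuous_on_det) (auto simp: M_def intro!: continuous_intros)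
  moreover have "M 0 = mat 1" "M 1 = G" by (simp_all add: M_def vec_eq_iff)
  ultimately obtain t where "0 \<le> t" "t \<le> 1" "det (M t) = 0"
    using IVT2'[of "\<lambda>t. det (M t)" 1 0 0] \<open>\<not> det G > 0\<close> by auto
  with nz show False by blast
qed

lemma gram_inner:
  assumes "bilinear (g c x)"
  shows "g c x v w = v \<bullet> (gram g c x *v w)"
proof -
  have lin: "linear (g c x v)" "linear (\<lambda>v. g c x v w)" for v w
    using assms by (auto simp: bilinear_def)
  have "g c x v w = g c x (\<Sum>i\<in>UNIV. v $ i *s axis i 1) (\<Sum>j\<in>UNIV. w $ j *s axis j 1)"
    by (simp only: basis_expansion)
  also have "\<dots> = (\<Sum>j\<in>UNIV. \<Sum>i\<in>UNIV. w $ j * (v $ i * g c x (axis i 1) (axis j 1)))"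
    by (simp add: linear_sum[OF lin(1)] linear_sum[OF lin(2)] linear_cmul[OF lin(1)] linear_cmul[OF lin(2)]
        scalar_mult_eq_scaleR sum_distrib_left)
  also have "\<dots> = (\<Sum>i\<in>UNIV. \<Sum>j\<in>UNIV. w $ j * (v $ i * g c x (axis i 1) (axis j 1)))"
    by (rule sum.swap)
  also have "\<dots> = v \<bullet> (gram g c x *v w)"
    by (simp add: inner_vec_def gram_def matrix_vector_mult_def sum_distrib_left mult_ac)
  finally show ?thesis .
qed

lemma linear_eq_inner:
  fixes f :: "real^'n \<Rightarrow> real"
  assumes "linear f"
  shows "f v = v \<bullet> (\<chi> i. f (axis i 1))"
proof -
  have "f v = f (\<Sum>i\<in>UNIV. v $ i *s axis i 1)" by (simp only: basis_expansion)
  also have "\<dots> = v \<bullet> (\<chi> i. f (axis i 1))"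
    by (simp add: linear_sum[OF assms] linear_cmul[OF assms] scalar_mult_eq_scaleR inner_vec_def)
  finally show ?thesis .
qed

lemma matrix_inv_mult:
  fixes G :: "real^'n^'n"
  assumes "det G \<noteq> 0"
  shows "G *v (matrix_inv G *v a) = a"
proof -
  have "invertible G" using assms by (simp add: invertible_det_nz)
  then have "G ** matrix_inv G = mat 1"
    unfolding invertible_def matrix_inv_def by (rule someI2_ex) blast
  then show ?thesis by (simp add: matrix_vector_mul_assoc)
qed

section \<open>Densities of volume forms and of Riemannian metrics\<close>

context manifold begin

lemma transition_in_image:
  "\<lbrakk>c \<in> A; x \<in> cmap c ` (cdom c \<inter> cdom d)\<rbrakk> \<Longrightarrow> transition c d x \<in> cmap d ` cdom d"
  by (auto simp: transition_cmap)

text \<open>The rows of the transported coordinate frame form the transposed Jacobian, and a top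
  form scales with the determinant of the frame.\<close>

lemma volume_form_density:
  assumes "volume_form A \<omega>"
  shows "chart_density (\<lambda>c x. \<omega> c x (mat 1))"
  unfolding chart_density_def
proof (intro conjI ballI)
  have top: "smooth_top_form A \<omega>" using assms by (simp add: volume_form_def)
  fix c assume c: "c \<in> A"
  show "continuous_on (cmap c ` cdom c) (\<lambda>x. \<omega> c x (mat 1))"
    by (rule smooth_on_continuous) (use top c in \<open>unfold smooth_top_form_def, blast\<close>)
  show "\<omega> c x (mat 1) > 0" if "x \<in> cmap c ` cdom c" for x
    using assms c that by (auto simp: volume_form_def)
  fix d x assume d: "d \<in> A" and x: "x \<in> cmap c ` (cdom c \<inter> cdom d)"
  let ?J = "\<chi> j. dtransition c d x (mat 1 $ j)" and ?y = "transition c d x"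
  have y: "?y \<in> cmap d ` cdom d" by (rule transition_in_image[OF c x])
  then have alt: "alternating_form (\<omega> d ?y)"
    using top d unfolding smooth_top_form_def alternating_form_def by blast
  have "\<omega> c x (mat 1) = \<omega> d ?y ?J"
    by (rule top[unfolded smooth_top_form_def, THEN conjunct2, rule_format, OF c d x])
  also have "\<dots> = det ?J * \<omega> d ?y (mat 1)"
    by (rule alternating_form_eq_det[OF alt])
  also have "?J = Finite_Cartesian_Product.transpose (matrix (dtransition c d x))"
    by (simp add: vec_eq_iff Finite_Cartesian_Product.transpose_def matrix_def row_mat_1)
  finally show "\<omega> c x (mat 1) = det (matrix (dtransition c d x)) * \<omega> d ?y (mat 1)" by simp
qed

lemma metric_bilinear: "\<lbrakk>riemannian_metric A g; c \<in> A; x \<in> cmap c ` cdom c\<rbrakk> \<Longrightarrow> bilinear (g c x)"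
  and metric_pos: "\<lbrakk>riemannian_metric A g; c \<in> A; x \<in> cmap c ` cdom c; v \<noteq> 0\<rbrakk> \<Longrightarrow> g c x v v > 0"
  and metric_smooth: "\<lbrakk>riemannian_metric A g; c \<in> A\<rbrakk> \<Longrightarrow> smooth_on (cmap c ` cdom c) (\<lambda>x. g c x v w)"
  and metric_transition: "\<lbrakk>riemannian_metric A g; c \<in> A; d \<in> A; x \<in> cmap c ` (cdom c \<inter> cdom d)\<rbrakk>
    \<Longrightarrow> g c x v w = g d (transition c d x) (dtransition c d x v) (dtransition c d x w)"
  unfolding riemannian_metric_def by blast+

lemma metric_gram:
  "\<lbrakk>riemannian_metric A g; c \<in> A; x \<in> cmap c ` cdom c\<rbrakk> \<Longrightarrow> g c x v w = v \<bullet> (gram g c x *v w)"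
  by (intro gram_inner metric_bilinear)

lemma gram_det_pos:
  assumes g: "riemannian_metric A g" and c: "c \<in> A" "x \<in> cmap c ` cdom c"
  shows "det (gram g c x) > 0"
  using det_positive_definite[of "gram g c x"] metric_pos[OF g c] metric_gram[OF g c]
  by simp

lemma gram_continuous:
  assumes g: "riemannian_metric A g" and c: "c \<in> A"
  shows "continuous_on (cmap c ` cdom c) (\<lambda>x. gram g c x $ i $ j)"
  using smooth_on_continuous[OF metric_smooth[OF g c]] by (simp add: gram_def)

lemma gram_transition:
  assumes g: "riemannian_metric A g" and cd: "c \<in> A" "d \<in> A" and x: "x \<in> cmap c ` (cdom c \<inter> cdom d)"
  defines "J \<equiv> matrix (dtransition c d x)"
  shows "gram g c x = Finite_Cartesian_Product.transpose J ** (gram g d (transition c d x) ** J)"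
proof -
  let ?G = "gram g d (transition c d x)"
  have lin: "linear (dtransition c d x)"
    by (rule has_derivative_linear[OF transition_has_derivative[OF cd x]])
  have J: "dtransition c d x v = J *v v" for v
    using fun_cong[OF matrix_vector_mul(2)[OF lin]] by (simp add: J_def)
  have "gram g c x $ i $ j = (Finite_Cartesian_Product.transpose J ** (?G ** J)) $ i $ j" for i j
  proof -
    have "gram g c x $ i $ j = g c x (axis i 1) (axis j 1)" by (simp add: gram_def)
    also have "\<dots> = g d (transition c d x) (J *v axis i 1) (J *v axis j 1)"
      by (rule metric_transition[OF g cd x, unfolded J])
    also have "\<dots> = (J *v axis i 1) \<bullet> (?G *v (J *v axis j 1))"
      by (rule metric_gram[OF g cd(2) transition_in_image[OF cd(1) x]])
    also have "\<dots> = column i J \<bullet> (?G *v column j J)"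
      by (simp add: matrix_vector_mult_basis)
    also have "\<dots> = (Finite_Cartesian_Product.transpose J ** (?G ** J)) $ i $ j"
      by (simp add: inner_vec_def column_def Finite_Cartesian_Product.transpose_def matrix_matrix_mult_def
          matrix_vector_mult_def)
    finally show ?thesis .
  qed
  then show ?thesis by (simp add: vec_eq_iff)
qed

text \<open>By \<open>gram_transition\<close> the Gram determinant changes by the square of the
  Jacobian determinant, which is positive and so comes out of the root without a sign.\<close>

lemma riemannian_volume_density:
  assumes g: "riemannian_metric A g"
  shows "chart_density (\<lambda>c x. riemannian_volume g c x (mat 1))"
  unfolding chart_density_def
proof (intro conjI ballI)
  fix c assume c: "c \<in> A"
  show "continuous_on (cmap c ` cdom c) (\<lambda>x. riemannian_volume g c x (mat 1))"
    unfolding riemannian_volume_def by (intro continuous_intros continuous_on_det gram_continuous[OF g c])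
  show "riemannian_volume g c x (mat 1) > 0" if "x \<in> cmap c ` cdom c" for x
    using gram_det_pos[OF g c that] by (simp add: riemannian_volume_def)
  fix d x assume d: "d \<in> A" and x: "x \<in> cmap c ` (cdom c \<inter> cdom d)"
  show "riemannian_volume g c x (mat 1)
      = det (matrix (dtransition c d x)) * riemannian_volume g d (transition c d x) (mat 1)"
    using det_dtransition[OF c d x]
    by (simp add: riemannian_volume_def gram_transition[OF g c d x] det_mul real_sqrt_mult)
qed

section \<open>The pointwise norm of a 1-form\<close>

lemma one_form_linear: "\<lbrakk>smooth_one_form A \<alpha>; c \<in> A; x \<in> cmap c ` cdom c\<rbrakk> \<Longrightarrow> linear (\<alpha> c x)"
  and one_form_smooth: "\<lbrakk>smooth_one_form A \<alpha>; c \<in> A\<rbrakk> \<Longrightarrow> smooth_on (cmap c ` cdom c) (\<lambda>x. \<alpha> c x v)"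
  and one_form_transition: "\<lbrakk>smooth_one_form A \<alpha>; c \<in> A; d \<in> A; x \<in> cmap c ` (cdom c \<inter> cdom d)\<rbrakk>
    \<Longrightarrow> \<alpha> c x v = \<alpha> d (transition c d x) (dtransition c d x v)"
  unfolding smooth_one_form_def by blast+

text \<open>\<open>form_sqnorm\<close> in a prescribed chart, free of the choice by
  \<open>SOME\<close>.\<close>

definition chart_sqnorm :: "('m, 'n) two_tensor \<Rightarrow> ('m, 'n) one_form \<Rightarrow> ('m, 'n) density" where
  "chart_sqnorm g \<alpha> c x = (let a = (\<chi> i. \<alpha> c x (axis i 1)) in a \<bullet> (matrix_inv (gram g c x) *v a))"

text \<open>The squared norm of \<open>\<alpha>\<close> is \<open>\<alpha>(b)\<close> for the vector \<open>b\<close> dual to \<open>\<alpha>\<close>, which does not depend on coordinates.\<close>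

lemma dual_vector:
  assumes g: "riemannian_metric A g" and \<alpha>: "smooth_one_form A \<alpha>" and c: "c \<in> A" "x \<in> cmap c ` cdom c"
  obtains b where "\<And>v. g c x v b = \<alpha> c x v" "chart_sqnorm g \<alpha> c x = \<alpha> c x b"
proof
  let ?a = "\<chi> i. \<alpha> c x (axis i 1)"
  let ?b = "matrix_inv (gram g c x) *v ?a"
  have lin: "linear (\<alpha> c x)" by (rule one_form_linear[OF \<alpha> c])
  have G: "gram g c x *v ?b = ?a"
    using gram_det_pos[OF g c] by (intro matrix_inv_mult) simp
  show "g c x v ?b = \<alpha> c x v" for v
    unfolding metric_gram[OF g c] G linear_eq_inner[OF lin, of v] ..
  show "chart_sqnorm g \<alpha> c x = \<alpha> c x ?b"
    unfolding linear_eq_inner[OF lin, of ?b] chart_sqnorm_def Let_def by (rule inner_commute)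
qed

text \<open>The Jacobian maps the dual vector in \<open>c\<close> to the one in \<open>d\<close>:
  both represent the same functional because the Jacobian is onto, and the metric is definite. This
  spares the transformation of inverse Gram matrices.\<close>

lemma chart_sqnorm_transition:
  assumes g: "riemannian_metric A g" and \<alpha>: "smooth_one_form A \<alpha>" and cd: "c \<in> A" "d \<in> A"
    and x: "x \<in> cmap c ` (cdom c \<inter> cdom d)"
  shows "chart_sqnorm g \<alpha> c x = chart_sqnorm g \<alpha> d (transition c d x)"
proof -
  let ?y = "transition c d x" and ?J = "dtransition c d x"
  have x': "x \<in> cmap c ` cdom c" using x by blast
  note y = transition_in_image[OF cd(1) x]
  obtain b where b: "\<And>v. g c x v b = \<alpha> c x v" "chart_sqnorm g \<alpha> c x = \<alpha> c x b"
    using dual_vector[OF g \<alpha> cd(1) x'] by blast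
  obtain b' where b': "\<And>v. g d ?y v b' = \<alpha> d ?y v" "chart_sqnorm g \<alpha> d ?y = \<alpha> d ?y b'"
    using dual_vector[OF g \<alpha> cd(2) y] by blast
  have lin: "linear ?J" by (rule has_derivative_linear[OF transition_has_derivative[OF cd x]])
  have "surj ?J"
  proof -
    have "invertible (matrix ?J)" using det_dtransition[OF cd x] by (simp add: invertible_det_nz)
    then obtain B where "matrix ?J ** B = mat 1" unfolding invertible_def by blast
    then have "?J (B *v w) = w" for w
      using fun_cong[OF matrix_vector_mul(2)[OF lin], of "B *v w", symmetric] by (simp add: matrix_vector_mul_assoc)
    then show ?thesis by (metis surjI)
  qed
  have \<alpha>_tr: "\<alpha> c x v = \<alpha> d ?y (?J v)" for v
    by (rule one_form_transition[OF \<alpha> cd x])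
  have "g d ?y w (?J b) = g d ?y w b'" for w
  proof -
    obtain v where w: "w = ?J v" using \<open>surj ?J\<close> by (metis surjD)
    show ?thesis
      unfolding w b'(1) using metric_transition[OF g cd x, of v b] b(1)[of v] \<alpha>_tr[of v] by simp
  qed
  moreover have "linear (g d ?y (?J b - b'))"
    using metric_bilinear[OF g cd(2) y] by (simp add: bilinear_def)
  ultimately have "g d ?y (?J b - b') (?J b - b') = 0"
    by (simp add: linear_diff)
  then have "?J b = b'" using metric_pos[OF g cd(2) y, of "?J b - b'"] by force
  then show ?thesis using b(2) b'(2) \<alpha>_tr[of b] by simp
qed

lemma form_sqnorm_eq:
  assumes g: "riemannian_metric A g" and \<alpha>: "smooth_one_form A \<alpha>" and c: "c \<in> A" "p \<in> cdom c"
  shows "form_sqnorm A g \<alpha> p = chart_sqnorm g \<alpha> c (cmap c p)"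
proof -
  define d where "d = (SOME c. c \<in> A \<and> p \<in> cdom c)"
  have d: "d \<in> A" "p \<in> cdom d" using someI[of "\<lambda>c. c \<in> A \<and> p \<in> cdom c" c] c by (auto simp: d_def)
  have "form_sqnorm A g \<alpha> p = chart_sqnorm g \<alpha> d (cmap d p)"
    by (simp add: form_sqnorm_def chart_sqnorm_def Let_def d_def)
  also have "\<dots> = chart_sqnorm g \<alpha> c (transition d c (cmap d p))"
    by (rule chart_sqnorm_transition[OF g \<alpha> d(1) c(1)]) (use c d in auto)
  finally show ?thesis by (simp add: transition_cmap[OF d])
qed

text \<open>Cramer's rule writes the dual vector with determinants in the entries of
  \<open>\<alpha>\<close> and of the Gram matrix, which are continuous.\<close>

lemma chart_sqnorm_continuous:
  assumes g: "riemannian_metric A g" and \<alpha>: "smooth_one_form A \<alpha>" and c: "c \<in> A"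
  shows "continuous_on (cmap c ` cdom c) (chart_sqnorm g \<alpha> c)"
proof -
  let ?X = "cmap c ` cdom c"
  have cont_\<alpha>: "continuous_on ?X (\<lambda>x. \<alpha> c x v)" for v
    by (rule smooth_on_continuous[OF one_form_smooth[OF \<alpha> c]])
  let ?a = "\<lambda>x. \<chi> i. \<alpha> c x (axis i 1)"
  let ?b = "\<lambda>x k. det (\<chi> i j. if j = k then \<alpha> c x (axis i 1) else gram g c x $ i $ j) / det (gram g c x)"
  have "chart_sqnorm g \<alpha> c x = (\<Sum>k\<in>UNIV. \<alpha> c x (axis k 1) * ?b x k)" if x: "x \<in> ?X" for x
  proof -
    have nz: "det (gram g c x) \<noteq> 0" using gram_det_pos[OF g c x] by simp
    have "matrix_inv (gram g c x) *v ?a x = (\<chi> k. det (\<chi> i j. if j = k then ?a x $ i else gram g c x $ i $ j) / det (gram g c x))"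
      using cramer[OF nz] matrix_inv_mult[OF nz] by blast
    then show ?thesis by (simp add: chart_sqnorm_def inner_vec_def cong: if_cong)
  qed
  moreover have "continuous_on ?X (\<lambda>x. if j = k then \<alpha> c x (axis i 1) else gram g c x $ i $ j)" for i j k
    using cont_\<alpha> gram_continuous[OF g c] by (cases "j = k") auto
  then have "continuous_on ?X (\<lambda>x. \<Sum>k\<in>UNIV. \<alpha> c x (axis k 1) * ?b x k)"
    using gram_det_pos[OF g c]
    by (intro continuous_intros cont_\<alpha> continuous_on_det gram_continuous[OF g c]) (force | simp)+
  ultimately show ?thesis by (simp cong: continuous_on_cong)
qed

lemma form_sqnorm_continuous:
  assumes g: "riemannian_metric A g" and \<alpha>: "smooth_one_form A \<alpha>"
  shows "continuous_on UNIV (form_sqnorm A g \<alpha>)"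
proof -
  have "continuous (at p) (form_sqnorm A g \<alpha>)" for p
  proof -
    obtain c where c: "c \<in> A" "p \<in> cdom c" using chart_around .
    have "continuous_on (cdom c) (\<lambda>q. chart_sqnorm g \<alpha> c (cmap c q))"
      by (rule continuous_on_compose2[OF chart_sqnorm_continuous[OF g \<alpha> c(1)] continuous_on_cmap[OF c(1)]]) simp
    then have "continuous_on (cdom c) (form_sqnorm A g \<alpha>)"
      by (rule continuous_on_eq) (simp add: form_sqnorm_eq[OF g \<alpha> c(1)])
    then show ?thesis using c(2) continuous_on_eq_continuous_at[OF open_cdom[OF c(1)]] by blast
  qed
  then show ?thesis by (simp add: continuous_at_imp_continuous_on)
qed

text \<open>The value is \<open>g(b, b)\<close> for the dual vector \<open>b\<close>, and
  \<open>b = 0\<close> forces \<open>\<alpha>\<close> to vanish at the point.\<close>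

lemma form_sqnorm_nonneg:
  assumes g: "riemannian_metric A g" and \<alpha>: "smooth_one_form A \<alpha>"
  shows "form_sqnorm A g \<alpha> p \<ge> 0"
    and form_sqnorm_eq_0: "\<lbrakk>form_sqnorm A g \<alpha> p = 0; c \<in> A; p \<in> cdom c\<rbrakk> \<Longrightarrow> \<alpha> c (cmap c p) v = 0"
proof -
  have *: "form_sqnorm A g \<alpha> p \<ge> 0 \<and> (form_sqnorm A g \<alpha> p = 0 \<longrightarrow> \<alpha> c (cmap c p) v = 0)"
    if c: "c \<in> A" "p \<in> cdom c" for c v
  proof -
    let ?x = "cmap c p"
    have x: "?x \<in> cmap c ` cdom c" using c by blast
    obtain b where b: "\<And>v. g c ?x v b = \<alpha> c ?x v" "chart_sqnorm g \<alpha> c ?x = \<alpha> c ?x b"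
      using dual_vector[OF g \<alpha> c(1) x] by blast
    have eq: "form_sqnorm A g \<alpha> p = g c ?x b b" using form_sqnorm_eq[OF g \<alpha> c] b by simp
    have lin: "linear (g c ?x w)" for w using metric_bilinear[OF g c(1) x] by (simp add: bilinear_def)
    show ?thesis
    proof (cases "b = 0")
      case True
      then show ?thesis using eq b(1)[of v] linear_0[OF lin] by simp
    next
      case False
      then show ?thesis using eq metric_pos[OF g c(1) x False] by simp
    qed
  qed
  show "form_sqnorm A g \<alpha> p \<ge> 0" using * chart_around by metis
  show "\<lbrakk>form_sqnorm A g \<alpha> p = 0; c \<in> A; p \<in> cdom c\<rbrakk> \<Longrightarrow> \<alpha> c (cmap c p) v = 0" using * by blast
qed

end

context manifold begin

section \<open>Exact forms\<close>

definition smooth_function :: "('m \<Rightarrow> real) \<Rightarrow> bool" where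
  "smooth_function f \<longleftrightarrow> (\<forall>c\<in>A. smooth_on (cmap c ` cdom c) (f \<circ> cinv c))"

definition exact_form :: "('m \<Rightarrow> real) \<Rightarrow> ('m, 'n) one_form" where
  "exact_form f c x = frechet_derivative (f \<circ> cinv c) (at x)"

lemma exact_form_has_derivative:
  assumes "smooth_function f" "c \<in> A" "x \<in> cmap c ` cdom c"
  shows "((f \<circ> cinv c) has_derivative exact_form f c x) (at x)"
  unfolding exact_form_def
  by (rule smooth_on_has_derivative[OF _ assms(3)]) (use assms in \<open>simp add: smooth_function_def\<close>)

lemma local_primitive_exact_form:
  assumes "smooth_function f"
  shows "local_primitive A (exact_form f) UNIV f"
  unfolding local_primitive_def using exact_form_has_derivative[OF assms] by auto

text \<open>Closedness is the symmetry of second derivatives; the transformation law is the chain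
  rule.\<close>

lemma closed_exact_form:
  assumes f: "smooth_function f"
  shows "closed_one_form A (exact_form f)"
proof -
  have smooth: "smooth_on (cmap c ` cdom c) (f \<circ> cinv c)" if "c \<in> A" for c
    using f that by (simp add: smooth_function_def)
  have "smooth_one_form A (exact_form f)"
    unfolding smooth_one_form_def
  proof (intro conjI ballI allI)
    fix c x assume c: "c \<in> A" and x: "x \<in> cmap c ` cdom c"
    show "linear (exact_form f c x)"
      by (rule has_derivative_linear[OF exact_form_has_derivative[OF f c x]])
  next
    fix c v assume c: "c \<in> A"
    show "smooth_on (cmap c ` cdom c) (\<lambda>x. exact_form f c x v)"
      unfolding exact_form_def by (rule smooth_on_frechet_derivative[OF smooth[OF c]])
  next
    fix c d x v assume c: "c \<in> A" and d: "d \<in> A" and x: "x \<in> cmap c ` (cdom c \<inter> cdom d)"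
    have "((f \<circ> cinv d) \<circ> transition c d has_derivative exact_form f d (transition c d x) \<circ> dtransition c d x) (at x)"
      by (intro diff_chain_at transition_has_derivative exact_form_has_derivative f c d x transition_in_image)
    then have "((f \<circ> cinv c) has_derivative exact_form f d (transition c d x) \<circ> dtransition c d x) (at x)"
    proof (rule has_derivative_transform_within_open)
      show "open (cmap c ` (cdom c \<inter> cdom d))" by (intro open_cmap_image open_cdom c d)
    qed (use x cinv_transition[OF c d] in auto)
    from fun_cong[OF frechet_derivative_at[OF this], of v, symmetric]
    show "exact_form f c x v = exact_form f d (transition c d x) (dtransition c d x v)"
      by (simp only: exact_form_def comp_apply)
  qed
  moreover have "frechet_derivative (\<lambda>y. exact_form f c y w) (at x) v
      - frechet_derivative (\<lambda>y. exact_form f c y v) (at x) w = 0"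
    if c: "c \<in> A" and x: "x \<in> cmap c ` cdom c" for c x v w
    unfolding exact_form_def
    using smooth_on_second_derivative_symmetric[OF smooth[OF c] open_image_cdom[OF c] x] by simp
  ultimately show ?thesis unfolding closed_one_form_def by blast
qed

lemma smooth_exact_form: "smooth_function f \<Longrightarrow> smooth_one_form A (exact_form f)"
  using closed_exact_form by (simp add: closed_one_form_def)

lemma smooth_function_scale:
  assumes "smooth_function f"
  shows "smooth_function (\<lambda>p. k * f p)"
  using assms open_image_cdom unfolding smooth_function_def smooth_on_def comp_def
  by (auto intro!: Ck_on_mult Ck_on_const)

text \<open>\<open>f\<close> and the zero function are then primitives of the same form, so
  \<open>f\<close> is locally constant, and the manifold is connected.\<close>

lemma exact_form_eq_0_imp_const:
  assumes f: "smooth_function f" and 0: "\<And>c p v. \<lbrakk>c \<in> A; p \<in> cdom c\<rbrakk> \<Longrightarrow> exact_form f c (cmap c p) v = 0"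
  shows "f p = f q"
proof (rule connected_equivalence_relation[OF connected_M UNIV_I UNIV_I, where R = "\<lambda>p q. f p = f q"])
  fix p :: 'm
  have "local_primitive A (exact_form f) UNIV (\<lambda>_. 0)"
    unfolding local_primitive_def
  proof (intro conjI ballI)
    fix c x assume c: "c \<in> A" and x: "x \<in> cmap c ` (cdom c \<inter> UNIV)"
    then have "exact_form f c x = (\<lambda>_. 0)" using 0[OF c] by auto
    then show "(((\<lambda>_. 0) \<circ> cinv c) has_derivative exact_form f c x) (at x)" by (simp add: comp_def)
  qed simp
  from local_primitive_diff[OF local_primitive_exact_form[OF f] this UNIV_I UNIV_I]
  obtain U C where "open U" "p \<in> U" "\<And>q. q \<in> U \<Longrightarrow> f q = 0 + C" by metis
  then show "\<exists>T. openin (top_of_set UNIV) T \<and> p \<in> T \<and> (\<forall>q\<in>T. f p = f q)"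
    by (intro exI[of _ U]) auto
qed auto

lemma smooth_function_separates:
  assumes pq: "p \<noteq> q"
  obtains f where "smooth_function f" "f p \<noteq> f q"
proof -
  obtain c where c: "c \<in> A" "p \<in> cdom c" using chart_around .
  obtain R where R: "R > 0" "ball (cmap c p) R \<subseteq> cmap c ` (cdom c \<inter> - {q})"
    using chart_ball[OF c, of "- {q}"] pq by auto
  \<comment> \<open>With half the radius the closed ball still lies in the coordinate image; its
    preimage is compact, hence closed in the manifold, and this makes the extension by 0
    smooth.\<close>
  define r where "r = R / 2"
  have r: "r > 0" using R(1) by (simp add: r_def)
  have K: "cball (cmap c p) r \<subseteq> cmap c ` (cdom c \<inter> - {q})"
    using R by (intro order_trans[OF _ R(2)]) (auto simp: r_def)
  define f where "f z = (if z \<in> cdom c then bump (cmap c p) r (cmap c z) else 0)" for z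
  let ?K = "cinv c ` cball (cmap c p) r"
  have "compact ?K"
    using K by (intro compact_continuous_image compact_cball continuous_on_subset[OF continuous_on_cinv[OF c(1)]]) auto
  then have closed_K: "closed ?K" by (rule compact_imp_closed)
  have f_0: "f z = 0" if "z \<notin> ?K" for z
  proof (cases "z \<in> cdom c")
    case True
    then have "cmap c z \<notin> ball (cmap c p) r"
      using that cinv_cmap[OF c(1) True] ball_subset_cball by (metis image_eqI subsetD)
    then show ?thesis using bump_eq_0[of r "cmap c z"] r True by (simp add: f_def)
  qed (simp add: f_def)
  have "smooth_function f"
    unfolding smooth_function_def smooth_on_def
  proof (intro ballI allI)
    fix d k assume d: "d \<in> A"
    show "Ck_on k (cmap d ` cdom d) (f \<circ> cinv d)"
    proof (rule Ck_on_local)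
      fix x assume "x \<in> cmap d ` cdom d"
      then obtain z where z: "z \<in> cdom d" "x = cmap d z" by blast
      show "\<exists>T. open T \<and> x \<in> T \<and> Ck_on k T (f \<circ> cinv d)"
      proof (cases "z \<in> cdom c")
        case True
        let ?T = "cmap d ` (cdom d \<inter> cdom c)"
        have T: "open ?T" by (intro open_cmap_image open_cdom c d)
        have "smooth_on ?T (bump (cmap c p) r \<circ> transition d c)"
          by (rule smooth_on_compose[OF T smooth_on_transition[OF d c(1)] smooth_on_bump]) simp
        then have "Ck_on k ?T (bump (cmap c p) r \<circ> transition d c)" by (simp add: smooth_on_def)
        then have "Ck_on k ?T (f \<circ> cinv d)"
          by (rule Ck_on_cong_imp[OF T, rotated]) (auto simp: f_def transition_cmap[OF d] cinv_cmap[OF d])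
        then show ?thesis using T z True by (intro exI[of _ ?T]) auto
      next
        case False
        \<comment> \<open>Off the chart domain of \<open>c\<close> the complement of
          \<open>?K\<close> is a neighbourhood on which \<open>f\<close> vanishes.\<close>
        let ?T = "cmap d ` (cdom d \<inter> - ?K)"
        have T: "open ?T" using closed_K by (intro open_cmap_image d) auto
        have "Ck_on k ?T (f \<circ> cinv d)"
          by (rule Ck_on_cong_imp[OF T _ Ck_on_const[of k ?T 0]]) (auto simp: f_0 cinv_cmap[OF d])
        moreover have "?K \<subseteq> cdom c" using K cinv_in_cdom[OF c(1)] by blast
        then have "x \<in> ?T" using False z by blast
        ultimately show ?thesis using T by blast
      qed
    qed
  qed
  moreover have "f p \<noteq> f q"
  proof -
    have "q \<notin> ?K"
    proof
      assume "q \<in> ?K"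
      then obtain y where y: "y \<in> cball (cmap c p) r" "q = cinv c y" by blast
      then obtain z where "z \<in> cdom c" "z \<noteq> q" "y = cmap c z" using K by blast
      then show False using y(2) cinv_cmap[OF c(1)] by simp
    qed
    then have "f q = 0" by (rule f_0)
    moreover have "f p > 0" using c(2) r bump_center[of r "cmap c p"] by (simp add: f_def)
    ultimately show ?thesis by simp
  qed
  ultimately show thesis using that by blast
qed

text \<open>The dimension is at least 1 because index types are nonempty, so a coordinate ball
  contains a second point. It yields a nonconstant function and with it a closed form of norm
  1.\<close>

lemma two_points: "\<exists>p q :: 'm. p \<noteq> q"
proof -
  obtain c where c: "c \<in> A" "(undefined :: 'm) \<in> cdom c" using chart_around .
  obtain r where r: "r > 0" "ball (cmap c undefined) r \<subseteq> cmap c ` cdom c"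
    using chart_ball[OF c open_UNIV] by auto
  let ?x = "cmap c undefined"
  let ?y = "?x + (r / 2) *\<^sub>R axis undefined 1"
  have "?x \<in> cmap c ` cdom c" "?y \<in> cmap c ` cdom c"
    using r by (auto simp: dist_norm norm_axis_1 intro!: subsetD[OF r(2)])
  moreover have "?x \<noteq> ?y" using r(1) by (simp add: axis_eq_0_iff)
  ultimately show ?thesis by (metis imageE)
qed

section \<open>The \<open>L\<^sup>2\<close> norm\<close>

lemma continuous_integrable:
  fixes F :: "'m \<Rightarrow> real"
  assumes F: "continuous_on UNIV F" and \<mu>: "finite_measure \<mu>" "sets \<mu> = sets borel"
  shows "integrable \<mu> F"
proof -
  have "bounded (range F)"
    by (intro compact_imp_bounded compact_continuous_image F compact_M)
  then obtain B where B: "\<And>x. norm (F x) \<le> B" unfolding bounded_iff by blast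
  have "F \<in> borel_measurable \<mu>"
    using borel_measurable_continuous_onI[OF F] measurable_cong_sets[OF \<mu>(2) refl] by blast
  then show ?thesis by (intro finite_measure.integrable_const_bound[OF \<mu>(1), of F B]) (use B in auto)
qed

lemma riemannian_measure:
  assumes "riemannian_metric A g"
  defines "\<mu> \<equiv> volume_measure A (riemannian_volume g)"
  shows "finite_measure \<mu>" "sets \<mu> = sets borel" "\<lbrakk>open U; U \<noteq> {}\<rbrakk> \<Longrightarrow> emeasure \<mu> U \<noteq> 0"
proof -
  note \<rho> = riemannian_volume_density[OF assms(1)]
  have \<mu>: "is_volume_measure (\<lambda>c x. riemannian_volume g c x (mat 1)) \<mu>"
    unfolding \<mu>_def by (rule volume_measure[where \<omega> = "riemannian_volume g", OF \<rho>])
  show "finite_measure \<mu>" by (rule volume_measure_finite[OF \<rho> \<mu>])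
  show "sets \<mu> = sets borel" using \<mu> unfolding is_volume_measure_def by blast
  show "\<lbrakk>open U; U \<noteq> {}\<rbrakk> \<Longrightarrow> emeasure \<mu> U \<noteq> 0" by (rule volume_measure_open_pos[OF \<rho> \<mu>])
qed

text \<open>The open set where the continuous pointwise norm is nonzero is null, hence empty, as
  nonempty open sets have positive measure.\<close>

lemma L2_norm_eq_0:
  assumes g: "riemannian_metric A g" and \<alpha>: "smooth_one_form A \<alpha>" and 0: "L2_norm_form A g \<alpha> = 0"
  shows "form_sqnorm A g \<alpha> p = 0"
proof -
  let ?\<mu> = "volume_measure A (riemannian_volume g)" and ?F = "form_sqnorm A g \<alpha>"
  note \<mu> = riemannian_measure[OF g]
  note cont = form_sqnorm_continuous[OF g \<alpha>]
  have "(\<integral>p. ?F p \<partial>?\<mu>) = 0" using 0 by (simp add: L2_norm_form_def)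
  \<comment> \<open>Integrability matters here: the integral of a nonintegrable function is 0 by
    default.\<close>
  moreover have "integrable ?\<mu> ?F" by (rule continuous_integrable[OF cont \<mu>(1,2)])
  ultimately have "AE p in ?\<mu>. ?F p = 0"
    using integral_nonneg_eq_0_iff_AE[of ?\<mu> ?F] form_sqnorm_nonneg[OF g \<alpha>] by simp
  let ?U = "{p. ?F p \<noteq> 0}"
  have U: "open ?U"
    by (rule open_Collect_neq[OF cont continuous_on_const])
  have space: "space ?\<mu> = UNIV" using sets_eq_imp_space_eq[OF \<mu>(2)] by simp
  have "?U \<in> null_sets ?\<mu>"
    using \<open>AE p in ?\<mu>. ?F p = 0\<close> U \<mu>(2) by (subst AE_iff_null_sets) auto
  then have "emeasure ?\<mu> ?U = 0" by blast
  then have "?U = {}" using \<mu>(3)[OF U] by blast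
  then show ?thesis by blast
qed

lemma form_sqnorm_scale:
  assumes g: "riemannian_metric A g" and f: "smooth_function f"
  shows "form_sqnorm A g (exact_form (\<lambda>p. k * f p)) p = k\<^sup>2 * form_sqnorm A g (exact_form f) p"
proof -
  obtain c where c: "c \<in> A" "p \<in> cdom c" using chart_around .
  then have x: "cmap c p \<in> cmap c ` cdom c" by blast
  have "((\<lambda>x. k * (f \<circ> cinv c) x) has_derivative (\<lambda>v. k * exact_form f c (cmap c p) v)) (at (cmap c p))"
    by (rule has_derivative_mult_right[OF exact_form_has_derivative[OF f c(1) x]])
  from frechet_derivative_at[OF this]
  have eq: "exact_form (\<lambda>p. k * f p) c (cmap c p) = (\<lambda>v. k * exact_form f c (cmap c p) v)"
    by (simp add: exact_form_def comp_def)
  let ?a = "\<chi> i. exact_form f c (cmap c p) (axis i 1)"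
  have "(\<chi> i. k * exact_form f c (cmap c p) (axis i 1)) = k *\<^sub>R ?a" by (simp add: vec_eq_iff)
  then have "chart_sqnorm g (exact_form (\<lambda>p. k * f p)) c (cmap c p) = k\<^sup>2 * chart_sqnorm g (exact_form f) c (cmap c p)"
    by (simp add: chart_sqnorm_def Let_def eq matrix_vector_mult_scaleR power2_eq_square)
  then show ?thesis
    by (simp add: form_sqnorm_eq[OF g smooth_exact_form[OF f] c]
        form_sqnorm_eq[OF g smooth_exact_form[OF smooth_function_scale[OF f]] c])
qed

text \<open>A nonconstant function has a differential of nonzero norm; \<open>k\<close> is the
  reciprocal of that norm.\<close>

lemma unit_exact_form:
  assumes g: "riemannian_metric A g" and f: "smooth_function f" "f p \<noteq> f q"
  obtains k where "k \<noteq> 0" "exact_form (\<lambda>p. k * f p) \<in> unit_closed_forms A g"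
proof -
  let ?N = "L2_norm_form A g (exact_form f)"
  have "?N \<noteq> 0"
  proof
    assume "?N = 0"
    note 0 = L2_norm_eq_0[OF g smooth_exact_form[OF f(1)] this]
    have "f p = f q"
      by (rule exact_form_eq_0_imp_const[OF f(1)]) (rule form_sqnorm_eq_0[OF g smooth_exact_form[OF f(1)] 0])
    with f(2) show False by blast
  qed
  then have N: "?N > 0"
    using form_sqnorm_nonneg[OF g smooth_exact_form[OF f(1)]]
    by (simp add: L2_norm_form_def order_less_le)
  have "L2_norm_form A g (exact_form (\<lambda>p. (1 / ?N) * f p)) = sqrt ((1 / ?N)\<^sup>2) * ?N"
    unfolding L2_norm_form_def form_sqnorm_scale[OF g f(1)] by (simp add: real_sqrt_mult)
  also have "\<dots> = 1" using N by simp
  finally show thesis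
    using that[of "1 / ?N"] N closed_exact_form[OF smooth_function_scale[OF f(1), of "1 / ?N"]]
    by (simp add: unit_closed_forms_def)
qed

section \<open>The norm\<close>

text \<open>The cocycle identity integrated over \<open>y\<close>: invariance of
  \<open>\<mu>\<close> removes \<open>k\<close> from the second argument, while the base point
  becomes \<open>k z\<close>.\<close>

lemma mean_displacement_comp:
  assumes \<alpha>: "closed_one_form A \<alpha>" and h: "displacement_welldefined \<alpha> h" and k: "displacement_welldefined \<alpha> k"
    and \<mu>: "finite_measure \<mu>" "sets \<mu> = sets borel" "distr \<mu> \<mu> k = \<mu>"
  shows "(\<integral>y. displacement A \<alpha> (h \<circ> k) z y \<partial>\<mu>)
    = (\<integral>y. displacement A \<alpha> h (k z) y \<partial>\<mu>) + (\<integral>y. displacement A \<alpha> k z y \<partial>\<mu>)"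
proof -
  have k_cont: "continuous_on UNIV k" using k by (simp add: displacement_welldefined_def)
  have cont: "continuous_on UNIV (\<lambda>y. displacement A \<alpha> h (k z) (k y))"
    using continuous_on_compose2[OF displacement_continuous[OF \<alpha> h] k_cont] by blast
  have "k \<in> measurable borel borel" by (rule borel_measurable_continuous_onI[OF k_cont])
  then have k_meas: "k \<in> measurable \<mu> \<mu>" using measurable_cong_sets[OF \<mu>(2,2)] by blast
  have "displacement A \<alpha> h (k z) \<in> borel_measurable borel"
    by (rule borel_measurable_continuous_onI[OF displacement_continuous[OF \<alpha> h]])
  then have d_meas: "displacement A \<alpha> h (k z) \<in> borel_measurable \<mu>"
    using measurable_cong_sets[OF \<mu>(2) refl] by blast
  have "(\<integral>y. displacement A \<alpha> h (k z) y \<partial>\<mu>) = (\<integral>y. displacement A \<alpha> h (k z) (k y) \<partial>\<mu>)"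
    using integral_distr[OF k_meas d_meas] \<mu>(3) by simp
  then show ?thesis
    unfolding displacement_comp[OF h k]
    using continuous_integrable[OF cont \<mu>(1,2)]
      continuous_integrable[OF displacement_continuous[OF \<alpha> k] \<mu>(1,2), of z] by simp
qed

end

theorem proposition3p18:
  fixes A :: "('m::{t2_space, second_countable_topology}, 'n::{finite, wellorder}) chart set"
    and g :: "('m, 'n) two_tensor"
    and \<Omega> :: "('m, 'n) top_form"
  assumes "closed_connected_oriented_manifold A"
    and "riemannian_metric A g"
    and "volume_form A \<Omega>"
    and "emeasure (volume_measure A \<Omega>) UNIV = 1"
  shows "(\<forall>h \<in> volume_homeos_0 A \<Omega>. norm_infty_0 A g \<Omega> h \<ge> 0) \<and>
         (\<forall>h \<in> volume_homeos_0 A \<Omega>. \<forall>k \<in> volume_homeos_0 A \<Omega>.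
            norm_infty_0 A g \<Omega> (h \<circ> k) \<le> norm_infty_0 A g \<Omega> h + norm_infty_0 A g \<Omega> k) \<and>
         (\<forall>h \<in> volume_homeos_0 A \<Omega>. norm_infty_0 A g \<Omega> (inv h) = norm_infty_0 A g \<Omega> h) \<and>
         (\<forall>h \<in> volume_homeos_0 A \<Omega>. norm_infty_0 A g \<Omega> h = 0 \<longrightarrow> h = id)"
proof -
  interpret manifold A by unfold_locales (rule assms(1))
  note g = assms(2)
  let ?\<mu> = "volume_measure A \<Omega>" and ?N = "norm_infty_0 A g \<Omega>" and ?U = "unit_closed_forms A g"
  define \<Phi> where "\<Phi> \<alpha> h z = (\<integral>y. displacement A \<alpha> h z y \<partial>?\<mu>)" for \<alpha> :: "('m, 'n) one_form" and h z
  note \<rho> = volume_form_density[OF assms(3)]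
  have vm: "is_volume_measure (\<lambda>c x. \<Omega> c x (mat 1)) ?\<mu>" by (rule volume_measure[where \<omega> = \<Omega>, OF \<rho>])
  have fin: "finite_measure ?\<mu>" by (rule volume_measure_finite[OF \<rho> vm])
  have sets: "sets ?\<mu> = sets borel" using vm unfolding is_volume_measure_def by blast
  have space: "space ?\<mu> = UNIV" using sets_eq_imp_space_eq[OF sets] by simp
  have closed: "closed_one_form A \<alpha>" if "\<alpha> \<in> ?U" for \<alpha>
    using that by (simp add: unit_closed_forms_def)
  have wd: "displacement_welldefined \<alpha> h" if "\<alpha> \<in> ?U" "h \<in> volume_homeos_0 A \<Omega>" for \<alpha> h
    by (rule displacement_welldefined_volume_homeos_0[OF closed[OF that(1)] that(2)])
  have homeo: "homeomorphism UNIV UNIV h (inv h)" "distr ?\<mu> ?\<mu> h = ?\<mu>" if "h \<in> volume_homeos_0 A \<Omega>" for h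
    using that volume_homeos_0_subset[of \<Omega>] by (auto simp: volume_homeos_def)
  have N_upper: "ereal \<bar>\<Phi> \<alpha> h z\<bar> \<le> ?N h" if "\<alpha> \<in> ?U" for \<alpha> h z
    unfolding norm_infty_0_def \<Phi>_def by (rule SUP_upper2[OF that]) (rule SUP_upper[OF UNIV_I])
  have N_least: "?N h \<le> b" if "\<And>\<alpha> z. \<alpha> \<in> ?U \<Longrightarrow> ereal \<bar>\<Phi> \<alpha> h z\<bar> \<le> b" for h b
    unfolding norm_infty_0_def by (intro SUP_least) (use that in \<open>simp add: \<Phi>_def\<close>)
  have comp: "\<Phi> \<alpha> (h \<circ> k) z = \<Phi> \<alpha> h (k z) + \<Phi> \<alpha> k z"
    if "\<alpha> \<in> ?U" "displacement_welldefined \<alpha> h" "k \<in> volume_homeos_0 A \<Omega>" for \<alpha> h k z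
    unfolding \<Phi>_def
    by (rule mean_displacement_comp[OF closed[OF that(1)] that(2) wd[OF that(1,3)] fin sets homeo(2)[OF that(3)]])
  have inv: "\<Phi> \<alpha> (inv h) (h z) = - \<Phi> \<alpha> h z" if \<alpha>: "\<alpha> \<in> ?U" and h: "h \<in> volume_homeos_0 A \<Omega>" for \<alpha> h z
  proof -
    have inv_h: "inv h \<circ> h = id" using homeo(1)[OF h] by (auto simp: homeomorphism_def)
    have wd_inv: "displacement_welldefined \<alpha> (inv h)"
      by (rule displacement_welldefined_inv[OF wd[OF \<alpha> h] homeo(1)[OF h]])
    \<comment> \<open>By the cocycle identity the displacements of \<open>inv h\<close> and
      \<open>h\<close> add up along \<open>inv h \<circ> h\<close>, and
      \<open>displacement_inv\<close> makes them cancel.\<close>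
    have "displacement A \<alpha> (inv h \<circ> h) z y = 0" for y
      using displacement_inv[OF wd[OF \<alpha> h] homeo(1)[OF h], of "h z" "h y"] pointfree_idE[OF inv_h]
      unfolding displacement_comp[OF wd_inv wd[OF \<alpha> h]] by simp
    then have "\<Phi> \<alpha> (inv h \<circ> h) z = 0" by (simp add: \<Phi>_def)
    then show ?thesis using comp[OF \<alpha> wd_inv h, of z] by simp
  qed
  have nonneg: "?N h \<ge> 0" for h
  proof -
    obtain p q :: 'm where "p \<noteq> q" using two_points by blast
    then obtain f where f: "smooth_function f" "f p \<noteq> f q" using smooth_function_separates by blast
    obtain k where "exact_form (\<lambda>p. k * f p) \<in> ?U" using unit_exact_form[OF g f] by blast
    from order_trans[OF _ N_upper[OF this, of h p]] show ?thesis by simp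
  qed
  have triangle: "?N (h \<circ> k) \<le> ?N h + ?N k"
    if h: "h \<in> volume_homeos_0 A \<Omega>" and k: "k \<in> volume_homeos_0 A \<Omega>" for h k
  proof (rule N_least)
    fix \<alpha> z assume \<alpha>: "\<alpha> \<in> ?U"
    \<comment> \<open>The first term has the shifted base point \<open>k z\<close>, which is
      harmless since the norm takes the supremum over all base points.\<close>
    have "ereal \<bar>\<Phi> \<alpha> (h \<circ> k) z\<bar> \<le> ereal \<bar>\<Phi> \<alpha> h (k z)\<bar> + ereal \<bar>\<Phi> \<alpha> k z\<bar>"
      unfolding comp[OF \<alpha> wd[OF \<alpha> h] k] by simp
    also have "\<dots> \<le> ?N h + ?N k" by (intro add_mono N_upper \<alpha>)
    finally show "ereal \<bar>\<Phi> \<alpha> (h \<circ> k) z\<bar> \<le> ?N h + ?N k" .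
  qed
  have inverse: "?N (inv h) = ?N h" if h: "h \<in> volume_homeos_0 A \<Omega>" for h
  proof (rule antisym)
    \<comment> \<open>Both inequalities use \<open>inv\<close>, with base points exchanged between
      \<open>z\<close> and \<open>h z\<close>; surjectivity lets every base point occur as some
      \<open>h z\<close>.\<close>
    have surj: "h (inv h z) = z" for z using homeo(1)[OF h] by (auto simp: homeomorphism_def)
    show "?N (inv h) \<le> ?N h"
    proof (rule N_least)
      fix \<alpha> z assume \<alpha>: "\<alpha> \<in> ?U"
      show "ereal \<bar>\<Phi> \<alpha> (inv h) z\<bar> \<le> ?N h"
        using inv[OF \<alpha> h, of "inv h z"] N_upper[OF \<alpha>, of h "inv h z"] by (simp add: surj)
    qed
    show "?N h \<le> ?N (inv h)"
    proof (rule N_least)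
      fix \<alpha> z assume \<alpha>: "\<alpha> \<in> ?U"
      show "ereal \<bar>\<Phi> \<alpha> h z\<bar> \<le> ?N (inv h)"
        using inv[OF \<alpha> h, of z] N_upper[OF \<alpha>, of "inv h" "h z"] by simp
    qed
  qed
  have faithful: "h = id" if h: "h \<in> volume_homeos_0 A \<Omega>" and 0: "?N h = 0" for h
  proof (rule ccontr)
    assume "h \<noteq> id"
    then obtain z where "h z \<noteq> z" by (auto simp: fun_eq_iff)
    then obtain f where f: "smooth_function f" "f (h z) \<noteq> f z" using smooth_function_separates by blast
    obtain k where k: "k \<noteq> 0" "exact_form (\<lambda>p. k * f p) \<in> ?U" using unit_exact_form[OF g f] by blast
    define F where "F = (\<lambda>p. k * f p)"
    have F: "smooth_function F" "F (h z) \<noteq> F z" "exact_form F \<in> ?U"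
      using smooth_function_scale[OF f(1)] f(2) k by (auto simp: F_def)
    note prim = local_primitive_exact_form[OF F(1)]
    have F_cont: "continuous_on UNIV F" by (rule local_primitive_continuous[OF prim])
    have h_cont: "continuous_on UNIV h" using homeo(1)[OF h] by (simp add: homeomorphism_def)
    have Fh_cont: "continuous_on UNIV (\<lambda>y. F (h y))"
      using continuous_on_compose2[OF F_cont h_cont] by blast
    note int = continuous_integrable[OF F_cont fin sets] continuous_integrable[OF Fh_cont fin sets]
    have h_meas: "h \<in> measurable ?\<mu> ?\<mu>"
      using borel_measurable_continuous_onI[OF h_cont] measurable_cong_sets[OF sets sets] by blast
    have "F \<in> borel_measurable ?\<mu>"
      using borel_measurable_continuous_onI[OF F_cont] measurable_cong_sets[OF sets refl] by blast
    from integral_distr[OF h_meas this, unfolded homeo(2)[OF h]]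
    have mean: "(\<integral>y. F (h y) \<partial>?\<mu>) = (\<integral>y. F y \<partial>?\<mu>)" by (rule sym)
    have mass: "measure ?\<mu> (space ?\<mu>) = 1" using assms(4) space by (simp add: measure_def)
    have "\<Phi> (exact_form F) h z = (\<integral>y. (F (h y) - F y) - (F (h z) - F z) \<partial>?\<mu>)"
      unfolding \<Phi>_def displacement_exact[OF prim wd[OF F(3) h]] ..
    \<comment> \<open>Invariance makes the first integral 0, and total mass 1 turns the second into
      its constant integrand.\<close>
    also have "\<dots> = (\<integral>y. F (h y) - F y \<partial>?\<mu>) - (\<integral>y. F (h z) - F z \<partial>?\<mu>)"
      by (intro Bochner_Integration.integral_diff Bochner_Integration.integrable_diff int
          finite_measure.integrable_const[OF fin])
    also have "\<dots> = - (F (h z) - F z)"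
      using mass by (simp add: Bochner_Integration.integral_diff[OF int(2,1)] mean)
    finally have "\<bar>\<Phi> (exact_form F) h z\<bar> > 0" using F(2) by simp
    then show False using N_upper[OF F(3), of h z] 0 by simp
  qed
  show ?thesis
    by (intro conjI ballI impI) (rule nonneg triangle inverse faithful; assumption)+
qed

end
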